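(* Let $R$ be a unital associative (not necessarily commutative) superalgebra, and let $p\ge 1$, $q\ge 0$ be integers. There is a chain homotopy $h:C(M_{p,q}(R))\to C(M_{p,q}(R))$, i.e. a family of linear maps $h^m:C_m(M_{p,q}(R))\to C_{m+1}(M_{p,q}(R))$, $m\ge 0$, such that $$d\circ h+h\circ d=\mathrm{Id}-\mathrm{Inc}\circ\mathrm{Str},$$ that is, $d^{m+1}\circ h^m+h^{m-1}\circ d^m=\mathrm{Id}-\mathrm{Inc}^m\circ\mathrm{Str}^m$ on $C_m(M_{p,q}(R))$ for every $m\ge 0$ (where for $m=0$ the term $h^{-1}\circ d^0$ is zero).
   Context: A superalgebra $R=R_0\oplus R_1$ is a $\mathbb{Z}_2$-graded associative unital algebra over a commutative unital ground ring $k$ (in even degree); $|a|\in\mathbb{Z}_2$ denotes the parity of a homogeneous element $a$. All tensor products are over $k$, and linear means $k$-linear. $M_{p,q}(R)$ is the algebra of $(p+q)\times(p+q)$ matrices over $R$ with ordinary matrix multiplication, graded as follows. Write $A=\begin{pmatrix}A_{11}&A_{12}\\ A_{21}&A_{22}\end{pmatrix}$ with blocks of sizes $p\times p$, $p\times q$, $q\times p$, $q\times q$. $A$ is even if the entries of $A_{11},A_{22}$ are even and those of $A_{12},A_{21}$ are odd; $A$ is odd if the entries of $A_{11},A_{22}$ are odd and those of $A_{12},A_{21}$ are even. The parity of a homogeneous matrix is denoted $|A|$. With this grading $M_{p,q}(R)$ is a unital superalgebra. Hochschild complex $(C(S),d)$ of a superalgebra $S$: $C_m(S)=S^{\otimes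 (m+1)}$ for $m\ge 0$; for $m\ge1$ the face maps $\delta^m_i:C_m(S)\to C_{m-1}(S)$ are the linear maps given on homogeneous elements by $$\delta^m_i(a_0\otimes\dots\otimes a_m)=a_0\otimes\dots\otimes a_ia_{i+1}\otimes\dots\otimes a_m\quad(0\le i<m),$$ $$\delta^m_m(a_0\otimes\dots\otimes a_m)=(-1)^{|a_m|(|a_0|+\dots+|a_{m-1}|)}a_ma_0\otimes a_1\otimes\dots\otimes a_{m-1},$$ and the differential is $d^m=\sum_{i=0}^m(-1)^i\delta^m_i$ (with $d^0=0$). The Dennis supertrace $\mathrm{Str}^m:M_{p,q}(R)^{\otimes (m+1)}\to R^{\otimes (m+1)}$ is the $k$-linear map defined on homogeneous supermatrices $A^0,\dots,A^m$ by $$\mathrm{Str}^m(A^0\otimes\dots\otimes A^m)=\sum_{i_0=1}^{p}\ \sum_{i_1,\dots,i_m=1}^{p+q} A^0_{i_0i_1}\otimes A^1_{i_1i_2}\otimes\dots\otimes A^{m-1}_{i_{m-1}i_m}\otimes A^m_{i_mi_0}+(-1)^{1+|A^0|+\dots+|A^m|}\sum_{i_0=p+1}^{p+q}\ \sum_{i_1,\dots,i_m=1}^{p+q} A^0_{i_0i_1}\otimes A^1_{i_1i_2}\otimes\dots\otimes A^{m-1}_{i_{m-1}i_m}\otimes A^m_{i_mi_0}.$$ For $m=0$ this is the supertrace: $\mathrm{Str}^0(A)=\mathrm{tr}A_{11}+(-1)^{1+|A|}\mathrm{tr}A_{22}$. The map $\mathrm{Inc}^m:R^{\otimes (m+1)}\to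 M_{p,q}(R)^{\otimes (m+1)}$ is the linear map $\mathrm{Inc}^m(a_0\otimes\dots\otimes a_m)=E^{11}(a_0)\otimes\dots\otimes E^{11}(a_m)$, where $E^{11}(a)$ is the matrix whose $(1,1)$ entry is $a$ and whose other entries are $0$. $\mathrm{Str}$ and $\mathrm{Inc}$ denote the families $(\mathrm{Str}^m)_{m\ge 0}$ and $(\mathrm{Inc}^m)_{m\ge 0}$. *)

theory Defs
  imports
    "HOL-Algebra.AbelCoset"
    "HOL-Algebra.Module"
    "HOL-Library.Z2"
    "Jordan_Normal_Form.Matrix"
begin

section \<open>Superalgebras\<close>

text \<open>Parities are elements of the field \<^typ>\<open>bit\<close> with two elements; \<open>homog S e\<close> is the
  submodule of homogeneous elements of parity \<open>e\<close>. The element \<open>0\<close> has both parities.\<close>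

record ('k, 'a) superalgebra = "('k, 'a) module" +
  homog :: "bit \<Rightarrow> 'a set"

locale superalgebra = module K S + S: ring S for K and S (structure) +
  assumes smult_mult_left: "\<lbrakk>c \<in> carrier K; x \<in> carrier S; y \<in> carrier S\<rbrakk>
      \<Longrightarrow> (c \<odot>\<^bsub>S\<^esub> x) \<otimes>\<^bsub>S\<^esub> y = c \<odot>\<^bsub>S\<^esub> (x \<otimes>\<^bsub>S\<^esub> y)"
    and smult_mult_right: "\<lbrakk>c \<in> carrier K; x \<in> carrier S; y \<in> carrier S\<rbrakk>
      \<Longrightarrow> x \<otimes>\<^bsub>S\<^esub> (c \<odot>\<^bsub>S\<^esub> y) = c \<odot>\<^bsub>S\<^esub> (x \<otimes>\<^bsub>S\<^esub> y)"
    and homog_submodule: "submodule (homog S e) K S"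
    and homog_sum: "homog S 0 <+>\<^bsub>S\<^esub> homog S 1 = carrier S"
    and homog_inter: "homog S 0 \<inter> homog S 1 = {\<zero>\<^bsub>S\<^esub>}"
    and one_homog: "\<one>\<^bsub>S\<^esub> \<in> homog S 0"
    and mult_homog: "\<lbrakk>x \<in> homog S e; y \<in> homog S e'\<rbrakk> \<Longrightarrow> x \<otimes>\<^bsub>S\<^esub> y \<in> homog S (e + e')"

text \<open>\<open>signed M e x\<close> is \<open>(-1)\<^sup>e x\<close>.\<close>

definition signed :: "('a, 'b) ring_scheme \<Rightarrow> bit \<Rightarrow> 'a \<Rightarrow> 'a" where
  "signed M e x = (if e = 0 then x else \<ominus>\<^bsub>M\<^esub> x)"

definition matrix_superalgebra ::
    "nat \<Rightarrow> nat \<Rightarrow> ('k, 'a) superalgebra \<Rightarrow> ('k, 'a mat) superalgebra" where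
  "matrix_superalgebra p q R = (let n = p + q in
    \<lparr>carrier = {A \<in> carrier_mat n n. elements_mat A \<subseteq> carrier R},
     monoid.mult = (\<lambda>A B. mat n n (\<lambda>(i, j). \<Oplus>\<^bsub>R\<^esub>l\<in>{..<n}. A $$ (i, l) \<otimes>\<^bsub>R\<^esub> B $$ (l, j))),
     one = mat n n (\<lambda>(i, j). if i = j then \<one>\<^bsub>R\<^esub> else \<zero>\<^bsub>R\<^esub>),
     zero = mat n n (\<lambda>_. \<zero>\<^bsub>R\<^esub>),
     add = (\<lambda>A B. mat n n (\<lambda>(i, j). A $$ (i, j) \<oplus>\<^bsub>R\<^esub> B $$ (i, j))),
     smult = (\<lambda>c A. mat n n (\<lambda>(i, j). c \<odot>\<^bsub>R\<^esub> A $$ (i, j))),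
     homog = (\<lambda>e. {A \<in> carrier_mat n n. \<forall>i<n. \<forall>j<n.
       A $$ (i, j) \<in> homog R (if i < p \<longleftrightarrow> j < p then e else e + 1)})\<rparr>)"


section \<open>Tensor powers of a module\<close>

definition linear_maps ::
    "('k, 'c) ring_scheme \<Rightarrow> ('k, 'a, 'm) module_scheme \<Rightarrow> ('k, 'b, 'n) module_scheme \<Rightarrow> ('a \<Rightarrow> 'b) set"
  where
  "linear_maps K M N = {f \<in> carrier M \<rightarrow> carrier N.
    (\<forall>x\<in>carrier M. \<forall>y\<in>carrier M. f (x \<oplus>\<^bsub>M\<^esub> y) = f x \<oplus>\<^bsub>N\<^esub> f y) \<and>
    (\<forall>c\<in>carrier K. \<forall>x\<in>carrier M. f (c \<odot>\<^bsub>M\<^esub> x) = c \<odot>\<^bsub>N\<^esub> f x)}"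

text \<open>The multiplicative fields \<open>mult\<close> and \<open>one\<close> of the record play no role in a module.\<close>

definition free_module :: "('k, 'c) ring_scheme \<Rightarrow> 'x set \<Rightarrow> ('k, 'x \<Rightarrow> 'k) module" where
  "free_module K X =
    \<lparr>carrier = {\<phi> \<in> UNIV \<rightarrow> carrier K.
       finite {x. \<phi> x \<noteq> \<zero>\<^bsub>K\<^esub>} \<and> {x. \<phi> x \<noteq> \<zero>\<^bsub>K\<^esub>} \<subseteq> X},
     monoid.mult = undefined, one = undefined,
     zero = (\<lambda>x. \<zero>\<^bsub>K\<^esub>),
     add = (\<lambda>\<phi> \<psi> x. \<phi> x \<oplus>\<^bsub>K\<^esub> \<psi> x),
     smult = (\<lambda>c \<phi> x. c \<otimes>\<^bsub>K\<^esub> \<phi> x)\<rparr>"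

definition basis_elem :: "('k, 'c) ring_scheme \<Rightarrow> 'x \<Rightarrow> 'x \<Rightarrow> 'k" where
  "basis_elem K x = (\<lambda>y. if y = x then \<one>\<^bsub>K\<^esub> else \<zero>\<^bsub>K\<^esub>)"

definition submodule_generated ::
    "('k, 'c) ring_scheme \<Rightarrow> ('k, 'a, 'm) module_scheme \<Rightarrow> 'a set \<Rightarrow> 'a set" where
  "submodule_generated K M X = \<Inter>{H. submodule H K M \<and> X \<subseteq> H}"

definition quotient_module ::
    "('k, 'a, 'm) module_scheme \<Rightarrow> 'a set \<Rightarrow> ('k, 'a set) module" where
  "quotient_module M N =
    \<lparr>carrier = a_rcosets\<^bsub>M\<^esub> N,
     monoid.mult = undefined, one = undefined,
     zero = N,
     add = (\<lambda>X Y. X <+>\<^bsub>M\<^esub> Y),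
     smult = (\<lambda>c X. \<Union>x\<in>X. N +>\<^bsub>M\<^esub> (c \<odot>\<^bsub>M\<^esub> x))\<rparr>"

definition tuples :: "('a, 'b) ring_scheme \<Rightarrow> nat \<Rightarrow> 'a list set" where
  "tuples M n = {xs. length xs = n \<and> set xs \<subseteq> carrier M}"

definition multilinear_relations ::
    "('k, 'c) ring_scheme \<Rightarrow> ('k, 'a, 'm) module_scheme \<Rightarrow> nat \<Rightarrow> ('a list \<Rightarrow> 'k) set" where
  "multilinear_relations K M n = (let F = free_module K (tuples M n); e = basis_elem K in
    {e (xs[i := x \<oplus>\<^bsub>M\<^esub> y]) \<ominus>\<^bsub>F\<^esub> (e (xs[i := x]) \<oplus>\<^bsub>F\<^esub> e (xs[i := y])) | xs i x y.
       xs \<in> tuples M n \<and> i < n \<and> x \<in> carrier M \<and> y \<in> carrier M} \<union>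
    {e (xs[i := c \<odot>\<^bsub>M\<^esub> x]) \<ominus>\<^bsub>F\<^esub> (c \<odot>\<^bsub>F\<^esub> e (xs[i := x])) | xs i c x.
       xs \<in> tuples M n \<and> i < n \<and> c \<in> carrier K \<and> x \<in> carrier M})"

definition tensor_kernel ::
    "('k, 'c) ring_scheme \<Rightarrow> ('k, 'a, 'm) module_scheme \<Rightarrow> nat \<Rightarrow> ('a list \<Rightarrow> 'k) set" where
  "tensor_kernel K M n =
    submodule_generated K (free_module K (tuples M n)) (multilinear_relations K M n)"

definition tensor_power ::
    "('k, 'c) ring_scheme \<Rightarrow> ('k, 'a, 'm) module_scheme \<Rightarrow> nat \<Rightarrow> ('k, ('a list \<Rightarrow> 'k) set) module"
  where
  "tensor_power K M n = quotient_module (free_module K (tuples M n)) (tensor_kernel K M n)"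

text \<open>\<open>tensor K M [a\<^sub>1, \<dots>, a\<^sub>n]\<close> is the pure tensor \<open>a\<^sub>1 \<otimes> \<dots> \<otimes> a\<^sub>n\<close> in \<open>tensor_power K M n\<close>.\<close>

definition tensor ::
    "('k, 'c) ring_scheme \<Rightarrow> ('k, 'a, 'm) module_scheme \<Rightarrow> 'a list \<Rightarrow> ('a list \<Rightarrow> 'k) set" where
  "tensor K M xs = tensor_kernel K M (length xs)
     +>\<^bsub>free_module K (tuples M (length xs))\<^esub> basis_elem K xs"

text \<open>The linear map on a tensor power with prescribed values on the pure tensors. It exists and
  is unique when the prescribed values are multilinear in the entries of the tuple; being
  \<open>extensional\<close> only fixes its irrelevant values outside the carrier.\<close>

definition linear_extension ::
    "('k, 'c) ring_scheme \<Rightarrow> ('k, 'a, 'm) module_scheme \<Rightarrow> nat \<Rightarrow> ('k, 'b, 'n) module_scheme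
      \<Rightarrow> ('a list \<Rightarrow> 'b) \<Rightarrow> ('a list \<Rightarrow> 'k) set \<Rightarrow> 'b" where
  "linear_extension K M n T g = (THE f. f \<in> linear_maps K (tensor_power K M n) T \<and>
     f \<in> extensional (carrier (tensor_power K M n)) \<and>
     (\<forall>xs\<in>tuples M n. f (tensor K M xs) = g xs))"

text \<open>The linear map on a tensor power of a superalgebra with prescribed values on the pure
  tensors of homogeneous elements; \<open>g es xs\<close> is the value at \<open>xs\<close> when \<open>xs ! j\<close> has
  parity \<open>es ! j\<close>. It exists and is unique when \<open>g es\<close> is multilinear on tuples of
  homogeneous elements of parities \<open>es\<close>, because the two homogeneous components span.\<close>

definition homog_linear_extension ::
    "('k, 'c) ring_scheme \<Rightarrow> ('k, 'a) superalgebra \<Rightarrow> nat \<Rightarrow> ('k, 'b, 'n) module_scheme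
      \<Rightarrow> (bit list \<Rightarrow> 'a list \<Rightarrow> 'b) \<Rightarrow> ('a list \<Rightarrow> 'k) set \<Rightarrow> 'b" where
  "homog_linear_extension K S n T g = (THE f. f \<in> linear_maps K (tensor_power K S n) T \<and>
     f \<in> extensional (carrier (tensor_power K S n)) \<and>
     (\<forall>es xs. length es = n \<and> length xs = n \<and> (\<forall>j<n. xs ! j \<in> homog S (es ! j))
        \<longrightarrow> f (tensor K S xs) = g es xs))"


section \<open>The Hochschild complex\<close>

definition hochschild ::
    "('k, 'c) ring_scheme \<Rightarrow> ('k, 'a) superalgebra \<Rightarrow> nat \<Rightarrow> ('k, ('a list \<Rightarrow> 'k) set) module" where
  "hochschild K S m = tensor_power K S (Suc m)"

definition hochschild_face ::
    "('k, 'c) ring_scheme \<Rightarrow> ('k, 'a) superalgebra \<Rightarrow> nat \<Rightarrow> nat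
      \<Rightarrow> ('a list \<Rightarrow> 'k) set \<Rightarrow> ('a list \<Rightarrow> 'k) set" where
  "hochschild_face K S m i = homog_linear_extension K S (Suc m) (hochschild K S (m - 1))
    (\<lambda>es as. if i < m
      then tensor K S (take i as @ (as ! i \<otimes>\<^bsub>S\<^esub> as ! (i + 1)) # drop (i + 2) as)
      else signed (hochschild K S (m - 1)) (es ! m * (\<Sum>j<m. es ! j))
             (tensor K S ((as ! m \<otimes>\<^bsub>S\<^esub> as ! 0) # map ((!) as) [1..<m])))"

text \<open>The sign exponent \<open>of_nat i\<close> is the residue of \<open>i\<close> modulo 2.\<close>

definition hochschild_diff ::
    "('k, 'c) ring_scheme \<Rightarrow> ('k, 'a) superalgebra \<Rightarrow> nat
      \<Rightarrow> ('a list \<Rightarrow> 'k) set \<Rightarrow> ('a list \<Rightarrow> 'k) set" where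
  "hochschild_diff K S m x = (if m = 0 then \<zero>\<^bsub>hochschild K S 0\<^esub>
    else \<Oplus>\<^bsub>hochschild K S (m - 1)\<^esub>i\<in>{..m}.
      signed (hochschild K S (m - 1)) (of_nat i) (hochschild_face K S m i x))"


section \<open>Dennis supertrace and inclusion\<close>

text \<open>For an index list \<open>ix = [i\<^sub>0, \<dots>, i\<^sub>m]\<close> this is
  \<open>A\<^sup>0\<^bsub>i\<^sub>0 i\<^sub>1\<^esub> \<otimes> \<dots> \<otimes> A\<^sup>m\<^bsub>i\<^sub>m i\<^sub>0\<^esub>\<close>.\<close>

definition cyclic_tensor ::
    "('k, 'c) ring_scheme \<Rightarrow> ('k, 'a) superalgebra \<Rightarrow> nat \<Rightarrow> 'a mat list \<Rightarrow> nat list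
      \<Rightarrow> ('a list \<Rightarrow> 'k) set" where
  "cyclic_tensor K R m As ix =
    tensor K R (map (\<lambda>j. (As ! j) $$ (ix ! j, ix ! (if j = m then 0 else j + 1))) [0..<Suc m])"

definition index_lists :: "nat \<Rightarrow> nat set \<Rightarrow> nat \<Rightarrow> nat list set" where
  "index_lists m I n = {ix. length ix = Suc m \<and> ix ! 0 \<in> I \<and> (\<forall>j\<in>{1..m}. ix ! j < n)}"

definition Str ::
    "('k, 'c) ring_scheme \<Rightarrow> nat \<Rightarrow> nat \<Rightarrow> ('k, 'a) superalgebra \<Rightarrow> nat
      \<Rightarrow> ('a mat list \<Rightarrow> 'k) set \<Rightarrow> ('a list \<Rightarrow> 'k) set" where
  "Str K p q R m = homog_linear_extension K (matrix_superalgebra p q R) (Suc m) (hochschild K R m)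
    (\<lambda>es As.
      (\<Oplus>\<^bsub>hochschild K R m\<^esub>ix\<in>index_lists m {0..<p} (p + q). cyclic_tensor K R m As ix)
      \<oplus>\<^bsub>hochschild K R m\<^esub>
      signed (hochschild K R m) (1 + (\<Sum>j\<le>m. es ! j))
        (\<Oplus>\<^bsub>hochschild K R m\<^esub>ix\<in>index_lists m {p..<p + q} (p + q). cyclic_tensor K R m As ix))"

text \<open>Indices start at 0, so the entry in the first row and first column has index \<open>(0, 0)\<close>.\<close>

definition E11 :: "nat \<Rightarrow> nat \<Rightarrow> ('k, 'a) superalgebra \<Rightarrow> 'a \<Rightarrow> 'a mat" where
  "E11 p q R a = mat (p + q) (p + q) (\<lambda>(i, j). if i = 0 \<and> j = 0 then a else \<zero>\<^bsub>R\<^esub>)"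

definition Inc ::
    "('k, 'c) ring_scheme \<Rightarrow> nat \<Rightarrow> nat \<Rightarrow> ('k, 'a) superalgebra \<Rightarrow> nat
      \<Rightarrow> ('a list \<Rightarrow> 'k) set \<Rightarrow> ('a mat list \<Rightarrow> 'k) set" where
  "Inc K p q R m = linear_extension K R (Suc m) (hochschild K (matrix_superalgebra p q R) m)
    (\<lambda>as. tensor K (matrix_superalgebra p q R) (map (E11 p q R) as))"

end

theory Submission
  imports Defs
begin

text \<open>
  The homotopy is the alternating sum \<open>h = \<Sum>\<^sub>i (-1)\<^sup>i h\<^sub>i\<close> of the maps that send
  \<open>A\<^sup>0 \<otimes> \<dots> \<otimes> A\<^sup>m\<close> to the sum over all indices \<open>k\<^sub>0, \<dots>, k\<^bsub>i+1\<^esub>\<close> of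
  \<open>E k\<^sub>0 0 (A\<^sup>0 k\<^sub>0 k\<^sub>1) \<otimes> E 0 0 (A\<^sup>1 k\<^sub>1 k\<^sub>2) \<otimes> \<dots> \<otimes> E 0 0 (A\<^sup>i k\<^sub>i k\<^bsub>i+1\<^esub>) \<otimes> E 0 k\<^bsub>i+1\<^esub> 1 \<otimes> A\<^bsup>i+1\<^esup> \<otimes> \<dots> \<otimes> A\<^sup>m\<close>,
  where \<open>E k l a\<close> has the single entry \<open>a\<close> in row \<open>k\<close> and column \<open>l\<close>. It is the classical homotopy
  behind the Morita invariance of Hochschild homology. No sign has to be added, since the total
  parity of the new factors is that of \<open>A\<^sup>0 \<otimes> \<dots> \<otimes> A\<^sup>i\<close>: the parities of the indices cancel in
  pairs. With the faces \<open>\<delta>\<^sub>r\<close>, the \<open>h\<^sub>i\<close> satisfy the relations of a presimplicial homotopy,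
  namely \<open>\<delta>\<^sub>r h\<^sub>i = h\<^bsub>i-1\<^esub> \<delta>\<^sub>r\<close> for \<open>r < i\<close>, \<open>\<delta>\<^sub>i h\<^sub>i = \<delta>\<^sub>i h\<^bsub>i-1\<^esub>\<close>, and \<open>\<delta>\<^sub>r h\<^sub>i = h\<^sub>i \<delta>\<^bsub>r-1\<^esub>\<close> for \<open>r > i + 1\<close>. Hence
  everything in \<open>d h + h d\<close> cancels except \<open>\<delta>\<^sub>0 h\<^sub>0\<close>, which is the identity, and the last face of \<open>h\<^sub>m\<close>.
  The latter multiplies \<open>E 0 k 1\<close> cyclically onto \<open>E k 0 (A\<^sup>0 k l)\<close>, so it produces the inclusion of
  a trace, and moving \<open>E 0 k 1\<close>, which is odd exactly when \<open>k \<ge> p\<close>, past the other factors costs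
  precisely the sign in the supertrace.

  Both sides of the identity are linear, so it suffices to compare them on generators. Matrices
  \<open>E k l a\<close> with homogeneous \<open>a\<close> generate the matrix superalgebra additively
  (\<open>elementary_generates\<close>, \<open>linear_maps_eq_on_generators\<close>). On a tensor product of such matrices every
  index sum collapses to at most one term, each of the maps involved returns a single such tensor
  product up to sign, or zero, and the relations become bookkeeping about lists of indices
  (\<open>face_homotopy_low\<close>, \<open>face_homotopy_diagonal\<close>, \<open>face_homotopy_high\<close>, \<open>face_homotopy_last\<close>,
  \<open>face_homotopy_first\<close>, \<open>face_homotopy_corner\<close>). The cancellation itself is
  \<open>presimplicial_homotopy_cancellation\<close>.

  The maps are given by their values on pure tensors, for the faces and the supertrace even only on
  homogeneous ones. That these values determine linear maps is the universal property of the tensor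
  power (\<open>tensor_power_lift\<close>) together with the splitting of a graded module into its homogeneous
  parts (\<open>homog_linear_extension_exists\<close>).
\<close>

section \<open>Linear maps and signs\<close>

lemma linear_mapsI:
  assumes "\<And>x. x \<in> carrier M \<Longrightarrow> f x \<in> carrier N"
    and "\<And>x y. \<lbrakk>x \<in> carrier M; y \<in> carrier M\<rbrakk> \<Longrightarrow> f (x \<oplus>\<^bsub>M\<^esub> y) = f x \<oplus>\<^bsub>N\<^esub> f y"
    and "\<And>c x. \<lbrakk>c \<in> carrier K; x \<in> carrier M\<rbrakk> \<Longrightarrow> f (c \<odot>\<^bsub>M\<^esub> x) = c \<odot>\<^bsub>N\<^esub> f x"
  shows "f \<in> linear_maps K M N"
  using assms by (auto simp: linear_maps_def)

lemma linear_mapsD: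
  assumes "f \<in> linear_maps K M N"
  shows linear_maps_closed: "x \<in> carrier M \<Longrightarrow> f x \<in> carrier N"
    and linear_maps_add: "\<lbrakk>x \<in> carrier M; y \<in> carrier M\<rbrakk> \<Longrightarrow> f (x \<oplus>\<^bsub>M\<^esub> y) = f x \<oplus>\<^bsub>N\<^esub> f y"
    and linear_maps_smult:
      "\<lbrakk>c \<in> carrier K; x \<in> carrier M\<rbrakk> \<Longrightarrow> f (c \<odot>\<^bsub>M\<^esub> x) = c \<odot>\<^bsub>N\<^esub> f x"
  using assms by (auto simp: linear_maps_def)

lemma linear_maps_id: "(\<lambda>x. x) \<in> linear_maps K M M"
  by (rule linear_mapsI) auto

lemma linear_maps_compose:
  assumes "f \<in> linear_maps K M N" and "g \<in> linear_maps K N T"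
  shows "(\<lambda>x. g (f x)) \<in> linear_maps K M T"
  using linear_mapsD[OF assms(1)] linear_mapsD[OF assms(2)] by (intro linear_mapsI) auto

lemma linear_maps_zero:
  assumes "module K M" "module K N" "f \<in> linear_maps K M N"
  shows "f \<zero>\<^bsub>M\<^esub> = \<zero>\<^bsub>N\<^esub>"
proof -
  interpret M: module K M by fact
  interpret N: module K N by fact
  have "f \<zero>\<^bsub>M\<^esub> = f (\<zero>\<^bsub>K\<^esub> \<odot>\<^bsub>M\<^esub> \<zero>\<^bsub>M\<^esub>)" by simp
  also have "\<dots> = \<zero>\<^bsub>K\<^esub> \<odot>\<^bsub>N\<^esub> f \<zero>\<^bsub>M\<^esub>"
    by (rule linear_maps_smult[OF assms(3)]) auto
  also have "\<dots> = \<zero>\<^bsub>N\<^esub>"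
    using linear_maps_closed[OF assms(3), of "\<zero>\<^bsub>M\<^esub>"] by simp
  finally show ?thesis .
qed

lemma linear_maps_cong:
  assumes "module K M" "f \<in> linear_maps K M N" "\<And>x. x \<in> carrier M \<Longrightarrow> f x = g x"
  shows "g \<in> linear_maps K M N"
proof -
  interpret M: module K M by fact
  show ?thesis
    using linear_mapsD[OF assms(2)] by (intro linear_mapsI) (simp_all flip: assms(3))
qed

lemma linear_maps_neg:
  assumes "module K M" "module K N" "f \<in> linear_maps K M N" "x \<in> carrier M"
  shows "f (\<ominus>\<^bsub>M\<^esub> x) = \<ominus>\<^bsub>N\<^esub> f x"
proof -
  interpret M: module K M by fact
  interpret N: module K N by fact
  have "f (\<ominus>\<^bsub>M\<^esub> x) \<oplus>\<^bsub>N\<^esub> f x = f (\<ominus>\<^bsub>M\<^esub> x \<oplus>\<^bsub>M\<^esub> x)"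
    using linear_maps_add[OF assms(3)] assms(4) by simp
  also have "\<dots> = \<zero>\<^bsub>N\<^esub>"
    using assms(4) linear_maps_zero[OF assms(1-3)] by (simp add: M.l_neg)
  finally show ?thesis
    using linear_maps_closed[OF assms(3)] assms(4) by (simp add: N.minus_equality)
qed

lemma linear_maps_finsum:
  assumes "module K M" "module K N" "f \<in> linear_maps K M N" "\<And>i. i \<in> I \<Longrightarrow> u i \<in> carrier M"
  shows "f (\<Oplus>\<^bsub>M\<^esub>i\<in>I. u i) = (\<Oplus>\<^bsub>N\<^esub>i\<in>I. f (u i))"
proof -
  interpret M: module K M by fact
  interpret N: module K N by fact
  show ?thesis
    using assms(4)
  proof (induct I rule: infinite_finite_induct)
    case (insert i I)
    have u: "u \<in> I \<rightarrow> carrier M" "u i \<in> carrier M"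
      and fu: "(\<lambda>i. f (u i)) \<in> I \<rightarrow> carrier N" "f (u i) \<in> carrier N"
      using insert(4) linear_maps_closed[OF assms(3)] by auto
    have "f (\<Oplus>\<^bsub>M\<^esub>i\<in>insert i I. u i) = f (u i \<oplus>\<^bsub>M\<^esub> (\<Oplus>\<^bsub>M\<^esub>i\<in>I. u i))"
      using insert u by (simp add: M.finsum_insert)
    also have "\<dots> = f (u i) \<oplus>\<^bsub>N\<^esub> f (\<Oplus>\<^bsub>M\<^esub>i\<in>I. u i)"
      using u by (intro linear_maps_add[OF assms(3)]) auto
    finally show ?case
      using insert fu by (simp add: N.finsum_insert)
  qed (auto simp: linear_maps_zero[OF assms(1-3)])
qed

lemma signed_closed:
  assumes "module K M" "x \<in> carrier M"
  shows "signed M e x \<in> carrier M"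
proof -
  interpret M: module K M by fact
  show ?thesis using assms(2) by (simp add: signed_def)
qed

lemma signed_signed:
  assumes "module K M" "x \<in> carrier M"
  shows "signed M e (signed M e' x) = signed M (e + e') x"
proof -
  interpret M: module K M by fact
  show ?thesis using assms(2) by (cases e; cases e') (simp_all add: signed_def)
qed

lemma signed_zero:
  assumes "module K M"
  shows "signed M e \<zero>\<^bsub>M\<^esub> = \<zero>\<^bsub>M\<^esub>"
proof -
  interpret M: module K M by fact
  show ?thesis by (simp add: signed_def)
qed

lemma linear_maps_signed:
  assumes "module K M" "module K N" "f \<in> linear_maps K M N" "x \<in> carrier M"
  shows "f (signed M e x) = signed N e (f x)"
  using linear_maps_neg[OF assms] by (simp add: signed_def)

lemma signed_linear:
  assumes "module K M"
  shows "signed M e \<in> linear_maps K M M"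
proof -
  interpret M: module K M by fact
  show ?thesis
    by (rule linear_mapsI) (auto simp: signed_def M.minus_add M.smult_r_minus)
qed

lemma finsum_linear_maps:
  assumes "module K N" "\<And>i. i \<in> I \<Longrightarrow> f i \<in> linear_maps K M N"
  shows "(\<lambda>x. \<Oplus>\<^bsub>N\<^esub>i\<in>I. f i x) \<in> linear_maps K M N"
proof -
  interpret N: module K N by fact
  note f = linear_mapsD[OF assms(2)]
  show ?thesis
  proof (rule linear_mapsI)
    show "(\<Oplus>\<^bsub>N\<^esub>i\<in>I. f i x) \<in> carrier N" if "x \<in> carrier M" for x
      using f(1) that by (intro N.finsum_closed) auto
    show "(\<Oplus>\<^bsub>N\<^esub>i\<in>I. f i (x \<oplus>\<^bsub>M\<^esub> y)) = (\<Oplus>\<^bsub>N\<^esub>i\<in>I. f i x) \<oplus>\<^bsub>N\<^esub> (\<Oplus>\<^bsub>N\<^esub>i\<in>I. f i y)"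
      if "x \<in> carrier M" "y \<in> carrier M" for x y
    proof -
      have "(\<Oplus>\<^bsub>N\<^esub>i\<in>I. f i (x \<oplus>\<^bsub>M\<^esub> y)) = (\<Oplus>\<^bsub>N\<^esub>i\<in>I. f i x \<oplus>\<^bsub>N\<^esub> f i y)"
        using f that by (intro N.finsum_cong') auto
      also have "\<dots> = (\<Oplus>\<^bsub>N\<^esub>i\<in>I. f i x) \<oplus>\<^bsub>N\<^esub> (\<Oplus>\<^bsub>N\<^esub>i\<in>I. f i y)"
        using f(1) that by (intro N.finsum_addf) auto
      finally show ?thesis .
    qed
    show "(\<Oplus>\<^bsub>N\<^esub>i\<in>I. f i (c \<odot>\<^bsub>M\<^esub> x)) = c \<odot>\<^bsub>N\<^esub> (\<Oplus>\<^bsub>N\<^esub>i\<in>I. f i x)"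
      if "c \<in> carrier K" "x \<in> carrier M" for c x
    proof (cases "finite I")
      case True
      then show ?thesis
        using f that by (subst N.finsum_smult_ldistr) (auto intro!: N.finsum_cong')
    qed (use that in simp)
  qed
qed

lemma add_linear_maps:
  assumes "module K N" "f \<in> linear_maps K M N" "g \<in> linear_maps K M N"
  shows "(\<lambda>x. f x \<oplus>\<^bsub>N\<^esub> g x) \<in> linear_maps K M N"
proof -
  interpret N: module K N by fact
  show ?thesis
    using linear_mapsD[OF assms(2)] linear_mapsD[OF assms(3)]
    by (intro linear_mapsI) (auto simp: N.smult_r_distr N.a_ac)
qed

section \<open>Free modules and quotients\<close>

lemma free_module_module:
  assumes "cring K"
  shows "module K (free_module K X)"
proof -
  interpret K: cring K by fact
  have supp: "finite {x. a x \<oplus>\<^bsub>K\<^esub> b x \<noteq> \<zero>\<^bsub>K\<^esub>} \<and> {x. a x \<oplus>\<^bsub>K\<^esub> b x \<noteq> \<zero>\<^bsub>K\<^esub>} \<subseteq> X"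
    if "finite {x. a x \<noteq> \<zero>\<^bsub>K\<^esub>}" "{x. a x \<noteq> \<zero>\<^bsub>K\<^esub>} \<subseteq> X"
      "finite {x. b x \<noteq> \<zero>\<^bsub>K\<^esub>}" "{x. b x \<noteq> \<zero>\<^bsub>K\<^esub>} \<subseteq> X" for a b
  proof -
    have "{x. a x \<oplus>\<^bsub>K\<^esub> b x \<noteq> \<zero>\<^bsub>K\<^esub>} \<subseteq> {x. a x \<noteq> \<zero>\<^bsub>K\<^esub>} \<union> {x. b x \<noteq> \<zero>\<^bsub>K\<^esub>}" by auto
    then show ?thesis using that by (meson finite_UnI finite_subset le_supI order_trans)
  qed
  have supp2: "finite {x. c \<otimes>\<^bsub>K\<^esub> b x \<noteq> \<zero>\<^bsub>K\<^esub>} \<and> {x. c \<otimes>\<^bsub>K\<^esub> b x \<noteq> \<zero>\<^bsub>K\<^esub>} \<subseteq> X"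
    if "finite {x. b x \<noteq> \<zero>\<^bsub>K\<^esub>}" "{x. b x \<noteq> \<zero>\<^bsub>K\<^esub>} \<subseteq> X" "c \<in> carrier K" for b c
  proof -
    have "{x. c \<otimes>\<^bsub>K\<^esub> b x \<noteq> \<zero>\<^bsub>K\<^esub>} \<subseteq> {x. b x \<noteq> \<zero>\<^bsub>K\<^esub>}" using that by auto
    then show ?thesis using that by (meson finite_subset order_trans)
  qed
  show ?thesis
  proof (rule moduleI)
    show "abelian_group (free_module K X)"
    proof (rule abelian_groupI, goal_cases)
      case (6 a)
      show ?case
      proof (rule bexI[of _ "\<lambda>x. \<ominus>\<^bsub>K\<^esub> a x"])
        show "(\<lambda>x. \<ominus>\<^bsub>K\<^esub> a x) \<oplus>\<^bsub>free_module K X\<^esub> a = \<zero>\<^bsub>free_module K X\<^esub>"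
          using 6 by (auto simp: free_module_def K.l_neg Pi_iff)
        have "{x. \<ominus>\<^bsub>K\<^esub> a x \<noteq> \<zero>\<^bsub>K\<^esub>} \<subseteq> {x. a x \<noteq> \<zero>\<^bsub>K\<^esub>}" by auto
        then show "(\<lambda>x. \<ominus>\<^bsub>K\<^esub> a x) \<in> carrier (free_module K X)"
          using 6 unfolding free_module_def
          by (auto simp: Pi_iff intro: finite_subset)
      qed
    qed (use supp in \<open>auto simp: free_module_def Pi_iff K.a_ac\<close>)
  qed (use supp2 in \<open>auto simp: free_module_def Pi_iff K.l_distr K.r_distr K.m_assoc assms\<close>)
qed

lemma basis_elem_closed:
  assumes "cring K" "x \<in> X"
  shows "basis_elem K x \<in> carrier (free_module K X)"
proof -
  interpret K: cring K by fact
  have "{y. basis_elem K x y \<noteq> \<zero>\<^bsub>K\<^esub>} \<subseteq> {x}" by (auto simp: basis_elem_def)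
  then have "finite {y. basis_elem K x y \<noteq> \<zero>\<^bsub>K\<^esub>}" "{y. basis_elem K x y \<noteq> \<zero>\<^bsub>K\<^esub>} \<subseteq> X"
    using assms(2) by (auto intro: finite_subset)
  then show ?thesis by (auto simp: free_module_def basis_elem_def)
qed

text \<open>Induction on the size of the support: split off one basis element at a time.\<close>

lemma free_module_spanned:
  assumes "cring K" "submodule H K (free_module K X)" "\<And>x. x \<in> X \<Longrightarrow> basis_elem K x \<in> H"
  shows "carrier (free_module K X) \<subseteq> H"
proof
  interpret K: cring K by fact
  let ?F = "free_module K X"
  interpret F: module K ?F by (rule free_module_module) fact
  note H = F.submoduleE[OF assms(2)]
  fix \<phi> assume "\<phi> \<in> carrier ?F"
  then show "\<phi> \<in> H"
  proof (induct "card {x. \<phi> x \<noteq> \<zero>\<^bsub>K\<^esub>}" arbitrary: \<phi>)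
    case 0
    then have "\<phi> = \<zero>\<^bsub>?F\<^esub>" by (auto simp: free_module_def)
    then show ?case using H(1,2) assms(2) by (metis submodule.axioms(1) subgroup.one_closed monoid.simps(2) ring_record_simps(11))
  next
    case (Suc n)
    then obtain x where x: "\<phi> x \<noteq> \<zero>\<^bsub>K\<^esub>" by fastforce
    have fin: "finite {x. \<phi> x \<noteq> \<zero>\<^bsub>K\<^esub>}" and X: "{x. \<phi> x \<noteq> \<zero>\<^bsub>K\<^esub>} \<subseteq> X"
      and cl: "\<And>x. \<phi> x \<in> carrier K"
      using Suc(3) by (auto simp: free_module_def)
    have supp: "{y. (\<phi>(x := \<zero>\<^bsub>K\<^esub>)) y \<noteq> \<zero>\<^bsub>K\<^esub>} = {y. \<phi> y \<noteq> \<zero>\<^bsub>K\<^esub>} - {x}" by auto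
    have "\<phi>(x := \<zero>\<^bsub>K\<^esub>) \<in> carrier ?F"
      using fin X cl by (simp add: free_module_def supp del: fun_upd_apply) auto
    moreover have "n = card {y. (\<phi>(x := \<zero>\<^bsub>K\<^esub>)) y \<noteq> \<zero>\<^bsub>K\<^esub>}"
      unfolding supp using Suc(2) fin x by simp
    ultimately have "\<phi>(x := \<zero>\<^bsub>K\<^esub>) \<in> H" using Suc(1) by blast
    moreover have "\<phi> x \<odot>\<^bsub>?F\<^esub> basis_elem K x \<in> H"
      using H(4) assms(3) cl x X by auto
    ultimately have "\<phi>(x := \<zero>\<^bsub>K\<^esub>) \<oplus>\<^bsub>?F\<^esub> (\<phi> x \<odot>\<^bsub>?F\<^esub> basis_elem K x) \<in> H" by (rule H(5))
    moreover have "\<phi>(x := \<zero>\<^bsub>K\<^esub>) \<oplus>\<^bsub>?F\<^esub> (\<phi> x \<odot>\<^bsub>?F\<^esub> basis_elem K x) = \<phi>"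
      using cl by (auto simp: free_module_def basis_elem_def)
    ultimately show ?case by simp
  qed
qed

lemma free_module_lift:
  assumes "module K T" "\<And>x. x \<in> X \<Longrightarrow> g x \<in> carrier T"
  obtains f where "f \<in> linear_maps K (free_module K X) T"
    and "\<And>x. x \<in> X \<Longrightarrow> f (basis_elem K x) = g x"
proof -
  interpret T: module K T by fact
  let ?F = "free_module K X"
  define f where "f \<phi> = (\<Oplus>\<^bsub>T\<^esub>x\<in>{x. \<phi> x \<noteq> \<zero>\<^bsub>K\<^esub>}. \<phi> x \<odot>\<^bsub>T\<^esub> g x)" for \<phi>
  (* The sum may be taken over any finite set containing the support, so that the sums for two
     elements can be compared over a common index set. *)
  have f_eq: "f \<phi> = (\<Oplus>\<^bsub>T\<^esub>x\<in>A. \<phi> x \<odot>\<^bsub>T\<^esub> g x)"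
    if "{x. \<phi> x \<noteq> \<zero>\<^bsub>K\<^esub>} \<subseteq> A" "A \<subseteq> X" "finite A" "\<And>x. \<phi> x \<in> carrier K" for \<phi> A
    unfolding f_def
    using that assms(2) by (intro T.add.finprod_mono_neutral_cong_left) auto
  have "f \<in> linear_maps K ?F T"
  proof (rule linear_mapsI)
    fix \<phi> assume "\<phi> \<in> carrier ?F"
    then show "f \<phi> \<in> carrier T"
      unfolding f_def using assms(2) by (intro T.finsum_closed) (auto simp: free_module_def)
  next
    fix \<phi> \<psi> assume *: "\<phi> \<in> carrier ?F" "\<psi> \<in> carrier ?F"
    let ?A = "{x. \<phi> x \<noteq> \<zero>\<^bsub>K\<^esub>} \<union> {x. \<psi> x \<noteq> \<zero>\<^bsub>K\<^esub>}"
    have A: "?A \<subseteq> X" "finite ?A" "\<And>x. \<phi> x \<in> carrier K" "\<And>x. \<psi> x \<in> carrier K"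
      using * by (auto simp: free_module_def)
    have g: "x \<in> ?A \<Longrightarrow> g x \<in> carrier T" for x using A(1) assms(2) by blast
    have s: "(\<phi> \<oplus>\<^bsub>?F\<^esub> \<psi>) x = \<phi> x \<oplus>\<^bsub>K\<^esub> \<psi> x" for x by (simp add: free_module_def)
    have "f (\<phi> \<oplus>\<^bsub>?F\<^esub> \<psi>) = (\<Oplus>\<^bsub>T\<^esub>x\<in>?A. (\<phi> x \<oplus>\<^bsub>K\<^esub> \<psi> x) \<odot>\<^bsub>T\<^esub> g x)"
      using A by (subst f_eq[of _ ?A]) (auto simp: s)
    also have "\<dots> = (\<Oplus>\<^bsub>T\<^esub>x\<in>?A. \<phi> x \<odot>\<^bsub>T\<^esub> g x \<oplus>\<^bsub>T\<^esub> \<psi> x \<odot>\<^bsub>T\<^esub> g x)"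
      using A(3,4) g by (intro T.finsum_cong' refl funcsetI) (auto simp: T.smult_l_distr)
    also have "\<dots> = (\<Oplus>\<^bsub>T\<^esub>x\<in>?A. \<phi> x \<odot>\<^bsub>T\<^esub> g x) \<oplus>\<^bsub>T\<^esub> (\<Oplus>\<^bsub>T\<^esub>x\<in>?A. \<psi> x \<odot>\<^bsub>T\<^esub> g x)"
      using A(3,4) g by (intro T.finsum_addf) auto
    also have "\<dots> = f \<phi> \<oplus>\<^bsub>T\<^esub> f \<psi>"
      using A by (simp add: f_eq[of \<phi> ?A] f_eq[of \<psi> ?A])
    finally show "f (\<phi> \<oplus>\<^bsub>?F\<^esub> \<psi>) = f \<phi> \<oplus>\<^bsub>T\<^esub> f \<psi>" .
  next
    fix c \<phi> assume *: "c \<in> carrier K" "\<phi> \<in> carrier ?F"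
    let ?A = "{x. \<phi> x \<noteq> \<zero>\<^bsub>K\<^esub>}"
    have A: "?A \<subseteq> X" "finite ?A" "\<And>x. \<phi> x \<in> carrier K"
      using * by (auto simp: free_module_def)
    have g: "x \<in> ?A \<Longrightarrow> g x \<in> carrier T" for x using A(1) assms(2) by blast
    have s: "(c \<odot>\<^bsub>?F\<^esub> \<phi>) x = c \<otimes>\<^bsub>K\<^esub> \<phi> x" for x by (simp add: free_module_def)
    have "f (c \<odot>\<^bsub>?F\<^esub> \<phi>) = (\<Oplus>\<^bsub>T\<^esub>x\<in>?A. (c \<otimes>\<^bsub>K\<^esub> \<phi> x) \<odot>\<^bsub>T\<^esub> g x)"
      using A *(1) by (subst f_eq[of _ ?A]) (auto simp: s)
    also have "\<dots> = (\<Oplus>\<^bsub>T\<^esub>x\<in>?A. c \<odot>\<^bsub>T\<^esub> (\<phi> x \<odot>\<^bsub>T\<^esub> g x))"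
      using A(3) g *(1) by (intro T.finsum_cong' refl funcsetI) (auto simp: T.smult_assoc1)
    also have "\<dots> = c \<odot>\<^bsub>T\<^esub> f \<phi>"
      unfolding f_def using A(2,3) g *(1) by (intro T.finsum_smult_ldistr[symmetric]) auto
    finally show "f (c \<odot>\<^bsub>?F\<^esub> \<phi>) = c \<odot>\<^bsub>T\<^esub> f \<phi>" .
  qed
  moreover have "f (basis_elem K x) = g x" if "x \<in> X" for x
  proof -
    have "f (basis_elem K x) = (\<Oplus>\<^bsub>T\<^esub>y\<in>{x}. basis_elem K x y \<odot>\<^bsub>T\<^esub> g y)"
      using that by (intro f_eq) (auto simp: basis_elem_def)
    also have "\<dots> = g x" using that assms(2) by (simp add: basis_elem_def)
    finally show ?thesis .
  qed
  ultimately show thesis using that by blast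
qed

lemma submodule_abelian_subgroup:
  assumes "module K M" "submodule N K M"
  shows "abelian_subgroup N M"
proof -
  interpret M: module K M by fact
  show ?thesis
    using assms(2) by (intro abelian_subgroupI3 additive_subgroup.intro)
      (auto dest: submodule.axioms(1) intro: M.abelian_group_axioms)
qed

context
  fixes K :: "('k, 'c) ring_scheme" and M :: "('k, 'a, 'm) module_scheme" and N :: "'a set"
  assumes M: "module K M" and N: "submodule N K M"
begin

interpretation M: module K M by (fact M)
interpretation N: abelian_subgroup N M by (rule submodule_abelian_subgroup[OF M N])

lemma quotient_module_carrier:
  "carrier (quotient_module M N) = (\<lambda>x. N +>\<^bsub>M\<^esub> x) ` carrier M"
  by (auto simp: quotient_module_def A_RCOSETS_def')

lemma coset_closed: "x \<in> carrier M \<Longrightarrow> N +>\<^bsub>M\<^esub> x \<in> carrier (quotient_module M N)"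
  unfolding quotient_module_carrier by (rule imageI)

lemma coset_cases:
  assumes "X \<in> carrier (quotient_module M N)"
  obtains x where "x \<in> carrier M" "X = N +>\<^bsub>M\<^esub> x"
  using assms unfolding quotient_module_carrier by blast

lemma quotient_module_add:
  "\<lbrakk>x \<in> carrier M; y \<in> carrier M\<rbrakk> \<Longrightarrow>
    (N +>\<^bsub>M\<^esub> x) \<oplus>\<^bsub>quotient_module M N\<^esub> (N +>\<^bsub>M\<^esub> y) = N +>\<^bsub>M\<^esub> (x \<oplus>\<^bsub>M\<^esub> y)"
  by (simp add: quotient_module_def N.a_rcos_sum)

lemma coset_eq_iff:
  assumes "x \<in> carrier M" "y \<in> carrier M"
  shows "N +>\<^bsub>M\<^esub> x = N +>\<^bsub>M\<^esub> y \<longleftrightarrow> x \<ominus>\<^bsub>M\<^esub> y \<in> N"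
proof
  assume "N +>\<^bsub>M\<^esub> x = N +>\<^bsub>M\<^esub> y"
  then have "x \<in> N +>\<^bsub>M\<^esub> y" using N.a_rcos_self[OF assms(1)] by simp
  then show "x \<ominus>\<^bsub>M\<^esub> y \<in> N"
    using assms N.a_rcos_module[of y x] by (simp add: a_minus_def)
next
  assume "x \<ominus>\<^bsub>M\<^esub> y \<in> N"
  then have "x \<in> N +>\<^bsub>M\<^esub> y" using assms N.a_rcos_module[of y x] by (simp add: a_minus_def)
  then show "N +>\<^bsub>M\<^esub> x = N +>\<^bsub>M\<^esub> y" using assms N.a_repr_independence' by metis
qed

text \<open>The scalar multiple of a coset is a union of cosets; it is a single coset because all of
  them coincide.\<close>

lemma quotient_module_smult:
  assumes "c \<in> carrier K" "x \<in> carrier M"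
  shows "c \<odot>\<^bsub>quotient_module M N\<^esub> (N +>\<^bsub>M\<^esub> x) = N +>\<^bsub>M\<^esub> (c \<odot>\<^bsub>M\<^esub> x)"
proof -
  have "N +>\<^bsub>M\<^esub> (c \<odot>\<^bsub>M\<^esub> y) = N +>\<^bsub>M\<^esub> (c \<odot>\<^bsub>M\<^esub> x)" if "y \<in> N +>\<^bsub>M\<^esub> x" for y
  proof -
    have y: "y \<in> carrier M" using that assms(2) N.a_elemrcos_carrier by blast
    have "y \<ominus>\<^bsub>M\<^esub> x \<in> N"
      using that assms y N.a_rcos_module[of x y] by (simp add: a_minus_def)
    then have "c \<odot>\<^bsub>M\<^esub> (y \<ominus>\<^bsub>M\<^esub> x) \<in> N"
      using M.submoduleE(4)[OF N] assms by blast
    moreover have "c \<odot>\<^bsub>M\<^esub> (y \<ominus>\<^bsub>M\<^esub> x) = c \<odot>\<^bsub>M\<^esub> y \<ominus>\<^bsub>M\<^esub> c \<odot>\<^bsub>M\<^esub> x"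
      using assms y by (simp add: a_minus_def M.smult_r_distr M.smult_r_minus)
    ultimately show ?thesis using assms y by (simp add: coset_eq_iff)
  qed
  then have "(\<Union>y\<in>N +>\<^bsub>M\<^esub> x. N +>\<^bsub>M\<^esub> (c \<odot>\<^bsub>M\<^esub> y)) = (\<Union>y\<in>N +>\<^bsub>M\<^esub> x. N +>\<^bsub>M\<^esub> (c \<odot>\<^bsub>M\<^esub> x))"
    by (intro SUP_cong refl)
  also have "\<dots> = N +>\<^bsub>M\<^esub> (c \<odot>\<^bsub>M\<^esub> x)"
    using N.a_rcos_self[OF assms(2)] by blast
  finally show ?thesis by (simp add: quotient_module_def)
qed

lemma quotient_module_zero: "\<zero>\<^bsub>quotient_module M N\<^esub> = N +>\<^bsub>M\<^esub> \<zero>\<^bsub>M\<^esub>"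
  by (simp add: quotient_module_def M.a_coset_add_zero N.a_subset)

lemma quotient_module_module: "module K (quotient_module M N)"
proof -
  let ?Q = "quotient_module M N"
  note q = quotient_module_add quotient_module_smult quotient_module_zero
  note cl = coset_closed
  have rep: "\<exists>x\<in>carrier M. X = N +>\<^bsub>M\<^esub> x" if "X \<in> carrier ?Q" for X
    using that by (blast elim: coset_cases)
  show ?thesis
  proof (rule moduleI)
    show "abelian_group ?Q"
    proof (rule abelian_groupI)
      fix X assume "X \<in> carrier ?Q"
      then obtain x where x: "x \<in> carrier M" and X: "X = N +>\<^bsub>M\<^esub> x"
        using rep by blast
      show "\<zero>\<^bsub>?Q\<^esub> \<oplus>\<^bsub>?Q\<^esub> X = X"
        using x by (simp add: X q del: M.a_coset_add_zero)
      have "(N +>\<^bsub>M\<^esub> \<ominus>\<^bsub>M\<^esub> x) \<oplus>\<^bsub>?Q\<^esub> X = \<zero>\<^bsub>?Q\<^esub>"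
        using x by (simp add: X q M.l_neg)
      then show "\<exists>Y\<in>carrier ?Q. Y \<oplus>\<^bsub>?Q\<^esub> X = \<zero>\<^bsub>?Q\<^esub>"
        using cl x by blast
      fix Y assume "Y \<in> carrier ?Q"
      then obtain y where y: "y \<in> carrier M" and Y: "Y = N +>\<^bsub>M\<^esub> y"
        using rep by blast
      show "X \<oplus>\<^bsub>?Q\<^esub> Y \<in> carrier ?Q"
        using x y cl by (simp add: X Y q)
      show "X \<oplus>\<^bsub>?Q\<^esub> Y = Y \<oplus>\<^bsub>?Q\<^esub> X"
        using x y M.a_comm[of x y] by (simp only: X Y q)
      fix Z assume "Z \<in> carrier ?Q"
      then obtain z where z: "z \<in> carrier M" and Z: "Z = N +>\<^bsub>M\<^esub> z"
        using rep by blast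
      show "X \<oplus>\<^bsub>?Q\<^esub> Y \<oplus>\<^bsub>?Q\<^esub> Z = X \<oplus>\<^bsub>?Q\<^esub> (Y \<oplus>\<^bsub>?Q\<^esub> Z)"
        using x y z by (simp add: X Y Z q M.a_assoc)
    next
      show "\<zero>\<^bsub>?Q\<^esub> \<in> carrier ?Q" unfolding quotient_module_zero by (rule cl) simp
    qed
    show "cring K" by (rule M.R.cring_axioms)
    fix a X assume a: "a \<in> carrier K" and "X \<in> carrier ?Q"
    then obtain x where x: "x \<in> carrier M" and X: "X = N +>\<^bsub>M\<^esub> x"
      using rep by blast
    show "a \<odot>\<^bsub>?Q\<^esub> X \<in> carrier ?Q"
      using a x cl by (simp add: X q)
    fix b assume b: "b \<in> carrier K"
    show "(a \<oplus>\<^bsub>K\<^esub> b) \<odot>\<^bsub>?Q\<^esub> X = a \<odot>\<^bsub>?Q\<^esub> X \<oplus>\<^bsub>?Q\<^esub> b \<odot>\<^bsub>?Q\<^esub> X"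
      and "(a \<otimes>\<^bsub>K\<^esub> b) \<odot>\<^bsub>?Q\<^esub> X = a \<odot>\<^bsub>?Q\<^esub> (b \<odot>\<^bsub>?Q\<^esub> X)"
      using a b x by (simp_all add: X q M.smult_l_distr M.smult_assoc1)
  next
    fix a X Y assume a: "a \<in> carrier K" and "X \<in> carrier ?Q" "Y \<in> carrier ?Q"
    then obtain x y where "x \<in> carrier M" "y \<in> carrier M" "X = N +>\<^bsub>M\<^esub> x" "Y = N +>\<^bsub>M\<^esub> y"
      using rep by meson
    then show "a \<odot>\<^bsub>?Q\<^esub> (X \<oplus>\<^bsub>?Q\<^esub> Y) = a \<odot>\<^bsub>?Q\<^esub> X \<oplus>\<^bsub>?Q\<^esub> a \<odot>\<^bsub>?Q\<^esub> Y"
      using a by (simp add: q M.smult_r_distr)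
  next
    fix X assume "X \<in> carrier ?Q"
    then obtain x where "x \<in> carrier M" "X = N +>\<^bsub>M\<^esub> x" using rep by blast
    then show "\<one>\<^bsub>K\<^esub> \<odot>\<^bsub>?Q\<^esub> X = X" by (simp add: q)
  qed
qed

lemma coset_linear: "(\<lambda>x. N +>\<^bsub>M\<^esub> x) \<in> linear_maps K M (quotient_module M N)"
proof (rule linear_mapsI)
  show "N +>\<^bsub>M\<^esub> x \<in> carrier (quotient_module M N)" if "x \<in> carrier M" for x
    using that by (rule coset_closed)
  show "N +>\<^bsub>M\<^esub> (x \<oplus>\<^bsub>M\<^esub> y) = (N +>\<^bsub>M\<^esub> x) \<oplus>\<^bsub>quotient_module M N\<^esub> (N +>\<^bsub>M\<^esub> y)"
    if "x \<in> carrier M" "y \<in> carrier M" for x y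
    using that by (rule quotient_module_add[symmetric])
  show "N +>\<^bsub>M\<^esub> (c \<odot>\<^bsub>M\<^esub> x) = c \<odot>\<^bsub>quotient_module M N\<^esub> (N +>\<^bsub>M\<^esub> x)"
    if "c \<in> carrier K" "x \<in> carrier M" for c x
    using that by (rule quotient_module_smult[symmetric])
qed

lemma quotient_module_lift:
  assumes T: "module K T" and f: "f \<in> linear_maps K M T" and "\<And>x. x \<in> N \<Longrightarrow> f x = \<zero>\<^bsub>T\<^esub>"
  obtains f' where "f' \<in> linear_maps K (quotient_module M N) T"
    and "\<And>x. x \<in> carrier M \<Longrightarrow> f' (N +>\<^bsub>M\<^esub> x) = f x"
proof -
  interpret T: module K T by (fact T)
  define f' where "f' X = f (SOME x. x \<in> carrier M \<and> X = N +>\<^bsub>M\<^esub> x)" for X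
  have f': "f' (N +>\<^bsub>M\<^esub> x) = f x" if x: "x \<in> carrier M" for x
  proof -
    let ?y = "SOME y. y \<in> carrier M \<and> N +>\<^bsub>M\<^esub> x = N +>\<^bsub>M\<^esub> y"
    have y: "?y \<in> carrier M" "N +>\<^bsub>M\<^esub> x = N +>\<^bsub>M\<^esub> ?y"
      using someI[of "\<lambda>y. y \<in> carrier M \<and> N +>\<^bsub>M\<^esub> x = N +>\<^bsub>M\<^esub> y" x] x by blast+
    then have "x \<ominus>\<^bsub>M\<^esub> ?y \<in> N" using coset_eq_iff x by blast
    then have "f (x \<ominus>\<^bsub>M\<^esub> ?y) = \<zero>\<^bsub>T\<^esub>" by (rule assms(3))
    then have "f x \<ominus>\<^bsub>T\<^esub> f ?y = \<zero>\<^bsub>T\<^esub>"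
      using x y(1) by (simp add: a_minus_def linear_maps_add[OF f] linear_maps_neg[OF M T f])
    then have "f x = f ?y"
      using x y(1) linear_maps_closed[OF f] T.minus_equality[of "f x" "\<ominus>\<^bsub>T\<^esub> f ?y"]
      by (simp add: a_minus_def)
    then show ?thesis by (simp add: f'_def)
  qed
  moreover have "f' \<in> linear_maps K (quotient_module M N) T"
  proof (rule linear_mapsI)
    fix X assume "X \<in> carrier (quotient_module M N)"
    then obtain x where x: "x \<in> carrier M" and X: "X = N +>\<^bsub>M\<^esub> x" by (rule coset_cases)
    show "f' X \<in> carrier T" using x by (simp add: X f' linear_maps_closed[OF f])
    show "f' (c \<odot>\<^bsub>quotient_module M N\<^esub> X) = c \<odot>\<^bsub>T\<^esub> f' X" if "c \<in> carrier K" for c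
      using x that by (simp add: X quotient_module_smult f' linear_maps_smult[OF f])
    fix Y assume "Y \<in> carrier (quotient_module M N)"
    then obtain y where "y \<in> carrier M" and "Y = N +>\<^bsub>M\<^esub> y" by (rule coset_cases)
    then show "f' (X \<oplus>\<^bsub>quotient_module M N\<^esub> Y) = f' X \<oplus>\<^bsub>T\<^esub> f' Y"
      using x by (simp add: X quotient_module_add f' linear_maps_add[OF f])
  qed
  ultimately show thesis using that by blast
qed

end

lemma equalizer_submodule:
  assumes M: "module K M" and T: "module K T"
    and f: "f \<in> linear_maps K M T" and g: "g \<in> linear_maps K M T"
  shows "submodule {x \<in> carrier M. f x = g x} K M"
proof -
  interpret M: module K M by (fact M)
  show ?thesis
    by (rule M.submoduleI)
      (auto simp: linear_mapsD[OF f] linear_mapsD[OF g] linear_maps_neg[OF M T f]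
        linear_maps_neg[OF M T g] linear_maps_zero[OF M T f] linear_maps_zero[OF M T g])
qed

lemma zero_linear:
  assumes "module K N"
  shows "(\<lambda>x. \<zero>\<^bsub>N\<^esub>) \<in> linear_maps K M N"
proof -
  interpret N: module K N by fact
  show ?thesis by (rule linear_mapsI) auto
qed

section \<open>Multilinear maps and tensor powers\<close>

text \<open>For \<open>n = 0\<close> there are no entries to vary, and the condition is that \<open>g []\<close> lies in \<open>T\<close>.\<close>

definition multilinear ::
    "('k, 'c) ring_scheme \<Rightarrow> ('k, 'a, 'm) module_scheme \<Rightarrow> nat \<Rightarrow> ('k, 'b, 'n) module_scheme
      \<Rightarrow> ('a list \<Rightarrow> 'b) \<Rightarrow> bool" where
  "multilinear K M n T g \<longleftrightarrow> (\<forall>xs\<in>tuples M n. g xs \<in> carrier T \<and>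
    (\<forall>i<n. (\<lambda>x. g (xs[i := x])) \<in> linear_maps K M T))"

lemma multilinear_closed: "\<lbrakk>multilinear K M n T g; xs \<in> tuples M n\<rbrakk> \<Longrightarrow> g xs \<in> carrier T"
  and multilinear_slot: "\<lbrakk>multilinear K M n T g; xs \<in> tuples M n; i < n\<rbrakk>
    \<Longrightarrow> (\<lambda>x. g (xs[i := x])) \<in> linear_maps K M T"
  by (auto simp: multilinear_def)

lemma tuples_update: "\<lbrakk>xs \<in> tuples M n; x \<in> carrier M\<rbrakk> \<Longrightarrow> xs[i := x] \<in> tuples M n"
  using set_update_subset_insert[of xs i x] by (auto simp: tuples_def)

lemma tuples_nth: "\<lbrakk>xs \<in> tuples M n; i < n\<rbrakk> \<Longrightarrow> xs ! i \<in> carrier M"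
  by (auto simp: tuples_def)

lemma tuplesI: "\<lbrakk>length xs = n; \<And>i. i < n \<Longrightarrow> xs ! i \<in> carrier M\<rbrakk> \<Longrightarrow> xs \<in> tuples M n"
  by (auto simp: tuples_def in_set_conv_nth)

lemma multilinear_zero_entry:
  assumes "module K M" "module K T" "multilinear K M n T g" "xs \<in> tuples M n" "i < n"
    "xs ! i = \<zero>\<^bsub>M\<^esub>"
  shows "g xs = \<zero>\<^bsub>T\<^esub>"
proof -
  have "xs[i := \<zero>\<^bsub>M\<^esub>] = xs" by (simp flip: assms(6))
  then show ?thesis using linear_maps_zero[OF assms(1,2) multilinear_slot[OF assms(3-5)]] by simp
qed

text \<open>The maps that occur below rearrange the entries of a tuple, transform them linearly or merge
  two neighbours. In each case changing one entry of the argument changes a single entry of the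
  result, in a linear way.\<close>

lemma multilinear_compose:
  assumes M: "module K M" and g: "multilinear K N n' T g"
    and F: "\<And>xs. xs \<in> tuples M n \<Longrightarrow> F xs \<in> tuples N n'"
    and slot: "\<And>xs i. \<lbrakk>xs \<in> tuples M n; i < n\<rbrakk> \<Longrightarrow> \<exists>j<n'. \<exists>\<psi>\<in>linear_maps K M N.
      \<forall>x\<in>carrier M. F (xs[i := x]) = (F xs)[j := \<psi> x]"
  shows "multilinear K M n T (\<lambda>xs. g (F xs))"
  unfolding multilinear_def
proof (intro ballI conjI allI impI)
  fix xs i assume xs: "xs \<in> tuples M n"
  show "g (F xs) \<in> carrier T" by (rule multilinear_closed[OF g F[OF xs]])
  assume "i < n"
  then obtain j \<psi> where j: "j < n'" "\<psi> \<in> linear_maps K M N"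
    "\<And>x. x \<in> carrier M \<Longrightarrow> F (xs[i := x]) = (F xs)[j := \<psi> x]"
    using slot[OF xs] by blast
  have "(\<lambda>x. g ((F xs)[j := \<psi> x])) \<in> linear_maps K M T"
    by (rule linear_maps_compose[OF j(2) multilinear_slot[OF g F[OF xs] j(1)]])
  then show "(\<lambda>x. g (F (xs[i := x]))) \<in> linear_maps K M T"
    by (rule linear_maps_cong[OF M]) (simp add: j(3))
qed

lemma submodule_generated_submodule:
  assumes "module K M" "X \<subseteq> carrier M"
  shows "submodule (submodule_generated K M X) K M"
proof -
  interpret M: module K M by fact
  have c: "submodule (carrier M) K M" by (rule M.carrier_is_submodule)
  have z: "\<zero>\<^bsub>M\<^esub> \<in> H" if "submodule H K M" for H
    using subgroup.one_closed[OF submodule.axioms(1)[OF that]] by simp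
  show ?thesis
  proof (rule M.submoduleI)
    show "submodule_generated K M X \<subseteq> carrier M"
      using c assms(2) by (auto simp: submodule_generated_def)
  qed (use z M.submoduleE in \<open>auto simp: submodule_generated_def\<close>)
qed

lemma submodule_generated_superset: "X \<subseteq> submodule_generated K M X"
  by (auto simp: submodule_generated_def)

lemma submodule_generated_least:
  "\<lbrakk>submodule H K M; X \<subseteq> H\<rbrakk> \<Longrightarrow> submodule_generated K M X \<subseteq> H"
  by (auto simp: submodule_generated_def)

context
  fixes K :: "('k, 'c) ring_scheme" and M :: "('k, 'a, 'm) module_scheme"
  assumes M: "module K M"
begin

interpretation M: module K M by (fact M)

lemma tuples_module: "module K (free_module K (tuples M n))"
  by (rule free_module_module) (rule M.R.cring_axioms)

lemma tuple_basis_closed: "xs \<in> tuples M n \<Longrightarrow> basis_elem K xs \<in> carrier (free_module K (tuples M n))"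
  by (rule basis_elem_closed) (rule M.R.cring_axioms)

lemma multilinear_relations_subset:
  "multilinear_relations K M n \<subseteq> carrier (free_module K (tuples M n))"
proof -
  interpret F: module K "free_module K (tuples M n)" by (rule tuples_module)
  show ?thesis
    unfolding multilinear_relations_def Let_def
    by (auto intro!: F.minus_closed F.a_closed F.smult_closed tuple_basis_closed tuples_update)
qed

lemma tensor_kernel_submodule:
  "submodule (tensor_kernel K M n) K (free_module K (tuples M n))"
  unfolding tensor_kernel_def
  by (intro submodule_generated_submodule tuples_module multilinear_relations_subset)

lemma tensor_power_module: "module K (tensor_power K M n)"
  unfolding tensor_power_def
  by (intro quotient_module_module tuples_module tensor_kernel_submodule)

lemma coset_linear_tensor_power:
  "(\<lambda>\<phi>. tensor_kernel K M n +>\<^bsub>free_module K (tuples M n)\<^esub> \<phi>)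
    \<in> linear_maps K (free_module K (tuples M n)) (tensor_power K M n)"
  unfolding tensor_power_def
  by (intro coset_linear tuples_module tensor_kernel_submodule)

lemma tensor_eq:
  "xs \<in> tuples M n \<Longrightarrow>
    tensor K M xs = tensor_kernel K M n +>\<^bsub>free_module K (tuples M n)\<^esub> basis_elem K xs"
  by (simp add: tensor_def tuples_def)

lemma tensor_closed: "xs \<in> tuples M n \<Longrightarrow> tensor K M xs \<in> carrier (tensor_power K M n)"
  using linear_maps_closed[OF coset_linear_tensor_power] by (simp add: tensor_eq tuple_basis_closed)

lemma multilinear_tensor: "multilinear K M n (tensor_power K M n) (tensor K M)"
  unfolding multilinear_def
proof (intro ballI conjI allI impI)
  let ?F = "free_module K (tuples M n)"
  let ?N = "tensor_kernel K M n"
  interpret F: module K ?F by (rule tuples_module)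
  note q = coset_linear_tensor_power[of n]
  fix xs assume xs: "xs \<in> tuples M n"
  then show "tensor K M xs \<in> carrier (tensor_power K M n)" by (rule tensor_closed)
  fix i assume i: "i < n"
  have e: "basis_elem K (xs[i := x]) \<in> carrier ?F" if "x \<in> carrier M" for x
    using that xs by (intro tuple_basis_closed tuples_update)
  have t: "tensor K M (xs[i := x]) = ?N +>\<^bsub>?F\<^esub> basis_elem K (xs[i := x])" if "x \<in> carrier M" for x
    using that xs by (intro tensor_eq tuples_update)
  have rel: "\<phi> \<ominus>\<^bsub>?F\<^esub> \<psi> \<in> multilinear_relations K M n \<Longrightarrow> \<phi> \<in> carrier ?F \<Longrightarrow> \<psi> \<in> carrier ?F
      \<Longrightarrow> ?N +>\<^bsub>?F\<^esub> \<phi> = ?N +>\<^bsub>?F\<^esub> \<psi>" for \<phi> \<psi>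
    using submodule_generated_superset[of "multilinear_relations K M n" K ?F]
    by (subst coset_eq_iff[OF tuples_module tensor_kernel_submodule]) (auto simp: tensor_kernel_def)
  show "(\<lambda>x. tensor K M (xs[i := x])) \<in> linear_maps K M (tensor_power K M n)"
  proof (rule linear_mapsI)
    show "tensor K M (xs[i := x]) \<in> carrier (tensor_power K M n)" if "x \<in> carrier M" for x
      using xs that by (intro tensor_closed tuples_update)
    fix x assume x: "x \<in> carrier M"
    show "tensor K M (xs[i := x \<oplus>\<^bsub>M\<^esub> y]) =
        tensor K M (xs[i := x]) \<oplus>\<^bsub>tensor_power K M n\<^esub> tensor K M (xs[i := y])"
      if y: "y \<in> carrier M" for y
    proof -
      have "?N +>\<^bsub>?F\<^esub> basis_elem K (xs[i := x \<oplus>\<^bsub>M\<^esub> y]) =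
          ?N +>\<^bsub>?F\<^esub> (basis_elem K (xs[i := x]) \<oplus>\<^bsub>?F\<^esub> basis_elem K (xs[i := y]))"
      proof (rule rel)
        show "basis_elem K (xs[i := x \<oplus>\<^bsub>M\<^esub> y]) \<ominus>\<^bsub>?F\<^esub>
            (basis_elem K (xs[i := x]) \<oplus>\<^bsub>?F\<^esub> basis_elem K (xs[i := y])) \<in> multilinear_relations K M n"
          unfolding multilinear_relations_def Let_def using xs i x y by blast
      qed (use e x y in auto)
      then show ?thesis using x y by (simp add: t linear_maps_add[OF q] e)
    qed
    show "tensor K M (xs[i := c \<odot>\<^bsub>M\<^esub> x]) = c \<odot>\<^bsub>tensor_power K M n\<^esub> tensor K M (xs[i := x])"
      if c: "c \<in> carrier K" for c
    proof -
      have "?N +>\<^bsub>?F\<^esub> basis_elem K (xs[i := c \<odot>\<^bsub>M\<^esub> x]) =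
          ?N +>\<^bsub>?F\<^esub> (c \<odot>\<^bsub>?F\<^esub> basis_elem K (xs[i := x]))"
      proof (rule rel)
        show "basis_elem K (xs[i := c \<odot>\<^bsub>M\<^esub> x]) \<ominus>\<^bsub>?F\<^esub>
            (c \<odot>\<^bsub>?F\<^esub> basis_elem K (xs[i := x])) \<in> multilinear_relations K M n"
          unfolding multilinear_relations_def Let_def using xs i x c by blast
      qed (use e x c in auto)
      then show ?thesis using x c by (simp add: t linear_maps_smult[OF q] e)
    qed
  qed
qed

text \<open>The elements of the free module on which the two maps agree form a submodule that contains
  the basis.\<close>

lemma linear_maps_eq_on_tensors:
  assumes T: "module K T" and f: "f \<in> linear_maps K (tensor_power K M n) T"
    and g: "g \<in> linear_maps K (tensor_power K M n) T"
    and eq: "\<And>xs. xs \<in> tuples M n \<Longrightarrow> f (tensor K M xs) = g (tensor K M xs)"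
    and x: "x \<in> carrier (tensor_power K M n)"
  shows "f x = g x"
proof -
  let ?F = "free_module K (tuples M n)"
  let ?q = "\<lambda>\<phi>. tensor_kernel K M n +>\<^bsub>?F\<^esub> \<phi>"
  note q = coset_linear_tensor_power[of n]
  have "submodule {\<phi> \<in> carrier ?F. f (?q \<phi>) = g (?q \<phi>)} K ?F"
    by (rule equalizer_submodule[OF tuples_module T linear_maps_compose[OF q f]
          linear_maps_compose[OF q g]])
  then have "carrier ?F \<subseteq> {\<phi> \<in> carrier ?F. f (?q \<phi>) = g (?q \<phi>)}"
    by (rule free_module_spanned[OF M.R.cring_axioms])
      (use eq tensor_eq tuple_basis_closed in auto)
  moreover obtain \<phi> where "\<phi> \<in> carrier ?F" "x = ?q \<phi>"
    using x coset_cases[OF tuples_module tensor_kernel_submodule] unfolding tensor_power_def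
    by blast
  ultimately show ?thesis by auto
qed

text \<open>The linear extension of \<open>g\<close> to the free module on tuples kills the multilinear relations,
  because \<open>g\<close> is multilinear, and so factors through the quotient.\<close>

lemma tensor_power_lift:
  assumes T: "module K T" and g: "multilinear K M n T g"
  obtains f where "f \<in> linear_maps K (tensor_power K M n) T"
    and "\<And>xs. xs \<in> tuples M n \<Longrightarrow> f (tensor K M xs) = g xs"
proof -
  let ?F = "free_module K (tuples M n)"
  interpret T: module K T by (fact T)
  interpret F: module K ?F by (rule tuples_module)
  note gl = linear_mapsD[OF multilinear_slot[OF g]]
  obtain f where f: "f \<in> linear_maps K ?F T"
    and fg: "\<And>xs. xs \<in> tuples M n \<Longrightarrow> f (basis_elem K xs) = g xs"
    using free_module_lift[OF T, of "tuples M n" g] multilinear_closed[OF g] by blast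
  let ?H = "{\<phi> \<in> carrier ?F. f \<phi> = \<zero>\<^bsub>T\<^esub>}"
  have H: "submodule ?H K ?F"
    by (rule equalizer_submodule[OF tuples_module T f zero_linear[OF T]])
  have diff: "f (\<phi> \<ominus>\<^bsub>?F\<^esub> \<psi>) = \<zero>\<^bsub>T\<^esub>"
    if "\<phi> \<in> carrier ?F" "\<psi> \<in> carrier ?F" "f \<phi> = f \<psi>" for \<phi> \<psi>
    using that linear_maps_closed[OF f]
    by (simp add: a_minus_def linear_maps_add[OF f] linear_maps_neg[OF tuples_module T f] T.r_neg)
  have "f \<rho> = \<zero>\<^bsub>T\<^esub>" if \<rho>: "\<rho> \<in> multilinear_relations K M n" for \<rho>
  proof -
    consider xs i x y where "xs \<in> tuples M n" "i < n" "x \<in> carrier M" "y \<in> carrier M"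
        "\<rho> = basis_elem K (xs[i := x \<oplus>\<^bsub>M\<^esub> y]) \<ominus>\<^bsub>?F\<^esub>
          (basis_elem K (xs[i := x]) \<oplus>\<^bsub>?F\<^esub> basis_elem K (xs[i := y]))"
      | xs i c x where "xs \<in> tuples M n" "i < n" "c \<in> carrier K" "x \<in> carrier M"
        "\<rho> = basis_elem K (xs[i := c \<odot>\<^bsub>M\<^esub> x]) \<ominus>\<^bsub>?F\<^esub> (c \<odot>\<^bsub>?F\<^esub> basis_elem K (xs[i := x]))"
      using \<rho> unfolding multilinear_relations_def Let_def by blast
    then show ?thesis
    proof cases
      case 1
      note cl = tuple_basis_closed[OF tuples_update[OF 1(1)]]
      show ?thesis
        unfolding 1(5) using 1(1-4) cl
        by (intro diff) (simp_all add: linear_maps_add[OF f] fg tuples_update gl)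
    next
      case 2
      note cl = tuple_basis_closed[OF tuples_update[OF 2(1)]]
      show ?thesis
        unfolding 2(5) using 2(1-4) cl
        by (intro diff) (simp_all add: linear_maps_smult[OF f] fg tuples_update gl)
    qed
  qed
  then have "multilinear_relations K M n \<subseteq> ?H" using multilinear_relations_subset by auto
  then have "tensor_kernel K M n \<subseteq> ?H"
    unfolding tensor_kernel_def by (rule submodule_generated_least[OF H])
  then obtain f' where "f' \<in> linear_maps K (tensor_power K M n) T"
    and "\<And>\<phi>. \<phi> \<in> carrier ?F \<Longrightarrow> f' (tensor_kernel K M n +>\<^bsub>?F\<^esub> \<phi>) = f \<phi>"
    using quotient_module_lift[OF tuples_module tensor_kernel_submodule T f]
    unfolding tensor_power_def by blast
  then show thesis
    using that[of f'] fg tensor_eq tuple_basis_closed by simp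
qed

lemma linear_extension_properties:
  assumes T: "module K T" and g: "multilinear K M n T g"
  shows linear_extension_linear:
      "linear_extension K M n T g \<in> linear_maps K (tensor_power K M n) T"
    and linear_extension_tensor:
      "xs \<in> tuples M n \<Longrightarrow> linear_extension K M n T g (tensor K M xs) = g xs"
proof -
  let ?P = "\<lambda>f. f \<in> linear_maps K (tensor_power K M n) T \<and>
     f \<in> extensional (carrier (tensor_power K M n)) \<and> (\<forall>xs\<in>tuples M n. f (tensor K M xs) = g xs)"
  obtain f where f: "f \<in> linear_maps K (tensor_power K M n) T"
    "\<And>xs. xs \<in> tuples M n \<Longrightarrow> f (tensor K M xs) = g xs"
    using tensor_power_lift[OF T g] by blast
  define r where "r = restrict f (carrier (tensor_power K M n))"
  have "r \<in> linear_maps K (tensor_power K M n) T"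
    by (rule linear_maps_cong[OF tensor_power_module f(1)]) (simp add: r_def)
  then have r: "?P r"
    using f(2) tensor_closed by (simp add: r_def)
  have "\<exists>!f. ?P f"
  proof (rule ex1I[of _ r])
    fix f1 assume P1: "?P f1"
    show "f1 = r"
    proof (rule extensionalityI)
      show "f1 x = r x" if x: "x \<in> carrier (tensor_power K M n)" for x
        by (rule linear_maps_eq_on_tensors[OF T _ _ _ x]) (use r P1 in simp_all)
    qed (use r P1 in blast)+
  qed (rule r)
  from theI'[OF this]
  show "linear_extension K M n T g \<in> linear_maps K (tensor_power K M n) T"
    and "xs \<in> tuples M n \<Longrightarrow> linear_extension K M n T g (tensor K M xs) = g xs"
    unfolding linear_extension_def by blast+
qed

end

text \<open>Homogeneous elements are stable under scalars, so they generate a graded module already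
  under addition.\<close>

definition additively_generates :: "('a, 'm) ring_scheme \<Rightarrow> 'a set \<Rightarrow> bool" where
  "additively_generates M G \<longleftrightarrow> G \<subseteq> carrier M \<and>
    (\<forall>H \<subseteq> carrier M. G \<subseteq> H \<and> \<zero>\<^bsub>M\<^esub> \<in> H \<and> (\<forall>x\<in>H. \<forall>y\<in>H. x \<oplus>\<^bsub>M\<^esub> y \<in> H) \<longrightarrow> H = carrier M)"

text \<open>The entries are freed from the generating set one after another: by induction on \<open>k\<close>, the
  maps agree on all tuples whose entries from position \<open>k\<close> on are generators.\<close>

lemma multilinear_eq_on_generators:
  assumes M: "module K M" and T: "module K T" and G: "additively_generates M G"
    and f: "multilinear K M n T f" and g: "multilinear K M n T g"
    and eq: "\<And>xs. \<lbrakk>length xs = n; set xs \<subseteq> G\<rbrakk> \<Longrightarrow> f xs = g xs"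
    and xs: "xs \<in> tuples M n"
  shows "f xs = g xs"
proof -
  interpret M: module K M by (fact M)
  have "\<forall>xs\<in>tuples M n. (\<forall>i<n. k \<le> i \<longrightarrow> xs ! i \<in> G) \<longrightarrow> f xs = g xs" if "k \<le> n" for k
    using that
  proof (induction k)
    case 0
    then show ?case by (auto simp: tuples_def subset_iff in_set_conv_nth intro!: eq)
  next
    case (Suc k)
    show ?case
    proof (intro ballI impI)
      fix xs assume xs: "xs \<in> tuples M n" and xsG: "\<forall>i<n. Suc k \<le> i \<longrightarrow> xs ! i \<in> G"
      (* The values of the k-th entry for which the two sides agree form an additive subset. *)
      let ?H = "{x \<in> carrier M. f (xs[k := x]) = g (xs[k := x])}"
      have k: "k < n" using Suc.prems by simp
      note fl = multilinear_slot[OF f xs k] and gl = multilinear_slot[OF g xs k]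
      have len: "length xs = n" using xs by (simp add: tuples_def)
      have "G \<subseteq> ?H"
      proof
        fix x assume x: "x \<in> G"
        then have c: "x \<in> carrier M" using G by (auto simp: additively_generates_def)
        have "\<forall>i<n. k \<le> i \<longrightarrow> xs[k := x] ! i \<in> G"
          using xsG x len by (auto simp: nth_list_update)
        then have "f (xs[k := x]) = g (xs[k := x])"
          using Suc.IH Suc.prems tuples_update[OF xs c, of k] by simp
        then show "x \<in> ?H" using c by simp
      qed
      moreover have "\<zero>\<^bsub>M\<^esub> \<in> ?H"
        using linear_maps_zero[OF M T fl] linear_maps_zero[OF M T gl] by simp
      moreover have "\<forall>x\<in>?H. \<forall>y\<in>?H. x \<oplus>\<^bsub>M\<^esub> y \<in> ?H"
        by (auto simp: linear_maps_add[OF fl] linear_maps_add[OF gl])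
      moreover have "?H \<subseteq> carrier M" by auto
      ultimately have "?H = carrier M" using G unfolding additively_generates_def by blast
      moreover have "xs ! k \<in> carrier M" using tuples_nth[OF xs k] .
      ultimately have "xs ! k \<in> ?H" by (simp only:)
      then show "f xs = g xs" by simp
    qed
  qed
  from this[of n] show ?thesis using xs by simp
qed

lemma linear_maps_multilinear:
  assumes "multilinear K M n T g" "f \<in> linear_maps K T T'"
  shows "multilinear K M n T' (\<lambda>xs. f (g xs))"
  unfolding multilinear_def
proof (intro ballI conjI allI impI)
  fix xs assume xs: "xs \<in> tuples M n"
  show "f (g xs) \<in> carrier T'"
    by (rule linear_maps_closed[OF assms(2) multilinear_closed[OF assms(1) xs]])
  show "(\<lambda>x. f (g (xs[i := x]))) \<in> linear_maps K M T'" if "i < n" for i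
    by (rule linear_maps_compose[OF multilinear_slot[OF assms(1) xs that] assms(2)])
qed

lemma linear_maps_eq_on_generators:
  assumes M: "module K M" and T: "module K T" and G: "additively_generates M G"
    and f: "f \<in> linear_maps K (tensor_power K M n) T"
    and g: "g \<in> linear_maps K (tensor_power K M n) T"
    and eq: "\<And>xs. \<lbrakk>length xs = n; set xs \<subseteq> G\<rbrakk> \<Longrightarrow> f (tensor K M xs) = g (tensor K M xs)"
    and x: "x \<in> carrier (tensor_power K M n)"
  shows "f x = g x"
  using M T f g
proof (rule linear_maps_eq_on_tensors)
  note t = multilinear_tensor[OF M, of n]
  show "f (tensor K M xs) = g (tensor K M xs)" if "xs \<in> tuples M n" for xs
    by (rule multilinear_eq_on_generators[OF M T G linear_maps_multilinear[OF t f]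
          linear_maps_multilinear[OF t g] eq that])
qed (rule x)

lemma finsum_multilinear:
  assumes T: "module K T" and "\<And>i. i \<in> I \<Longrightarrow> multilinear K M n T (g i)"
  shows "multilinear K M n T (\<lambda>xs. \<Oplus>\<^bsub>T\<^esub>i\<in>I. g i xs)"
  unfolding multilinear_def
proof (intro ballI conjI allI impI)
  interpret T: module K T by (fact T)
  fix xs assume xs: "xs \<in> tuples M n"
  show "(\<Oplus>\<^bsub>T\<^esub>i\<in>I. g i xs) \<in> carrier T"
    using multilinear_closed[OF assms(2) xs] by (intro T.finsum_closed) auto
  show "(\<lambda>x. \<Oplus>\<^bsub>T\<^esub>i\<in>I. g i (xs[j := x])) \<in> linear_maps K M T" if "j < n" for j
    by (rule finsum_linear_maps[OF T]) (rule multilinear_slot[OF assms(2) xs that])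
qed

lemma add_multilinear:
  assumes T: "module K T" and "multilinear K M n T f" "multilinear K M n T g"
  shows "multilinear K M n T (\<lambda>xs. f xs \<oplus>\<^bsub>T\<^esub> g xs)"
  unfolding multilinear_def
proof (intro ballI conjI allI impI)
  interpret T: module K T by (fact T)
  fix xs assume xs: "xs \<in> tuples M n"
  show "f xs \<oplus>\<^bsub>T\<^esub> g xs \<in> carrier T"
    using multilinear_closed[OF assms(2) xs] multilinear_closed[OF assms(3) xs]
    by (rule T.a_closed)
  show "(\<lambda>x. f (xs[j := x]) \<oplus>\<^bsub>T\<^esub> g (xs[j := x])) \<in> linear_maps K M T" if "j < n" for j
    using that xs assms by (intro add_linear_maps multilinear_slot)
qed

text \<open>All index sums in the computations below have at most one nonzero term.\<close>

lemma finsum_single: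
  assumes "abelian_monoid M" "finite A" "a \<in> A" "f a \<in> carrier M"
    "\<And>x. \<lbrakk>x \<in> A; x \<noteq> a\<rbrakk> \<Longrightarrow> f x = \<zero>\<^bsub>M\<^esub>"
  shows "(\<Oplus>\<^bsub>M\<^esub>x\<in>A. f x) = f a"
proof -
  interpret M: abelian_monoid M by fact
  have "(\<Oplus>\<^bsub>M\<^esub>x\<in>A. f x) = (\<Oplus>\<^bsub>M\<^esub>x\<in>{a}. f x)"
    using assms(2-5)
    by (intro M.add.finprod_mono_neutral_cong_right) (auto, metis M.zero_closed)
  then show ?thesis using assms(4) by simp
qed

section \<open>Graded modules\<close>

text \<open>What the extension of maps from homogeneous elements rests on; it applies to the base
  superalgebra and, through their grading, to matrices.\<close>

locale graded_module = module K S for K :: "('k, 'c) ring_scheme" and S :: "('k, 'a) superalgebra" +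
  assumes homog_submodule: "submodule (homog S e) K S"
    and homog_sum: "homog S 0 <+>\<^bsub>S\<^esub> homog S 1 = carrier S"
    and homog_inter: "homog S 0 \<inter> homog S 1 = {\<zero>\<^bsub>S\<^esub>}"
begin

lemma module: "module K S" ..

lemma homog_subset: "homog S e \<subseteq> carrier S"
  by (rule submoduleE(1)[OF homog_submodule])

lemma homog_carrier: "x \<in> homog S e \<Longrightarrow> x \<in> carrier S"
  using homog_subset by blast

lemma homog_zero: "\<zero>\<^bsub>S\<^esub> \<in> homog S e"
  using subgroup.one_closed[OF submodule.axioms(1)[OF homog_submodule]] by simp

lemma homog_disjoint:
  assumes "x \<in> homog S e" "x \<in> homog S e'" "e \<noteq> e'"
  shows "x = \<zero>\<^bsub>S\<^esub>"
  using assms homog_inter by (cases e; cases e') auto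

lemma homog_decompose:
  assumes "x \<in> carrier S"
  obtains y z where "y \<in> homog S e" "z \<in> homog S (e + 1)" "x = y \<oplus>\<^bsub>S\<^esub> z"
proof -
  obtain y z where yz: "y \<in> homog S 0" "z \<in> homog S 1" "x = y \<oplus>\<^bsub>S\<^esub> z"
    using assms unfolding homog_sum[symmetric] set_add_def' by blast
  show thesis
  proof (cases e)
    case zero
    then show thesis using yz that[of y z] by simp
  next
    case one
    have "x = z \<oplus>\<^bsub>S\<^esub> y" using yz homog_carrier M.a_comm by metis
    then show thesis using yz one that[of z y] by simp
  qed
qed

lemma homog_decompose_unique:
  assumes "y \<in> homog S e" "z \<in> homog S (e + 1)" "y' \<in> homog S e" "z' \<in> homog S (e + 1)"
    and "y \<oplus>\<^bsub>S\<^esub> z = y' \<oplus>\<^bsub>S\<^esub> z'"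
  shows "y = y'"
proof -
  note c = homog_carrier[OF assms(1)] homog_carrier[OF assms(2)] homog_carrier[OF assms(3)]
    homog_carrier[OF assms(4)]
  note sub = submoduleE[OF homog_submodule]
  have d: "y \<ominus>\<^bsub>S\<^esub> y' \<in> homog S e" "z' \<ominus>\<^bsub>S\<^esub> z \<in> homog S (e + 1)"
    using assms sub(3,5) by (simp_all add: a_minus_def)
  have "y \<ominus>\<^bsub>S\<^esub> y' = y \<oplus>\<^bsub>S\<^esub> (z \<ominus>\<^bsub>S\<^esub> z) \<ominus>\<^bsub>S\<^esub> y'"
    using c by (simp add: a_minus_def M.r_neg)
  also have "\<dots> = (y \<oplus>\<^bsub>S\<^esub> z) \<ominus>\<^bsub>S\<^esub> z \<ominus>\<^bsub>S\<^esub> y'"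
    using c by (simp add: a_minus_def M.a_ac)
  also have "\<dots> = (y' \<ominus>\<^bsub>S\<^esub> y') \<oplus>\<^bsub>S\<^esub> (z' \<ominus>\<^bsub>S\<^esub> z)"
    unfolding assms(5) using c by (simp add: a_minus_def M.a_ac)
  also have "\<dots> = z' \<ominus>\<^bsub>S\<^esub> z" using c by (simp add: a_minus_def M.r_neg)
  finally have "y \<ominus>\<^bsub>S\<^esub> y' = \<zero>\<^bsub>S\<^esub>" using d by (intro homog_disjoint[of _ e "e + 1"]) auto
  then show ?thesis
    using c M.minus_equality[of y "\<ominus>\<^bsub>S\<^esub> y'"] by (simp add: a_minus_def)
qed

definition homog_part :: "bit \<Rightarrow> 'a \<Rightarrow> 'a" where
  "homog_part e x = (THE y. y \<in> homog S e \<and> (\<exists>z\<in>homog S (e + 1). x = y \<oplus>\<^bsub>S\<^esub> z))"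

lemma homog_part_add:
  assumes "y \<in> homog S e" "z \<in> homog S (e + 1)"
  shows "homog_part e (y \<oplus>\<^bsub>S\<^esub> z) = y"
  unfolding homog_part_def
proof (rule the_equality)
  show "y \<in> homog S e \<and> (\<exists>z'\<in>homog S (e + 1). y \<oplus>\<^bsub>S\<^esub> z = y \<oplus>\<^bsub>S\<^esub> z')"
    using assms by blast
next
  fix y' assume "y' \<in> homog S e \<and> (\<exists>z'\<in>homog S (e + 1). y \<oplus>\<^bsub>S\<^esub> z = y' \<oplus>\<^bsub>S\<^esub> z')"
  then obtain z' where "y' \<in> homog S e" "z' \<in> homog S (e + 1)"
    "y' \<oplus>\<^bsub>S\<^esub> z' = y \<oplus>\<^bsub>S\<^esub> z"
    by metis
  then show "y' = y" by (rule homog_decompose_unique[OF _ _ assms])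
qed

lemma homog_part_homog:
  assumes "x \<in> homog S e"
  shows "homog_part e' x = (if e' = e then x else \<zero>\<^bsub>S\<^esub>)"
proof (cases "e' = e")
  case True
  then show ?thesis
    using homog_part_add[OF assms homog_zero] homog_carrier[OF assms] by simp
next
  case False
  then have "e = e' + 1" by (cases e; cases e') auto
  then show ?thesis
    using homog_part_add[of "\<zero>\<^bsub>S\<^esub>" e' x] homog_carrier[OF assms] homog_zero assms False by simp
qed

lemma homog_part_linear: "homog_part e \<in> linear_maps K S S"
proof (rule linear_mapsI)
  note sub = submoduleE[OF homog_submodule]
  fix x assume "x \<in> carrier S"
  then obtain y z where yz: "y \<in> homog S e" "z \<in> homog S (e + 1)" "x = y \<oplus>\<^bsub>S\<^esub> z"
    by (rule homog_decompose)
  note c = homog_carrier[OF yz(1)] homog_carrier[OF yz(2)]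
  show "homog_part e x \<in> carrier S"
    using yz c by (simp add: homog_part_add)
  show "homog_part e (a \<odot>\<^bsub>S\<^esub> x) = a \<odot>\<^bsub>S\<^esub> homog_part e x" if "a \<in> carrier K" for a
    using yz c that by (simp add: smult_r_distr homog_part_add sub(4))
  fix x' assume "x' \<in> carrier S"
  then obtain y' z' where yz': "y' \<in> homog S e" "z' \<in> homog S (e + 1)" "x' = y' \<oplus>\<^bsub>S\<^esub> z'"
    by (rule homog_decompose)
  note c' = homog_carrier[OF yz'(1)] homog_carrier[OF yz'(2)]
  have "x \<oplus>\<^bsub>S\<^esub> x' = (y \<oplus>\<^bsub>S\<^esub> y') \<oplus>\<^bsub>S\<^esub> (z \<oplus>\<^bsub>S\<^esub> z')"
    using c c' by (simp add: yz(3) yz'(3) M.a_ac)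
  then show "homog_part e (x \<oplus>\<^bsub>S\<^esub> x') = homog_part e x \<oplus>\<^bsub>S\<^esub> homog_part e x'"
    using yz yz' by (simp add: homog_part_add sub(5))
qed

lemma homog_generates: "additively_generates S (homog S 0 \<union> homog S 1)"
  unfolding additively_generates_def
proof (intro conjI allI impI)
  show "homog S 0 \<union> homog S 1 \<subseteq> carrier S" using homog_subset by blast
next
  fix H assume H: "H \<subseteq> carrier S" and *: "homog S 0 \<union> homog S 1 \<subseteq> H \<and> \<zero>\<^bsub>S\<^esub> \<in> H \<and>
    (\<forall>x\<in>H. \<forall>y\<in>H. x \<oplus>\<^bsub>S\<^esub> y \<in> H)"
  have "x \<in> H" if x: "x \<in> carrier S" for x
  proof -
    obtain y z where "y \<in> homog S 0" "z \<in> homog S (0 + 1)" "x = y \<oplus>\<^bsub>S\<^esub> z"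
      using x by (rule homog_decompose)
    then show ?thesis using * by auto
  qed
  then show "H = carrier S" using H by blast
qed

text \<open>Multilinear expansion of every entry into its homogeneous parts leads to the formula
  \<open>x \<mapsto> \<Sum>\<^bsub>es\<^esub> g es (x\<^bsub>es\<^esub>)\<close>, where \<open>x\<^bsub>es\<^esub>\<close> consists of the parts of parities \<open>es\<close>. On a homogeneous
  tuple only the summand of its own parities survives, since any other has a zero entry.\<close>

lemma homog_linear_extension_exists:
  assumes T: "module K T"
    and g: "\<And>es. length es = n \<Longrightarrow> multilinear K S n T (g es)"
  shows "\<exists>f\<in>linear_maps K (tensor_power K S n) T.
    \<forall>es xs. length es = n \<and> length xs = n \<and> (\<forall>j<n. xs ! j \<in> homog S (es ! j))
      \<longrightarrow> f (tensor K S xs) = g es xs"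
proof -
  interpret T: module K T by (fact T)
  let ?E = "{es :: bit list. length es = n}"
  have "(UNIV :: bit set) \<subseteq> {0, 1}" by (metis UNIV_I bit.exhaust insert_iff subsetI)
  then have "finite (UNIV :: bit set)" by (rule finite_subset) simp
  then have fin: "finite ?E" using finite_lists_length_eq[of "UNIV :: bit set" n] by simp
  define F where "F es xs = map (\<lambda>j. homog_part (es ! j) (xs ! j)) [0..<n]" for es xs
  have F: "multilinear K S n T (\<lambda>xs. g es (F es xs))" if "es \<in> ?E" for es
  proof (rule multilinear_compose[OF module g])
    fix xs i assume xs: "xs \<in> tuples S n"
    show "F es xs \<in> tuples S n"
      using tuples_nth[OF xs] linear_maps_closed[OF homog_part_linear]
      by (intro tuplesI) (auto simp: F_def)
    assume i: "i < n"
    have "F es (xs[i := x]) = (F es xs)[i := homog_part (es ! i) x]" for x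
      using xs i by (intro nth_equalityI) (auto simp: F_def nth_list_update tuples_def)
    then show "\<exists>j<n. \<exists>\<psi>\<in>linear_maps K S S. \<forall>x\<in>carrier S. F es (xs[i := x]) = (F es xs)[j := \<psi> x]"
      using i homog_part_linear by blast
  qed (use that in simp)
  have sum: "multilinear K S n T (\<lambda>xs. \<Oplus>\<^bsub>T\<^esub>es\<in>?E. g es (F es xs))"
    by (rule finsum_multilinear[OF T F])
  obtain f where f: "f \<in> linear_maps K (tensor_power K S n) T"
    and fv: "\<And>xs. xs \<in> tuples S n \<Longrightarrow> f (tensor K S xs) = (\<Oplus>\<^bsub>T\<^esub>es\<in>?E. g es (F es xs))"
    by (rule tensor_power_lift[OF module T sum]) (rule that)
  have "f (tensor K S xs) = g es xs"
    if es: "length es = n" and xs: "length xs = n" "\<And>j. j < n \<Longrightarrow> xs ! j \<in> homog S (es ! j)" for es xs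
  proof -
    have t: "xs \<in> tuples S n" using xs homog_carrier by (blast intro: tuplesI)
    have tF: "F es' xs \<in> tuples S n" for es'
      using tuples_nth[OF t] linear_maps_closed[OF homog_part_linear]
      by (intro tuplesI) (auto simp: F_def)
    have "homog_part (es ! j) (xs ! j) = xs ! j" if "j < n" for j
      using homog_part_homog[OF xs(2)[OF that], of "es ! j"] by simp
    then have [simp]: "F es xs = xs"
      using xs(1) by (intro nth_equalityI) (auto simp: F_def)
    have "(\<Oplus>\<^bsub>T\<^esub>es\<in>?E. g es (F es xs)) = g es (F es xs)"
    proof (rule finsum_single[OF T.abelian_monoid_axioms fin])
      fix es' assume es': "es' \<in> ?E" "es' \<noteq> es"
      then obtain j where j: "j < n" "es' ! j \<noteq> es ! j" using es by (auto simp: list_eq_iff_nth_eq)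
      have "F es' xs ! j = \<zero>\<^bsub>S\<^esub>" using j homog_part_homog[OF xs(2)[OF j(1)], of "es' ! j"] by (simp add: F_def)
      then show "g es' (F es' xs) = \<zero>\<^bsub>T\<^esub>"
        using multilinear_zero_entry[OF module T g tF j(1)] es' by simp
    qed (use es multilinear_closed[OF g t] in auto)
    then show ?thesis using fv[OF t] by simp
  qed
  then show ?thesis using f by blast
qed

lemma homog_linear_extension_properties:
  assumes T: "module K T"
    and g: "\<And>es. length es = n \<Longrightarrow> multilinear K S n T (g es)"
  shows homog_linear_extension_linear:
      "homog_linear_extension K S n T g \<in> linear_maps K (tensor_power K S n) T"
    and homog_linear_extension_tensor:
      "\<lbrakk>length es = n; length xs = n; \<And>j. j < n \<Longrightarrow> xs ! j \<in> homog S (es ! j)\<rbrakk>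
        \<Longrightarrow> homog_linear_extension K S n T g (tensor K S xs) = g es xs"
proof -
  let ?C = "carrier (tensor_power K S n)"
  let ?P = "\<lambda>f. f \<in> linear_maps K (tensor_power K S n) T \<and> f \<in> extensional ?C \<and>
     (\<forall>es xs. length es = n \<and> length xs = n \<and> (\<forall>j<n. xs ! j \<in> homog S (es ! j))
        \<longrightarrow> f (tensor K S xs) = g es xs)"
  obtain f where f: "f \<in> linear_maps K (tensor_power K S n) T"
    "\<forall>es xs. length es = n \<and> length xs = n \<and> (\<forall>j<n. xs ! j \<in> homog S (es ! j))
      \<longrightarrow> f (tensor K S xs) = g es xs"
    using homog_linear_extension_exists[OF T, of n g] g by blast
  define r where "r = restrict f ?C"
  have "r \<in> linear_maps K (tensor_power K S n) T"
    by (rule linear_maps_cong[OF tensor_power_module[OF module] f(1)]) (simp add: r_def)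
  moreover have "r (tensor K S xs) = g es xs"
    if "length es = n" "length xs = n" "\<forall>j<n. xs ! j \<in> homog S (es ! j)" for es xs
  proof -
    have "tensor K S xs \<in> ?C"
      using that homog_carrier by (intro tensor_closed[OF module] tuplesI) blast+
    then show ?thesis using that f(2) by (simp add: r_def)
  qed
  moreover have "r \<in> extensional ?C" by (simp add: r_def)
  ultimately have r: "?P r"
    by blast
  have "\<exists>!f. ?P f"
  proof (rule ex1I[of _ r])
    fix f1 assume P1: "?P f1"
    show "f1 = r"
    proof (rule extensionalityI)
      show "f1 x = r x" if x: "x \<in> ?C" for x
      proof (rule linear_maps_eq_on_generators[OF module T homog_generates _ _ _ x])
        fix xs assume xs: "length xs = n" "set xs \<subseteq> homog S 0 \<union> homog S 1"
        define es where "es = map (\<lambda>x. if x \<in> homog S 0 then 0 else 1 :: bit) xs"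
        have "\<forall>j<n. xs ! j \<in> homog S (es ! j)" "length es = n"
          using xs by (auto simp: es_def subset_iff in_set_conv_nth)
        then show "f1 (tensor K S xs) = r (tensor K S xs)"
          using r P1 xs(1) by metis
      qed (use r P1 in simp_all)
    qed (use r P1 in blast)+
  qed (rule r)
  from theI'[OF this]
  show "homog_linear_extension K S n T g \<in> linear_maps K (tensor_power K S n) T"
    and "\<lbrakk>length es = n; length xs = n; \<And>j. j < n \<Longrightarrow> xs ! j \<in> homog S (es ! j)\<rbrakk>
        \<Longrightarrow> homog_linear_extension K S n T g (tensor K S xs) = g es xs"
    unfolding homog_linear_extension_def by blast+
qed

end

section \<open>Matrix superalgebras\<close>

lemma superalgebra_graded_module:
  assumes "superalgebra K S"
  shows "graded_module K S"
proof -
  interpret superalgebra K S by fact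
  show ?thesis
    by (intro graded_module.intro graded_module_axioms.intro module_axioms
        homog_submodule homog_sum homog_inter)
qed

locale supermatrices = R: superalgebra K R
  for K :: "'k ring" and R :: "('k, 'a) superalgebra" +
  fixes p q :: nat
begin

sublocale RG: graded_module K R
  by (rule superalgebra_graded_module) (rule R.superalgebra_axioms)

abbreviation n :: nat where "n \<equiv> p + q"

abbreviation S :: "('k, 'a mat) superalgebra" where "S \<equiv> matrix_superalgebra p q R"

definition index_parity :: "nat \<Rightarrow> bit" where
  "index_parity i = (if i < p then 0 else 1)"

definition E :: "nat \<Rightarrow> nat \<Rightarrow> 'a \<Rightarrow> 'a mat" where
  "E i j a = mat n n (\<lambda>(k, l). if k = i \<and> l = j then a else \<zero>\<^bsub>R\<^esub>)"

lemma E11_eq: "E11 p q R = E 0 0"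
  by (simp add: E11_def E_def fun_eq_iff)

lemma carrier_matrix_iff:
  "A \<in> carrier S \<longleftrightarrow> A \<in> carrier_mat n n \<and> (\<forall>i<n. \<forall>j<n. A $$ (i, j) \<in> carrier R)"
  by (auto simp: matrix_superalgebra_def Let_def elements_mat_def UN_subset_iff image_subset_iff)

text \<open>In terms of index parities the four blocks need no separate treatment.\<close>

lemma homog_matrix_iff:
  "A \<in> homog S e \<longleftrightarrow> A \<in> carrier_mat n n \<and>
    (\<forall>i<n. \<forall>j<n. A $$ (i, j) \<in> homog R (e + index_parity i + index_parity j))"
proof -
  have *: "(if i < p \<longleftrightarrow> j < p then e else e + 1) = e + index_parity i + index_parity j" for i j
    by (cases e) (auto simp: index_parity_def)
  show ?thesis unfolding * [symmetric] by (auto simp: matrix_superalgebra_def Let_def)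
qed

lemma matrix_ops:
  "A \<oplus>\<^bsub>S\<^esub> B = mat n n (\<lambda>(i, j). A $$ (i, j) \<oplus>\<^bsub>R\<^esub> B $$ (i, j))"
  "A \<otimes>\<^bsub>S\<^esub> B = mat n n (\<lambda>(i, j). \<Oplus>\<^bsub>R\<^esub>l\<in>{..<n}. A $$ (i, l) \<otimes>\<^bsub>R\<^esub> B $$ (l, j))"
  "c \<odot>\<^bsub>S\<^esub> A = mat n n (\<lambda>(i, j). c \<odot>\<^bsub>R\<^esub> A $$ (i, j))"
  "\<zero>\<^bsub>S\<^esub> = mat n n (\<lambda>_. \<zero>\<^bsub>R\<^esub>)"
  by (simp_all add: matrix_superalgebra_def Let_def)

lemma carrier_matrix_dim: "A \<in> carrier S \<Longrightarrow> dim_row A = n" "A \<in> carrier S \<Longrightarrow> dim_col A = n"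
  by (auto simp: carrier_matrix_iff)

lemma carrier_matrix_entry: "\<lbrakk>A \<in> carrier S; i < n; j < n\<rbrakk> \<Longrightarrow> A $$ (i, j) \<in> carrier R"
  by (auto simp: carrier_matrix_iff)

lemma matrix_module: "module K S"
proof (rule moduleI)
  show "cring K" by (rule R.R.cring_axioms)
  note c = carrier_matrix_dim carrier_matrix_entry
  show "abelian_group S"
  proof (rule abelian_groupI)
    fix A assume A: "A \<in> carrier S"
    show "\<exists>B\<in>carrier S. B \<oplus>\<^bsub>S\<^esub> A = \<zero>\<^bsub>S\<^esub>"
    proof (rule bexI)
      show "mat n n (\<lambda>ij. \<ominus>\<^bsub>R\<^esub> A $$ ij) \<oplus>\<^bsub>S\<^esub> A = \<zero>\<^bsub>S\<^esub>"
        by (rule eq_matI) (auto simp: matrix_ops c[OF A] R.M.l_neg)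
    qed (auto simp: carrier_matrix_iff c[OF A])
    show "\<zero>\<^bsub>S\<^esub> \<oplus>\<^bsub>S\<^esub> A = A"
      by (rule eq_matI) (auto simp: matrix_ops c[OF A])
    fix B assume B: "B \<in> carrier S"
    show "A \<oplus>\<^bsub>S\<^esub> B \<in> carrier S"
      by (auto simp: carrier_matrix_iff matrix_ops c[OF A] c[OF B])
    show "A \<oplus>\<^bsub>S\<^esub> B = B \<oplus>\<^bsub>S\<^esub> A"
      by (rule eq_matI) (auto simp: matrix_ops c[OF A] c[OF B] R.M.a_comm)
    fix C assume C: "C \<in> carrier S"
    show "A \<oplus>\<^bsub>S\<^esub> B \<oplus>\<^bsub>S\<^esub> C = A \<oplus>\<^bsub>S\<^esub> (B \<oplus>\<^bsub>S\<^esub> C)"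
      by (rule eq_matI) (auto simp: matrix_ops c[OF A] c[OF B] c[OF C] R.M.a_assoc)
  qed (auto simp: carrier_matrix_iff matrix_ops)
  show "x \<odot>\<^bsub>S\<^esub> A \<in> carrier S" if "x \<in> carrier K" "A \<in> carrier S" for x A
    using that by (auto simp: carrier_matrix_iff matrix_ops)
  show "(x \<oplus>\<^bsub>K\<^esub> y) \<odot>\<^bsub>S\<^esub> A = x \<odot>\<^bsub>S\<^esub> A \<oplus>\<^bsub>S\<^esub> y \<odot>\<^bsub>S\<^esub> A"
    if "x \<in> carrier K" "y \<in> carrier K" "A \<in> carrier S" for x y A
    using that by (intro eq_matI) (auto simp: matrix_ops c R.smult_l_distr)
  show "x \<odot>\<^bsub>S\<^esub> (A \<oplus>\<^bsub>S\<^esub> B) = x \<odot>\<^bsub>S\<^esub> A \<oplus>\<^bsub>S\<^esub> x \<odot>\<^bsub>S\<^esub> B"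
    if "x \<in> carrier K" "A \<in> carrier S" "B \<in> carrier S" for x A B
    using that by (intro eq_matI) (auto simp: matrix_ops c R.smult_r_distr)
  show "(x \<otimes>\<^bsub>K\<^esub> y) \<odot>\<^bsub>S\<^esub> A = x \<odot>\<^bsub>S\<^esub> (y \<odot>\<^bsub>S\<^esub> A)"
    if "x \<in> carrier K" "y \<in> carrier K" "A \<in> carrier S" for x y A
    using that by (intro eq_matI) (auto simp: matrix_ops c R.smult_assoc1)
  show "\<one>\<^bsub>K\<^esub> \<odot>\<^bsub>S\<^esub> A = A" if "A \<in> carrier S" for A
    using that by (intro eq_matI) (auto simp: matrix_ops c)
qed

lemma entry_linear: "\<lbrakk>i < n; j < n\<rbrakk> \<Longrightarrow> (\<lambda>A. A $$ (i, j)) \<in> linear_maps K S R"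
  by (rule linear_mapsI) (auto simp: carrier_matrix_iff matrix_ops)

lemma E_linear: "E i j \<in> linear_maps K R S"
  by (rule linear_mapsI) (auto intro!: eq_matI simp: E_def carrier_matrix_iff matrix_ops)

lemma E_closed: "a \<in> carrier R \<Longrightarrow> E i j a \<in> carrier S"
  by (rule linear_maps_closed[OF E_linear])

lemma E_entry: "\<lbrakk>k < n; l < n\<rbrakk> \<Longrightarrow> E i j a $$ (k, l) = (if k = i \<and> l = j then a else \<zero>\<^bsub>R\<^esub>)"
  by (simp add: E_def)

lemma E_zero: "E i j \<zero>\<^bsub>R\<^esub> = \<zero>\<^bsub>S\<^esub>"
  by (rule eq_matI) (auto simp: E_def matrix_ops)

lemma E_homog: "\<lbrakk>a \<in> homog R e; f = e + index_parity i + index_parity j\<rbrakk> \<Longrightarrow> E i j a \<in> homog S f"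
  by (cases e; cases "index_parity i"; cases "index_parity j")
    (auto simp: homog_matrix_iff E_def RG.homog_zero)

lemma E_mult:
  assumes "a \<in> carrier R" "b \<in> carrier R" "j < n"
  shows "E i j a \<otimes>\<^bsub>S\<^esub> E k l b = (if j = k then E i l (a \<otimes>\<^bsub>R\<^esub> b) else \<zero>\<^bsub>S\<^esub>)"
proof (rule eq_matI)
  fix r s assume "r < dim_row (if j = k then E i l (a \<otimes>\<^bsub>R\<^esub> b) else \<zero>\<^bsub>S\<^esub>)"
    "s < dim_col (if j = k then E i l (a \<otimes>\<^bsub>R\<^esub> b) else \<zero>\<^bsub>S\<^esub>)"
  then have rs: "r < n" "s < n" by (auto simp: E_def matrix_ops split: if_splits)
  have "(\<Oplus>\<^bsub>R\<^esub>t\<in>{..<n}. E i j a $$ (r, t) \<otimes>\<^bsub>R\<^esub> E k l b $$ (t, s)) =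
      E i j a $$ (r, j) \<otimes>\<^bsub>R\<^esub> E k l b $$ (j, s)"
    using assms rs
    by (intro finsum_single[OF R.M.abelian_monoid_axioms]) (auto simp: E_entry)
  then show "(E i j a \<otimes>\<^bsub>S\<^esub> E k l b) $$ (r, s) =
      (if j = k then E i l (a \<otimes>\<^bsub>R\<^esub> b) else \<zero>\<^bsub>S\<^esub>) $$ (r, s)"
    using assms rs by (simp add: matrix_ops E_entry)
qed (auto simp: E_def matrix_ops)

lemma matrix_mult_entry_linear:
  assumes "i < n" "j < n"
  shows "A \<in> carrier S \<Longrightarrow>
      (\<lambda>B. \<Oplus>\<^bsub>R\<^esub>l\<in>{..<n}. A $$ (i, l) \<otimes>\<^bsub>R\<^esub> B $$ (l, j)) \<in> linear_maps K S R"
    and "B \<in> carrier S \<Longrightarrow>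
      (\<lambda>A. \<Oplus>\<^bsub>R\<^esub>l\<in>{..<n}. A $$ (i, l) \<otimes>\<^bsub>R\<^esub> B $$ (l, j)) \<in> linear_maps K S R"
proof -
  show "(\<lambda>B. \<Oplus>\<^bsub>R\<^esub>l\<in>{..<n}. A $$ (i, l) \<otimes>\<^bsub>R\<^esub> B $$ (l, j)) \<in> linear_maps K S R" if "A \<in> carrier S"
  proof (rule finsum_linear_maps[OF RG.module])
    fix l assume "l \<in> {..<n}"
    then have "(\<lambda>x. A $$ (i, l) \<otimes>\<^bsub>R\<^esub> x) \<in> linear_maps K R R"
      using that assms
      by (intro linear_mapsI) (auto simp: carrier_matrix_iff R.S.r_distr R.smult_mult_right)
    then show "(\<lambda>B. A $$ (i, l) \<otimes>\<^bsub>R\<^esub> B $$ (l, j)) \<in> linear_maps K S R"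
      using \<open>l \<in> {..<n}\<close> assms by (intro linear_maps_compose[OF entry_linear]) auto
  qed
  show "(\<lambda>A. \<Oplus>\<^bsub>R\<^esub>l\<in>{..<n}. A $$ (i, l) \<otimes>\<^bsub>R\<^esub> B $$ (l, j)) \<in> linear_maps K S R" if "B \<in> carrier S"
  proof (rule finsum_linear_maps[OF RG.module])
    fix l assume "l \<in> {..<n}"
    then have "(\<lambda>x. x \<otimes>\<^bsub>R\<^esub> B $$ (l, j)) \<in> linear_maps K R R"
      using that assms
      by (intro linear_mapsI) (auto simp: carrier_matrix_iff R.S.l_distr R.smult_mult_left)
    then show "(\<lambda>A. A $$ (i, l) \<otimes>\<^bsub>R\<^esub> B $$ (l, j)) \<in> linear_maps K S R"
      using \<open>l \<in> {..<n}\<close> assms by (intro linear_maps_compose[OF entry_linear]) auto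
  qed
qed

lemma matrix_linearI:
  assumes M: "module K M" and "\<And>x. x \<in> carrier M \<Longrightarrow> f x \<in> carrier_mat n n"
    and "\<And>i j. \<lbrakk>i < n; j < n\<rbrakk> \<Longrightarrow> (\<lambda>x. f x $$ (i, j)) \<in> linear_maps K M R"
  shows "f \<in> linear_maps K M S"
proof -
  interpret M: module K M by (fact M)
  note d = carrier_matD[OF assms(2)] and l = linear_mapsD[OF assms(3)]
  show ?thesis
  proof (rule linear_mapsI)
    fix x assume x: "x \<in> carrier M"
    show "f x \<in> carrier S" using assms(2) x l(1) by (simp add: carrier_matrix_iff)
    show "f (x \<oplus>\<^bsub>M\<^esub> y) = f x \<oplus>\<^bsub>S\<^esub> f y" if "y \<in> carrier M" for y
      using x that by (intro eq_matI) (simp_all add: matrix_ops d l(2))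
    show "f (c \<odot>\<^bsub>M\<^esub> x) = c \<odot>\<^bsub>S\<^esub> f x" if "c \<in> carrier K" for c
      using x that by (intro eq_matI) (simp_all add: matrix_ops d l(3))
  qed
qed

lemma mult_linear_right: "A \<in> carrier S \<Longrightarrow> (\<lambda>B. A \<otimes>\<^bsub>S\<^esub> B) \<in> linear_maps K S S"
  using matrix_mult_entry_linear(1) by (intro matrix_linearI matrix_module) (simp_all add: matrix_ops)

lemma mult_linear_left: "B \<in> carrier S \<Longrightarrow> (\<lambda>A. A \<otimes>\<^bsub>S\<^esub> B) \<in> linear_maps K S S"
  using matrix_mult_entry_linear(2) by (intro matrix_linearI matrix_module) (simp_all add: matrix_ops)

lemma mult_matrix_closed: "\<lbrakk>A \<in> carrier S; B \<in> carrier S\<rbrakk> \<Longrightarrow> A \<otimes>\<^bsub>S\<^esub> B \<in> carrier S"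
  by (rule linear_maps_closed[OF mult_linear_right])

text \<open>All conditions hold entrywise, since each position of a matrix shifts the parity by a fixed
  amount.\<close>

lemma matrix_graded: "graded_module K S"
proof -
  interpret S: module K S by (rule matrix_module)
  note sub = R.submoduleE[OF RG.homog_submodule]
  have sub_S: "homog S e \<subseteq> carrier S" for e
    using RG.homog_carrier by (fastforce simp: homog_matrix_iff carrier_matrix_iff)
  have neg: "(\<ominus>\<^bsub>S\<^esub> A) $$ (i, j) = \<ominus>\<^bsub>R\<^esub> A $$ (i, j)" if "A \<in> carrier S" "i < n" "j < n" for A i j
    using linear_maps_neg[OF matrix_module RG.module entry_linear] that by blast
  show ?thesis
  proof (intro graded_module.intro graded_module_axioms.intro matrix_module)
    show submod: "submodule (homog S e) K S" for e
    proof (rule S.submoduleI[OF sub_S])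
      show "\<zero>\<^bsub>S\<^esub> \<in> homog S e" by (auto simp: homog_matrix_iff matrix_ops RG.homog_zero)
      fix A assume A: "A \<in> homog S e"
      then have c: "A \<in> carrier S" using sub_S by blast
      show "\<ominus>\<^bsub>S\<^esub> A \<in> homog S e"
        using A S.a_inv_closed[OF c] sub(3)
        by (auto simp: homog_matrix_iff neg[OF c] carrier_matrix_iff)
      show "A \<oplus>\<^bsub>S\<^esub> B \<in> homog S e" if "B \<in> homog S e" for B
        using A that sub(5) by (auto simp: homog_matrix_iff matrix_ops)
      show "c \<odot>\<^bsub>S\<^esub> A \<in> homog S e" if "c \<in> carrier K" for c
        using A that sub(4) by (auto simp: homog_matrix_iff matrix_ops)
    qed
    show "homog S 0 <+>\<^bsub>S\<^esub> homog S 1 = carrier S"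
    proof
      show "homog S 0 <+>\<^bsub>S\<^esub> homog S 1 \<subseteq> carrier S"
        using sub_S S.a_closed by (auto simp: set_add_def')
      show "carrier S \<subseteq> homog S 0 <+>\<^bsub>S\<^esub> homog S 1"
      proof
        fix A assume A: "A \<in> carrier S"
        let ?P = "\<lambda>e. mat n n (\<lambda>(i, j). RG.homog_part (e + index_parity i + index_parity j) (A $$ (i, j)))"
        have part: "x = RG.homog_part e x \<oplus>\<^bsub>R\<^esub> RG.homog_part (1 + e) x"
          "RG.homog_part e x \<in> homog R e" if x: "x \<in> carrier R" for e x
        proof -
          obtain y z where yz: "y \<in> homog R e" "z \<in> homog R (e + 1)" "x = y \<oplus>\<^bsub>R\<^esub> z"
            using x by (rule RG.homog_decompose)
          have zy: "x = z \<oplus>\<^bsub>R\<^esub> y" using yz RG.homog_carrier R.M.a_comm by metis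
          have "RG.homog_part e x = y" using yz RG.homog_part_add by blast
          moreover have "RG.homog_part (1 + e) x = z"
            using yz zy RG.homog_part_add[of z "1 + e" y] by (cases e) auto
          ultimately show "x = RG.homog_part e x \<oplus>\<^bsub>R\<^esub> RG.homog_part (1 + e) x"
            "RG.homog_part e x \<in> homog R e" using yz by auto
        qed
        have h: "?P e \<in> homog S e" for e
          using part(2) A by (auto simp: homog_matrix_iff carrier_matrix_iff)
        have "A = ?P 0 \<oplus>\<^bsub>S\<^esub> ?P 1"
        proof (rule eq_matI)
          fix i j assume "i < dim_row (?P 0 \<oplus>\<^bsub>S\<^esub> ?P 1)" "j < dim_col (?P 0 \<oplus>\<^bsub>S\<^esub> ?P 1)"
          then have ij: "i < n" "j < n" by (simp_all add: matrix_ops)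
          then show "A $$ (i, j) = (?P 0 \<oplus>\<^bsub>S\<^esub> ?P 1) $$ (i, j)"
            using part(1)[OF carrier_matrix_entry[OF A ij], of "index_parity i + index_parity j"]
            by (cases "index_parity i"; cases "index_parity j") (simp_all add: matrix_ops)
        qed (use A in \<open>simp_all add: matrix_ops carrier_matrix_dim\<close>)
        then show "A \<in> homog S 0 <+>\<^bsub>S\<^esub> homog S 1" using h unfolding set_add_def' by blast
      qed
    qed
    show "homog S 0 \<inter> homog S 1 = {\<zero>\<^bsub>S\<^esub>}"
    proof (intro equalityI subsetI)
      fix A assume A: "A \<in> homog S 0 \<inter> homog S 1"
      have "A $$ (i, j) = \<zero>\<^bsub>R\<^esub>" if "i < n" "j < n" for i j
      proof (rule RG.homog_disjoint)
        show "A $$ (i, j) \<in> homog R (0 + index_parity i + index_parity j)"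
          "A $$ (i, j) \<in> homog R (1 + index_parity i + index_parity j)"
          using that IntD1[OF A] IntD2[OF A] unfolding homog_matrix_iff by blast+
      qed (cases "index_parity i"; cases "index_parity j"; simp)
      then show "A \<in> {\<zero>\<^bsub>S\<^esub>}"
        using A by (auto intro!: eq_matI simp: homog_matrix_iff matrix_ops)
    qed (auto simp: homog_matrix_iff matrix_ops RG.homog_zero)
  qed
qed

sublocale SG: graded_module K S
  by (rule matrix_graded)

text \<open>A matrix is the sum of the \<open>E i j\<close> of its entries, and each entry is the sum of its two
  homogeneous parts.\<close>

lemma elementary_generates:
  "additively_generates S {E i j a | i j a. i < n \<and> j < n \<and> (\<exists>e. a \<in> homog R e)}"
  (is "additively_generates S ?G")
  unfolding additively_generates_def
proof (intro conjI allI impI)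
  show "?G \<subseteq> carrier S" using E_closed RG.homog_carrier by auto
  fix H assume H: "H \<subseteq> carrier S" and *: "?G \<subseteq> H \<and> \<zero>\<^bsub>S\<^esub> \<in> H \<and> (\<forall>A\<in>H. \<forall>B\<in>H. A \<oplus>\<^bsub>S\<^esub> B \<in> H)"
  have E_in: "E i j a \<in> H" if ij: "i < n" "j < n" and a: "a \<in> carrier R" for i j a
  proof -
    obtain y z where yz: "y \<in> homog R 0" "z \<in> homog R (0 + 1)" "a = y \<oplus>\<^bsub>R\<^esub> z"
      using a by (rule RG.homog_decompose)
    then have "E i j a = E i j y \<oplus>\<^bsub>S\<^esub> E i j z"
      by (simp add: linear_maps_add[OF E_linear] RG.homog_carrier)
    moreover have "E i j y \<in> ?G" "E i j z \<in> ?G" using ij yz by blast+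
    ultimately have "E i j y \<in> H" "E i j z \<in> H" "E i j a = E i j y \<oplus>\<^bsub>S\<^esub> E i j z"
      using * by blast+
    then show ?thesis using * by simp
  qed
  have sum_in: "(\<Oplus>\<^bsub>S\<^esub>x\<in>X. f x) \<in> H" if "finite X" "\<And>x. x \<in> X \<Longrightarrow> f x \<in> H" for X and f :: "nat \<times> nat \<Rightarrow> 'a mat"
    using that
  proof (induction X)
    case (insert x X)
    have "f x \<in> H" by (rule insert.prems) simp
    moreover have "(\<Oplus>\<^bsub>S\<^esub>x\<in>X. f x) \<in> H" by (rule insert.IH) (rule insert.prems, simp)
    moreover have "f \<in> X \<rightarrow> carrier S" using insert.prems H by blast
    ultimately show ?case using insert.hyps H * by (auto simp: SG.M.finsum_insert)
  qed (use * in simp)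
  have "A \<in> H" if A: "A \<in> carrier S" for A
  proof -
    let ?I = "{..<n} \<times> {..<n}"
    let ?f = "\<lambda>(i, j). E i j (A $$ (i, j))"
    have f: "?f x \<in> carrier S" if "x \<in> ?I" for x
      using that A by (auto intro!: E_closed carrier_matrix_entry)
    have sc: "(\<Oplus>\<^bsub>S\<^esub>x\<in>?I. ?f x) \<in> carrier S" using f by (intro SG.M.finsum_closed) blast
    have "A = (\<Oplus>\<^bsub>S\<^esub>x\<in>?I. ?f x)"
    proof (rule eq_matI)
      fix i j assume "i < dim_row (\<Oplus>\<^bsub>S\<^esub>x\<in>?I. ?f x)" "j < dim_col (\<Oplus>\<^bsub>S\<^esub>x\<in>?I. ?f x)"
      then have ij: "i < n" "j < n" using sc by (simp_all add: carrier_matrix_dim)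
      have "(\<Oplus>\<^bsub>S\<^esub>x\<in>?I. ?f x) $$ (i, j) = (\<Oplus>\<^bsub>R\<^esub>x\<in>?I. ?f x $$ (i, j))"
        using f by (intro linear_maps_finsum[OF matrix_module RG.module entry_linear[OF ij]])
      also have "\<dots> = ?f (i, j) $$ (i, j)"
        using ij A
        by (intro finsum_single[OF R.M.abelian_monoid_axioms])
          (auto simp: E_entry carrier_matrix_entry split: if_splits)
      finally show "A $$ (i, j) = (\<Oplus>\<^bsub>S\<^esub>x\<in>?I. ?f x) $$ (i, j)" using ij by (simp add: E_entry)
    qed (use A sc in \<open>simp_all add: carrier_matrix_dim\<close>)
    also have "\<dots> \<in> H"
      using A by (intro sum_in) (auto intro!: E_in carrier_matrix_entry)
    finally show ?thesis .
  qed
  then show "H = carrier S" using H by blast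
qed

end

section \<open>Face maps on pure tensors\<close>

lemma slot_updateI:
  assumes "j < k" "\<psi> \<in> L" "\<And>x. x \<in> C \<Longrightarrow> F x = ys[j := \<psi> x]"
  shows "\<exists>j<k. \<exists>\<psi>\<in>L. \<forall>x\<in>C. F x = ys[j := \<psi> x]"
  using assms by blast

lemma nth_less_bound: "\<lbrakk>set ix \<subseteq> {..<k}; s < length ix\<rbrakk> \<Longrightarrow> ix ! s < k" for k :: nat
  by (meson lessThan_iff nth_mem subsetD)

context supermatrices begin

lemma hochschild_module: "module K (hochschild K S m)"
  unfolding hochschild_def by (rule tensor_power_module[OF matrix_module])

lemma hochschild_R_module: "module K (hochschild K R m)"
  unfolding hochschild_def by (rule tensor_power_module[OF RG.module])

abbreviation pure :: "nat \<Rightarrow> (nat \<Rightarrow> 'a mat) \<Rightarrow> ('a mat list \<Rightarrow> 'k) set" where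
  "pure m A \<equiv> tensor K S (map A [0..<m])"

lemma pure_cong: "(\<And>s. s < m \<Longrightarrow> A s = B s) \<Longrightarrow> pure m A = pure m B"
  by (rule arg_cong[of _ _ "tensor K S"]) simp

lemma map_tuples: "(\<And>s. s < m \<Longrightarrow> f s \<in> carrier M) \<Longrightarrow> map f [0..<m] \<in> tuples M m"
  by (rule tuplesI) auto

lemma pure_closed:
  "(\<And>s. s \<le> m \<Longrightarrow> A s \<in> carrier S) \<Longrightarrow> pure (Suc m) A \<in> carrier (hochschild K S m)"
  unfolding hochschild_def by (intro tensor_closed[OF matrix_module] map_tuples) simp

lemma pure_zero:
  assumes "\<And>s. s \<le> m \<Longrightarrow> A s \<in> carrier S" "s \<le> m" "A s = \<zero>\<^bsub>S\<^esub>"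
  shows "pure (Suc m) A = \<zero>\<^bsub>hochschild K S m\<^esub>"
  unfolding hochschild_def
  by (rule multilinear_zero_entry[OF matrix_module tensor_power_module[OF matrix_module]
        multilinear_tensor[OF matrix_module], where i = s]) (use assms in \<open>auto intro!: map_tuples simp del: upt_Suc\<close>)

lemma merge_multilinear:
  assumes "i < m"
  shows "multilinear K S (Suc m) (tensor_power K S m)
    (\<lambda>As. tensor K S (take i As @ (As ! i \<otimes>\<^bsub>S\<^esub> As ! (i + 1)) # drop (i + 2) As))"
proof (rule multilinear_compose[OF matrix_module multilinear_tensor[OF matrix_module]])
  fix As assume As: "As \<in> tuples S (Suc m)"
  note c = tuples_nth[OF As]
  have len: "length As = Suc m" using As by (simp add: tuples_def)
  let ?F = "\<lambda>As. take i As @ (As ! i \<otimes>\<^bsub>S\<^esub> As ! (i + 1)) # drop (i + 2) As"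
  show "?F As \<in> tuples S m"
    using assms c len
    by (intro tuplesI) (auto simp: nth_append nth_Cons mult_matrix_closed split: nat.split)
  fix r assume r: "r < Suc m"
  consider "r < i" | "r = i" | "r = i + 1" | "r > i + 1" by linarith
  then show "\<exists>j<m. \<exists>\<psi>\<in>linear_maps K S S. \<forall>x\<in>carrier S. ?F (As[r := x]) = (?F As)[j := \<psi> x]"
  proof cases
    case 1
    then have "?F (As[r := x]) = (?F As)[r := x]" for x
      using assms len
      by (intro nth_equalityI) (auto simp: nth_append nth_list_update nth_Cons' split: nat.split)
    then show ?thesis using 1 assms linear_maps_id by (intro slot_updateI[of r _ "\<lambda>x. x"]) auto
  next
    case 2
    then have "?F (As[r := x]) = (?F As)[i := x \<otimes>\<^bsub>S\<^esub> As ! (i + 1)]" for x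
      using assms len
      by (intro nth_equalityI) (auto simp: nth_append nth_list_update nth_Cons' split: nat.split)
    moreover have "(\<lambda>x. x \<otimes>\<^bsub>S\<^esub> As ! (i + 1)) \<in> linear_maps K S S"
      using c assms by (intro mult_linear_left) simp
    ultimately show ?thesis using assms by (intro slot_updateI[of i])
  next
    case 3
    then have "?F (As[r := x]) = (?F As)[i := As ! i \<otimes>\<^bsub>S\<^esub> x]" for x
      using assms len
      by (intro nth_equalityI) (auto simp: nth_append nth_list_update nth_Cons' split: nat.split)
    moreover have "(\<lambda>x. As ! i \<otimes>\<^bsub>S\<^esub> x) \<in> linear_maps K S S"
      using c assms by (intro mult_linear_right) simp
    ultimately show ?thesis using assms by (intro slot_updateI[of i])
  next
    case 4
    then have "?F (As[r := x]) = (?F As)[r - 1 := x]" for x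
      using assms len r
      by (intro nth_equalityI) (auto simp: nth_append nth_list_update nth_Cons' split: nat.split)
    then show ?thesis using 4 r linear_maps_id
      by (intro slot_updateI[of "r - 1" _ "\<lambda>x. x"]) auto
  qed
qed

lemma cyclic_merge_multilinear:
  assumes "0 < m"
  shows "multilinear K S (Suc m) (tensor_power K S m)
    (\<lambda>As. tensor K S ((As ! m \<otimes>\<^bsub>S\<^esub> As ! 0) # map ((!) As) [1..<m]))"
proof (rule multilinear_compose[OF matrix_module multilinear_tensor[OF matrix_module]])
  fix As assume As: "As \<in> tuples S (Suc m)"
  note c = tuples_nth[OF As]
  have len: "length As = Suc m" using As by (simp add: tuples_def)
  let ?F = "\<lambda>As. (As ! m \<otimes>\<^bsub>S\<^esub> As ! 0) # map ((!) As) [1..<m]"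
  show "?F As \<in> tuples S m"
    using assms c by (intro tuplesI) (auto simp: nth_Cons mult_matrix_closed split: nat.split)
  fix r assume r: "r < Suc m"
  consider "r = 0" | "0 < r" "r < m" | "r = m" using r by linarith
  then show "\<exists>j<m. \<exists>\<psi>\<in>linear_maps K S S. \<forall>x\<in>carrier S. ?F (As[r := x]) = (?F As)[j := \<psi> x]"
  proof cases
    case 1
    then have "?F (As[r := x]) = (?F As)[0 := As ! m \<otimes>\<^bsub>S\<^esub> x]" for x
      using assms len by (auto simp: nth_list_update)
    moreover have "(\<lambda>x. As ! m \<otimes>\<^bsub>S\<^esub> x) \<in> linear_maps K S S"
      using c by (intro mult_linear_right) simp
    ultimately show ?thesis using assms by (intro slot_updateI[of 0])
  next
    case 2
    then have "?F (As[r := x]) = (?F As)[r := x]" for x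
      using len
      by (intro nth_equalityI) (auto simp: nth_list_update nth_Cons' split: nat.split)
    then show ?thesis using 2 linear_maps_id by (intro slot_updateI[of r _ "\<lambda>x. x"]) auto
  next
    case 3
    then have "?F (As[r := x]) = (?F As)[0 := x \<otimes>\<^bsub>S\<^esub> As ! 0]" for x
      using assms len by (auto simp: nth_list_update)
    moreover have "(\<lambda>x. x \<otimes>\<^bsub>S\<^esub> As ! 0) \<in> linear_maps K S S"
      using c by (intro mult_linear_left) simp
    ultimately show ?thesis using assms by (intro slot_updateI[of 0])
  qed
qed

text \<open>For a fixed list of parities \<open>es\<close> the prescribed value is multilinear on all tuples, homogeneous
  or not, so the face map exists and can be evaluated.\<close>

lemma hochschild_face_multilinear:
  assumes "0 < m" "i \<le> m"
  shows "multilinear K S (Suc m) (hochschild K S (m - 1)) (\<lambda>As. if i < m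
      then tensor K S (take i As @ (As ! i \<otimes>\<^bsub>S\<^esub> As ! (i + 1)) # drop (i + 2) As)
      else signed (hochschild K S (m - 1)) (es ! m * (\<Sum>j<m. es ! j))
             (tensor K S ((As ! m \<otimes>\<^bsub>S\<^esub> As ! 0) # map ((!) As) [1..<m])))"
proof -
  have h: "hochschild K S (m - 1) = tensor_power K S m" using assms by (simp add: hochschild_def)
  show ?thesis
  proof (cases "i < m")
    case True
    then show ?thesis unfolding h by (simp only: if_True merge_multilinear)
  next
    case False
    then show ?thesis
      using linear_maps_multilinear[OF cyclic_merge_multilinear[OF assms(1)]
          signed_linear[OF tensor_power_module[OF matrix_module]]]
      unfolding h by (simp only: if_False)
  qed
qed

lemma hochschild_face_linear:
  assumes "0 < m" "i \<le> m"
  shows "hochschild_face K S m i \<in> linear_maps K (hochschild K S m) (hochschild K S (m - 1))"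
  unfolding hochschild_face_def hochschild_def[of K S m]
  by (rule SG.homog_linear_extension_linear[OF hochschild_module])
    (rule hochschild_face_multilinear[OF assms])

lemma hochschild_face_inner:
  assumes "i < m" "\<And>j. j \<le> m \<Longrightarrow> A j \<in> homog S (e j)"
  shows "hochschild_face K S m i (pure (Suc m) A) =
    pure m (\<lambda>s. if s < i then A s else if s = i then A i \<otimes>\<^bsub>S\<^esub> A (Suc i) else A (Suc s))"
proof -
  let ?As = "map A [0..<Suc m]"
  have "hochschild_face K S m i (pure (Suc m) A) =
      tensor K S (take i ?As @ (?As ! i \<otimes>\<^bsub>S\<^esub> ?As ! (i + 1)) # drop (i + 2) ?As)"
    unfolding hochschild_face_def
    using assms
    by (subst SG.homog_linear_extension_tensor[OF hochschild_module hochschild_face_multilinear,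
          where es = "map e [0..<Suc m]"]) (auto simp del: upt_Suc)
  also have "take i ?As @ (?As ! i \<otimes>\<^bsub>S\<^esub> ?As ! (i + 1)) # drop (i + 2) ?As =
      map (\<lambda>s. if s < i then A s else if s = i then A i \<otimes>\<^bsub>S\<^esub> A (Suc i) else A (Suc s)) [0..<m]"
    using assms(1)
    by (intro nth_equalityI) (auto simp: nth_append nth_Cons' simp del: upt_Suc)
  finally show ?thesis .
qed

lemma hochschild_face_last:
  assumes "0 < m" "\<And>j. j \<le> m \<Longrightarrow> A j \<in> homog S (e j)"
  shows "hochschild_face K S m m (pure (Suc m) A) =
    signed (hochschild K S (m - 1)) (e m * (\<Sum>j<m. e j))
      (pure m (\<lambda>s. if s = 0 then A m \<otimes>\<^bsub>S\<^esub> A 0 else A s))"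
proof -
  let ?As = "map A [0..<Suc m]"
  let ?es = "map e [0..<Suc m]"
  have "hochschild_face K S m m (pure (Suc m) A) =
      signed (hochschild K S (m - 1)) (?es ! m * (\<Sum>j<m. ?es ! j))
        (tensor K S ((?As ! m \<otimes>\<^bsub>S\<^esub> ?As ! 0) # map ((!) ?As) [1..<m]))"
    unfolding hochschild_face_def
    using assms
    by (subst SG.homog_linear_extension_tensor[OF hochschild_module hochschild_face_multilinear,
          where es = ?es]) (auto simp del: upt_Suc)
  also have "?es ! m * (\<Sum>j<m. ?es ! j) = e m * (\<Sum>j<m. e j)"
    by (simp del: upt_Suc)
  also have "(?As ! m \<otimes>\<^bsub>S\<^esub> ?As ! 0) # map ((!) ?As) [1..<m] =
      map (\<lambda>s. if s = 0 then A m \<otimes>\<^bsub>S\<^esub> A 0 else A s) [0..<m]"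
    using assms(1) by (intro nth_equalityI) (auto simp: nth_Cons' simp del: upt_Suc)
  finally show ?thesis .
qed

section \<open>The components of the homotopy\<close>

text \<open>One summand of \<open>h\<^sub>i\<close>: the index list \<open>ix = [k\<^sub>0, \<dots>, k\<^bsub>i+1\<^esub>]\<close> picks one entry from each of the first
  \<open>i + 1\<close> matrices. The row index \<open>k\<^sub>0\<close> is kept in slot 0, all other picked entries move to the
  corner, and the inserted factor \<open>E 0 k\<^bsub>i+1\<^esub> 1\<close> remembers the final column.\<close>

definition homotopy_term :: "nat \<Rightarrow> nat \<Rightarrow> nat list \<Rightarrow> 'a mat list \<Rightarrow> 'a mat list" where
  "homotopy_term m i ix As = map (\<lambda>s.
    if s \<le> i then E (if s = 0 then ix ! 0 else 0) 0 (As ! s $$ (ix ! s, ix ! Suc s))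
    else if s = Suc i then E 0 (ix ! Suc i) \<one>\<^bsub>R\<^esub> else As ! (s - 1)) [0..<Suc (Suc m)]"

definition homotopy_component ::
    "nat \<Rightarrow> nat \<Rightarrow> ('a mat list \<Rightarrow> 'k) set \<Rightarrow> ('a mat list \<Rightarrow> 'k) set" where
  "homotopy_component m i = linear_extension K S (Suc m) (hochschild K S (Suc m))
    (\<lambda>As. \<Oplus>\<^bsub>hochschild K S (Suc m)\<^esub>ix\<in>{ix. length ix = Suc (Suc i) \<and> set ix \<subseteq> {..<n}}.
      tensor K S (homotopy_term m i ix As))"

lemma homotopy_term_tuples:
  assumes "As \<in> tuples S (Suc m)" "length ix = Suc (Suc i)" "set ix \<subseteq> {..<n}" "i \<le> m"
  shows "homotopy_term m i ix As \<in> tuples S (Suc (Suc m))"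
proof -
  have ix: "ix ! s < n" if "s < Suc (Suc i)" for s
    using that assms(2,3) nth_less_bound by simp
  show ?thesis
    unfolding homotopy_term_def using assms(4) ix tuples_nth[OF assms(1)]
    by (intro map_tuples) (auto intro!: E_closed carrier_matrix_entry)
qed

lemma homotopy_term_multilinear:
  assumes "length ix = Suc (Suc i)" "set ix \<subseteq> {..<n}" "i \<le> m"
  shows "multilinear K S (Suc m) (hochschild K S (Suc m)) (\<lambda>As. tensor K S (homotopy_term m i ix As))"
  unfolding hochschild_def
proof (rule multilinear_compose[OF matrix_module multilinear_tensor[OF matrix_module]])
  fix As assume As: "As \<in> tuples S (Suc m)"
  then show "homotopy_term m i ix As \<in> tuples S (Suc (Suc m))"
    by (intro homotopy_term_tuples assms)
  have len: "length As = Suc m" using As by (simp add: tuples_def)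
  have ix: "ix ! s < n" if "s < Suc (Suc i)" for s
    using that assms(1,2) nth_less_bound by simp
  fix r assume r: "r < Suc m"
  show "\<exists>j<Suc (Suc m). \<exists>\<psi>\<in>linear_maps K S S. \<forall>x\<in>carrier S.
    homotopy_term m i ix (As[r := x]) = (homotopy_term m i ix As)[j := \<psi> x]"
  proof (cases "r \<le> i")
    case True
    let ?\<psi> = "\<lambda>x. E (if r = 0 then ix ! 0 else 0) 0 (x $$ (ix ! r, ix ! Suc r))"
    have "homotopy_term m i ix (As[r := x]) = (homotopy_term m i ix As)[r := ?\<psi> x]" for x
      using True r len
      by (intro nth_equalityI)
        (auto simp: homotopy_term_def nth_list_update simp del: upt_Suc)
    moreover have "?\<psi> \<in> linear_maps K S S"
      using True by (intro linear_maps_compose[OF entry_linear E_linear] ix) auto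
    ultimately show ?thesis using r by (intro slot_updateI[of r]) auto
  next
    case False
    have "homotopy_term m i ix (As[r := x]) = (homotopy_term m i ix As)[Suc r := x]" for x
      using False r len assms(3)
      by (intro nth_equalityI)
        (auto simp: homotopy_term_def nth_list_update simp del: upt_Suc)
    then show ?thesis using r linear_maps_id
      by (intro slot_updateI[of "Suc r" _ "\<lambda>x. x"]) auto
  qed
qed

lemma homotopy_sum_multilinear:
  assumes "i \<le> m"
  shows "multilinear K S (Suc m) (hochschild K S (Suc m))
    (\<lambda>As. \<Oplus>\<^bsub>hochschild K S (Suc m)\<^esub>ix\<in>{ix. length ix = Suc (Suc i) \<and> set ix \<subseteq> {..<n}}.
      tensor K S (homotopy_term m i ix As))"
  by (rule finsum_multilinear[OF hochschild_module])
    (use homotopy_term_multilinear[OF _ _ assms] in blast)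

lemma homotopy_component_linear:
  assumes "i \<le> m"
  shows "homotopy_component m i \<in> linear_maps K (hochschild K S m) (hochschild K S (Suc m))"
  unfolding homotopy_component_def hochschild_def[of K S m]
  by (rule linear_extension_linear[OF matrix_module hochschild_module homotopy_sum_multilinear[OF assms]])

text \<open>On elementary matrices the sum over index lists has at most one nonzero term, and it is
  nonzero only if the column of each factor \<open>s < i\<close> matches the row of the next.\<close>

lemma homotopy_component_elementary:
  assumes "i \<le> m" and u: "\<And>s. s \<le> m \<Longrightarrow> u s < n" and v: "\<And>s. s \<le> m \<Longrightarrow> v s < n"
    and a: "\<And>s. s \<le> m \<Longrightarrow> a s \<in> carrier R"
  shows "homotopy_component m i (pure (Suc m) (\<lambda>s. E (u s) (v s) (a s))) =
    (if \<forall>s<i. v s = u (Suc s)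
     then pure (Suc (Suc m)) (\<lambda>s. if s \<le> i then E (if s = 0 then u 0 else 0) 0 (a s)
       else if s = Suc i then E 0 (v i) \<one>\<^bsub>R\<^esub> else E (u (s - 1)) (v (s - 1)) (a (s - 1)))
     else \<zero>\<^bsub>hochschild K S (Suc m)\<^esub>)"
proof -
  let ?H = "hochschild K S (Suc m)"
  let ?As = "map (\<lambda>s. E (u s) (v s) (a s)) [0..<Suc m]"
  let ?I = "{ix. length ix = Suc (Suc i) \<and> set ix \<subseteq> {..<n}}"
  interpret H: module K ?H by (rule hochschild_module)
  have As: "?As \<in> tuples S (Suc m)"
    using a by (intro map_tuples E_closed) simp
  have I: "finite ?I"
    using finite_lists_length_eq[of "{..<n}" "Suc (Suc i)"] by (simp add: conj_commute)
  (* Entry (k, l) of E (u s) (v s) (a s) vanishes unless k = u s and l = v s, so an index list that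
     contributes starts with u 0 and continues with the columns v 0, ..., v i. *)
  define ix0 where "ix0 = u 0 # map v [0..<Suc i]"
  have ix0: "ix0 \<in> ?I"
    using u[of 0] v assms(1) by (auto simp: ix0_def)
  have z: "tensor K S (homotopy_term m i ix ?As) = \<zero>\<^bsub>?H\<^esub>"
    if ix: "ix \<in> ?I" and s: "s \<le> i" "?As ! s $$ (ix ! s, ix ! Suc s) = \<zero>\<^bsub>R\<^esub>" for ix s
    unfolding hochschild_def
  proof (rule multilinear_zero_entry[OF matrix_module tensor_power_module[OF matrix_module]
        multilinear_tensor[OF matrix_module], where i = s])
    show "homotopy_term m i ix ?As \<in> tuples S (Suc (Suc m))"
      using ix by (intro homotopy_term_tuples As assms(1)) auto
    show "homotopy_term m i ix ?As ! s = \<zero>\<^bsub>S\<^esub>"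
      using s assms(1) by (simp add: homotopy_term_def E_zero del: upt_Suc)
  qed (use s assms(1) in simp)
  have entry: "?As ! s $$ (k, l) = (if k = u s \<and> l = v s then a s else \<zero>\<^bsub>R\<^esub>)"
    if "s \<le> i" "k < n" "l < n" for s k l
    using that assms(1) by (simp add: E_entry del: upt_Suc)
  have "homotopy_component m i (tensor K S ?As) =
      (\<Oplus>\<^bsub>?H\<^esub>ix\<in>?I. tensor K S (homotopy_term m i ix ?As))"
    unfolding homotopy_component_def
    by (rule linear_extension_tensor[OF matrix_module hochschild_module
          homotopy_sum_multilinear[OF assms(1)] As])
  also have "\<dots> = tensor K S (homotopy_term m i ix0 ?As)"
  proof (rule finsum_single[OF H.abelian_monoid_axioms I ix0])
    show "tensor K S (homotopy_term m i ix0 ?As) \<in> carrier ?H"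
      unfolding hochschild_def using ix0
      by (intro tensor_closed[OF matrix_module] homotopy_term_tuples As assms(1)) auto
    fix ix assume ix: "ix \<in> ?I" "ix \<noteq> ix0"
    have ixn: "ix ! s < n" if "s < Suc (Suc i)" for s
      using that ix nth_less_bound[of ix n s] by simp
    obtain t where t: "t < Suc (Suc i)" "ix ! t \<noteq> ix0 ! t"
      using ix ix0 by (auto simp: list_eq_iff_nth_eq)
    show "tensor K S (homotopy_term m i ix ?As) = \<zero>\<^bsub>?H\<^esub>"
    proof (cases t)
      case 0
      then show ?thesis
        using t entry[of 0 "ix ! 0" "ix ! Suc 0"] ixn by (intro z[OF ix(1), of 0]) (auto simp: ix0_def)
    next
      case (Suc s)
      then show ?thesis
        using t entry[of s "ix ! s" "ix ! Suc s"] ixn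
        by (intro z[OF ix(1), of s]) (auto simp: ix0_def simp del: upt_Suc)
    qed
  qed
  also have "\<dots> = (if \<forall>s<i. v s = u (Suc s)
     then pure (Suc (Suc m)) (\<lambda>s. if s \<le> i then E (if s = 0 then u 0 else 0) 0 (a s)
       else if s = Suc i then E 0 (v i) \<one>\<^bsub>R\<^esub> else E (u (s - 1)) (v (s - 1)) (a (s - 1)))
     else \<zero>\<^bsub>?H\<^esub>)"
  proof -
    have ix0n: "ix0 ! s < n" if "s < Suc (Suc i)" for s
      using that ix0 nth_less_bound[of ix0 n s] by simp
    have ix0_0: "ix0 ! 0 = u 0" by (simp add: ix0_def)
    have ix0_nth: "ix0 ! Suc s = v s" if "s \<le> i" for s
      using that by (simp add: ix0_def del: upt_Suc)
    show ?thesis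
    proof (cases "\<forall>s<i. v s = u (Suc s)")
      case True
      have "homotopy_term m i ix0 ?As = map (\<lambda>s. if s \<le> i then E (if s = 0 then u 0 else 0) 0 (a s)
        else if s = Suc i then E 0 (v i) \<one>\<^bsub>R\<^esub> else E (u (s - 1)) (v (s - 1)) (a (s - 1))) [0..<Suc (Suc m)]"
        unfolding homotopy_term_def
      proof (rule map_cong[OF refl], goal_cases)
        case (1 s)
        then have s: "s < Suc (Suc m)" by (simp del: upt_Suc)
        show ?case
        proof (cases "s \<le> i")
          case le: True
          have "ix0 ! s = u s" using le True by (cases s) (simp_all add: ix0_0 ix0_nth)
          then show ?thesis
            using le entry[of s "ix0 ! s" "ix0 ! Suc s"] ix0n[of s] ix0n[of "Suc s"]
            by (simp add: ix0_0 ix0_nth del: upt_Suc)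
        next
          case False
          moreover have "s - Suc 0 < Suc m" using s by linarith
          ultimately show ?thesis by (simp add: ix0_nth del: upt_Suc)
        qed
      qed
      then show ?thesis using True by simp
    next
      case False
      then obtain s where s: "s < i" "v s \<noteq> u (Suc s)" by blast
      then have "tensor K S (homotopy_term m i ix0 ?As) = \<zero>\<^bsub>?H\<^esub>"
        using entry[of "Suc s" "ix0 ! Suc s" "ix0 ! Suc (Suc s)"] v[of s] v[of "Suc s"] assms(1)
        by (intro z[OF ix0, of "Suc s"]) (auto simp: ix0_nth simp del: upt_Suc)
      then show ?thesis using False by (simp only: if_False)
    qed
  qed
  finally show ?thesis .
qed

section \<open>Supertrace and inclusion\<close>

lemma Inc_multilinear:
  "multilinear K R (Suc m) (hochschild K S m) (\<lambda>as. tensor K S (map (E11 p q R) as))"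
  unfolding hochschild_def
proof (rule multilinear_compose[OF RG.module multilinear_tensor[OF matrix_module]])
  fix as assume as: "as \<in> tuples R (Suc m)"
  show "map (E11 p q R) as \<in> tuples S (Suc m)"
    using as by (auto simp: tuples_def E11_eq intro!: E_closed)
  show "\<exists>j<Suc m. \<exists>\<psi>\<in>linear_maps K R S. \<forall>x\<in>carrier R.
      map (E11 p q R) (as[r := x]) = (map (E11 p q R) as)[j := \<psi> x]" if "r < Suc m" for r
    using that E_linear[of 0 0] by (auto simp: map_update E11_eq)
qed

lemma Inc_linear: "Inc K p q R m \<in> linear_maps K (hochschild K R m) (hochschild K S m)"
  unfolding Inc_def hochschild_def[of K R m]
  by (rule linear_extension_linear[OF RG.module hochschild_module Inc_multilinear])

lemma Inc_tensor:
  assumes "\<And>s. s \<le> m \<Longrightarrow> a s \<in> carrier R"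
  shows "Inc K p q R m (tensor K R (map a [0..<Suc m])) = pure (Suc m) (\<lambda>s. E 0 0 (a s))"
proof -
  have "map a [0..<Suc m] \<in> tuples R (Suc m)" using assms by (intro map_tuples) simp
  then show ?thesis
    unfolding Inc_def
    by (subst linear_extension_tensor[OF RG.module hochschild_module Inc_multilinear])
      (simp_all add: E11_eq comp_def del: upt_Suc)
qed

lemma index_listsD:
  assumes "ix \<in> index_lists m I n" "I \<subseteq> {..<n}"
  shows "length ix = Suc m" "\<And>s. s \<le> m \<Longrightarrow> ix ! s < n"
  using assms by (auto simp: index_lists_def) (metis Suc_le_eq atLeastAtMost_iff lessThan_iff not_gr_zero One_nat_def subsetD)

lemma finite_index_lists:
  assumes "I \<subseteq> {..<n}"
  shows "finite (index_lists m I n)"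
proof (rule finite_subset)
  show "index_lists m I n \<subseteq> {ix. set ix \<subseteq> {..<n} \<and> length ix = Suc m}"
    using index_listsD[OF _ assms] by (auto simp: in_set_conv_nth)
qed (simp add: finite_lists_length_eq)

lemma cyclic_tensor_multilinear:
  assumes "ix \<in> index_lists m I n" "I \<subseteq> {..<n}"
  shows "multilinear K S (Suc m) (hochschild K R m) (\<lambda>As. cyclic_tensor K R m As ix)"
  unfolding hochschild_def cyclic_tensor_def
proof (rule multilinear_compose[OF matrix_module multilinear_tensor[OF RG.module]])
  note ix = index_listsD[OF assms]
  let ?F = "\<lambda>As. map (\<lambda>j. As ! j $$ (ix ! j, ix ! (if j = m then 0 else j + 1))) [0..<Suc m]"
  fix As assume As: "As \<in> tuples S (Suc m)"
  have len: "length As = Suc m" using As by (simp add: tuples_def)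
  show "?F As \<in> tuples R (Suc m)"
    using ix tuples_nth[OF As] by (intro map_tuples carrier_matrix_entry) auto
  fix r assume r: "r < Suc m"
  let ?\<psi> = "\<lambda>A. A $$ (ix ! r, ix ! (if r = m then 0 else r + 1))"
  have "?F (As[r := x]) = (?F As)[r := ?\<psi> x]" for x
    using r len by (intro nth_equalityI) (auto simp: nth_list_update simp del: upt_Suc)
  moreover have "?\<psi> \<in> linear_maps K S R"
    using r ix by (intro entry_linear) auto
  ultimately show "\<exists>j<Suc m. \<exists>\<psi>\<in>linear_maps K S R. \<forall>x\<in>carrier S. ?F (As[r := x]) = (?F As)[j := \<psi> x]"
    using r by (intro slot_updateI[of r])
qed

lemma cyclic_sum_multilinear:
  assumes "I \<subseteq> {..<n}"
  shows "multilinear K S (Suc m) (hochschild K R m)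
    (\<lambda>As. \<Oplus>\<^bsub>hochschild K R m\<^esub>ix\<in>index_lists m I n. cyclic_tensor K R m As ix)"
  by (rule finsum_multilinear[OF hochschild_R_module]) (rule cyclic_tensor_multilinear[OF _ assms])

lemma Str_multilinear:
  "multilinear K S (Suc m) (hochschild K R m) (\<lambda>As.
      (\<Oplus>\<^bsub>hochschild K R m\<^esub>ix\<in>index_lists m {0..<p} n. cyclic_tensor K R m As ix)
      \<oplus>\<^bsub>hochschild K R m\<^esub>
      signed (hochschild K R m) e
        (\<Oplus>\<^bsub>hochschild K R m\<^esub>ix\<in>index_lists m {p..<n} n. cyclic_tensor K R m As ix))"
  by (intro add_multilinear hochschild_R_module cyclic_sum_multilinear
      linear_maps_multilinear[OF cyclic_sum_multilinear signed_linear]) auto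

lemma Str_linear: "Str K p q R m \<in> linear_maps K (hochschild K S m) (hochschild K R m)"
  unfolding Str_def hochschild_def[of K S m]
  by (rule SG.homog_linear_extension_linear[OF hochschild_R_module Str_multilinear])

text \<open>A nonzero term must run through the rows \<open>u 0, \<dots>, u m\<close>, and then the columns have to close up
  cyclically.\<close>

lemma cyclic_sum_elementary:
  assumes I: "I \<subseteq> {..<n}" and u: "\<And>s. s \<le> m \<Longrightarrow> u s < n"
    and a: "\<And>s. s \<le> m \<Longrightarrow> a s \<in> carrier R"
  shows "(\<Oplus>\<^bsub>hochschild K R m\<^esub>ix\<in>index_lists m I n.
      cyclic_tensor K R m (map (\<lambda>s. E (u s) (v s) (a s)) [0..<Suc m]) ix) =
    (if u 0 \<in> I \<and> (\<forall>s<m. v s = u (Suc s)) \<and> v m = u 0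
     then tensor K R (map a [0..<Suc m]) else \<zero>\<^bsub>hochschild K R m\<^esub>)"
proof -
  let ?H = "hochschild K R m"
  let ?As = "map (\<lambda>s. E (u s) (v s) (a s)) [0..<Suc m]"
  let ?next = "\<lambda>s. if s = m then 0 else s + 1"
  interpret H: module K ?H by (rule hochschild_R_module)
  let ?C = "(\<forall>s<m. v s = u (Suc s)) \<and> v m = u 0"
  have C: "?C \<longleftrightarrow> (\<forall>s\<le>m. v s = u (?next s))"
    by (auto simp: le_less)
  have As: "?As \<in> tuples S (Suc m)"
    using a by (intro map_tuples E_closed) simp
  have entry: "?As ! s $$ (ix ! s, ix ! ?next s) =
      (if ix ! s = u s \<and> ix ! ?next s = v s then a s else \<zero>\<^bsub>R\<^esub>)"
    if "ix \<in> index_lists m I n" "s \<le> m" for ix s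
    using that index_listsD(2)[OF that(1) I] by (simp add: E_entry del: upt_Suc)
  have closed: "cyclic_tensor K R m ?As ix \<in> carrier ?H" if "ix \<in> index_lists m I n" for ix
    using multilinear_closed[OF cyclic_tensor_multilinear[OF that I] As] by simp
  have z: "cyclic_tensor K R m ?As ix = \<zero>\<^bsub>?H\<^esub>"
    if ix: "ix \<in> index_lists m I n" and s: "s \<le> m" "\<not> (ix ! s = u s \<and> ix ! ?next s = v s)" for ix s
    unfolding hochschild_def cyclic_tensor_def
  proof (rule multilinear_zero_entry[OF RG.module tensor_power_module[OF RG.module]
        multilinear_tensor[OF RG.module], where i = s])
    show "map (\<lambda>j. ?As ! j $$ (ix ! j, ix ! ?next j)) [0..<Suc m] \<in> tuples R (Suc m)"
      using entry[OF ix] a by (intro map_tuples) (auto simp del: upt_Suc)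
    show "map (\<lambda>j. ?As ! j $$ (ix ! j, ix ! ?next j)) [0..<Suc m] ! s = \<zero>\<^bsub>R\<^esub>"
      using s entry[OF ix s(1)] by (cases "s = m") (auto simp del: upt_Suc)
  qed (use s in simp)
  show ?thesis
  proof (cases "u 0 \<in> I \<and> ?C")
    case True
    let ?ix = "map u [0..<Suc m]"
    have ix: "?ix \<in> index_lists m I n"
      using True u by (auto simp: index_lists_def simp del: upt_Suc)
    have "(\<Oplus>\<^bsub>?H\<^esub>ix\<in>index_lists m I n. cyclic_tensor K R m ?As ix) = cyclic_tensor K R m ?As ?ix"
    proof (rule finsum_single[OF H.abelian_monoid_axioms finite_index_lists[OF I] ix])
      fix ix assume ix: "ix \<in> index_lists m I n" "ix \<noteq> ?ix"
      then obtain s where "s \<le> m" "ix ! s \<noteq> u s"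
        using index_listsD(1)[OF ix(1) I] by (auto simp: list_eq_iff_nth_eq less_Suc_eq_le simp del: upt_Suc)
      then show "cyclic_tensor K R m ?As ix = \<zero>\<^bsub>?H\<^esub>" using z[OF ix(1)] by blast
    qed (rule closed[OF ix])
    also have "\<dots> = tensor K R (map a [0..<Suc m])"
    proof -
      have "?As ! s $$ (?ix ! s, ?ix ! ?next s) = a s" if "s \<le> m" for s
        using entry[OF ix that] True C that by (auto simp del: upt_Suc)
      then show ?thesis
        unfolding cyclic_tensor_def
        by (intro arg_cong[of _ _ "tensor K R"] map_cong) (auto simp del: upt_Suc)
    qed
    finally show ?thesis using True by simp
  next
    case False
    have "cyclic_tensor K R m ?As ix = \<zero>\<^bsub>?H\<^esub>" if ix: "ix \<in> index_lists m I n" for ix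
    proof (rule ccontr)
      assume "cyclic_tensor K R m ?As ix \<noteq> \<zero>\<^bsub>?H\<^esub>"
      then have *: "\<forall>s\<le>m. ix ! s = u s \<and> ix ! ?next s = v s" using z[OF ix] by blast
      moreover have "?next s \<le> m" if "s \<le> m" for s using that by simp
      ultimately have "\<forall>s\<le>m. v s = u (?next s)" by metis
      moreover have "u 0 \<in> I" using * ix by (auto simp: index_lists_def)
      ultimately show False using False C by blast
    qed
    then have "(\<Oplus>\<^bsub>?H\<^esub>ix\<in>index_lists m I n. cyclic_tensor K R m ?As ix) = \<zero>\<^bsub>?H\<^esub>"
      by (intro H.add.finprod_one_eqI) simp
    then show ?thesis using False by (simp only: if_False)
  qed
qed

text \<open>The sign is written with the parities of the entries instead of those of the matrices. This
  is the same for a closed chain of indices, where every index parity occurs once as a row and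
  once as a column.\<close>

lemma Str_elementary:
  assumes u: "\<And>s. s \<le> m \<Longrightarrow> u s < n" and v: "\<And>s. s \<le> m \<Longrightarrow> v s < n"
    and a: "\<And>s. s \<le> m \<Longrightarrow> a s \<in> homog R (e s)"
  shows "Str K p q R m (pure (Suc m) (\<lambda>s. E (u s) (v s) (a s))) =
    (if (\<forall>s<m. v s = u (Suc s)) \<and> v m = u 0
     then signed (hochschild K R m) (index_parity (u 0) * (1 + (\<Sum>s\<le>m. e s)))
       (tensor K R (map a [0..<Suc m]))
     else \<zero>\<^bsub>hochschild K R m\<^esub>)"
proof -
  let ?H = "hochschild K R m"
  let ?A = "\<lambda>s. E (u s) (v s) (a s)"
  let ?f = "\<lambda>s. e s + index_parity (u s) + index_parity (v s)"
  let ?C = "(\<forall>s<m. v s = u (Suc s)) \<and> v m = u 0"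
  let ?t = "tensor K R (map a [0..<Suc m])"
  interpret H: module K ?H by (rule hochschild_R_module)
  have ac: "\<And>s. s \<le> m \<Longrightarrow> a s \<in> carrier R" using a RG.homog_carrier by blast
  have t: "?t \<in> carrier ?H"
    unfolding hochschild_def using ac by (intro tensor_closed[OF RG.module] map_tuples) simp
  have hom: "\<And>s. s \<le> m \<Longrightarrow> ?A s \<in> homog S (?f s)" using a E_homog by blast
  have "Str K p q R m (pure (Suc m) ?A) =
    (if u 0 \<in> {0..<p} \<and> ?C then ?t else \<zero>\<^bsub>?H\<^esub>) \<oplus>\<^bsub>?H\<^esub>
      signed ?H (1 + (\<Sum>s\<le>m. map ?f [0..<Suc m] ! s)) (if u 0 \<in> {p..<n} \<and> ?C then ?t else \<zero>\<^bsub>?H\<^esub>)"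
    unfolding Str_def
    using hom
    by (subst SG.homog_linear_extension_tensor[OF hochschild_R_module Str_multilinear,
          where es = "map ?f [0..<Suc m]"])
      (simp_all add: cyclic_sum_elementary[OF _ u ac] less_Suc_eq_le subset_iff del: upt_Suc)
  also have "(\<Sum>s\<le>m. map ?f [0..<Suc m] ! s) = (\<Sum>s\<le>m. ?f s)"
    by (intro sum.cong) (simp_all del: upt_Suc)
  also have "(if u 0 \<in> {0..<p} \<and> ?C then ?t else \<zero>\<^bsub>?H\<^esub>) \<oplus>\<^bsub>?H\<^esub>
      signed ?H (1 + (\<Sum>s\<le>m. ?f s)) (if u 0 \<in> {p..<n} \<and> ?C then ?t else \<zero>\<^bsub>?H\<^esub>) =
    (if ?C then signed ?H (index_parity (u 0) * (1 + (\<Sum>s\<le>m. e s))) ?t else \<zero>\<^bsub>?H\<^esub>)"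
  proof (cases ?C)
    case True
    have "(\<Sum>s\<le>m. index_parity (v s)) = (\<Sum>s\<le>m. index_parity (u s))"
    proof -
      have "(\<Sum>s\<le>m. index_parity (v s)) = (\<Sum>s<m. index_parity (v s)) + index_parity (v m)"
        by (simp add: lessThan_Suc_atMost[symmetric])
      also have "\<dots> = (\<Sum>s<m. index_parity (u (Suc s))) + index_parity (u 0)"
        using True by simp
      also have "\<dots> = (\<Sum>s\<le>m. index_parity (u s))"
        by (simp only: lessThan_Suc_atMost[symmetric] sum.lessThan_Suc_shift add.commute)
      finally show ?thesis .
    qed
    moreover have "x + y + y = x" for x y :: bit by (cases x; cases y) simp_all
    ultimately have "(\<Sum>s\<le>m. ?f s) = (\<Sum>s\<le>m. e s)"
      by (simp only: sum.distrib)
    then show ?thesis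
      using True t u[of 0] signed_zero[OF hochschild_R_module]
      by (auto simp: index_parity_def signed_def)
  next
    case False
    then show ?thesis by (auto simp: signed_def)
  qed
  finally show ?thesis .
qed

end

section \<open>Cancellation in a presimplicial homotopy\<close>

lemma finsum_neg:
  assumes "module K M" "\<And>i. i \<in> I \<Longrightarrow> f i \<in> carrier M"
  shows "(\<Oplus>\<^bsub>M\<^esub>i\<in>I. \<ominus>\<^bsub>M\<^esub> f i) = \<ominus>\<^bsub>M\<^esub> (\<Oplus>\<^bsub>M\<^esub>i\<in>I. f i)"
  using linear_maps_finsum[OF assms(1) assms(1) signed_linear[OF assms(1)], of I f 1] assms(2)
  by (simp add: signed_def)

text \<open>The families stand for \<open>X r i = \<delta>\<^sub>r h\<^sub>i x\<close> and \<open>Y i r = h\<^sub>i \<delta>\<^sub>r x\<close> in a fixed degree \<open>m\<close>. Below and above the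
  diagonal the terms of \<open>X\<close> reappear in \<open>Y\<close> with the opposite sign, because exactly one of the two
  indices is shifted by one. Next to the diagonal the terms of \<open>X\<close> cancel in pairs.\<close>

lemma presimplicial_homotopy_cancellation:
  assumes M: "module K M"
    and X: "\<And>r i. \<lbrakk>r \<le> Suc m; i \<le> m\<rbrakk> \<Longrightarrow> X r i \<in> carrier M"
    and Y: "\<And>i r. \<lbrakk>i < m; r \<le> m\<rbrakk> \<Longrightarrow> Y i r \<in> carrier M"
    and low: "\<And>r i. \<lbrakk>r \<le> i; i < m\<rbrakk> \<Longrightarrow> X r (Suc i) = Y i r"
    and diag: "\<And>r. r < m \<Longrightarrow> X (Suc r) (Suc r) = X (Suc r) r"
    and high: "\<And>r i. \<lbrakk>i < r; r \<le> m\<rbrakk> \<Longrightarrow> X (Suc r) i = Y i r"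
  shows "(\<Oplus>\<^bsub>M\<^esub>r\<in>{..Suc m}. \<Oplus>\<^bsub>M\<^esub>i\<in>{..m}. signed M (of_nat r + of_nat i) (X r i)) \<oplus>\<^bsub>M\<^esub>
      (\<Oplus>\<^bsub>M\<^esub>r\<in>{..m}. \<Oplus>\<^bsub>M\<^esub>i\<in>{..<m}. signed M (of_nat r + of_nat i) (Y i r)) =
    X 0 0 \<ominus>\<^bsub>M\<^esub> X (Suc m) m"
proof -
  interpret M: module K M by (fact M)
  define Z where "Z r i = signed M (of_nat r + of_nat i) (X r i)" for r i
  define W where "W i r = signed M (of_nat r + of_nat i) (Y i r)" for i r
  have Zc: "Z r i \<in> carrier M" if "r \<le> Suc m" "i \<le> m" for r i
    unfolding Z_def by (rule signed_closed[OF M X[OF that]])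
  have Wc: "W i r \<in> carrier M" if "i < m" "r \<le> m" for i r
    unfolding W_def by (rule signed_closed[OF M Y[OF that]])
  have sgn: "signed M (e + 1) x = \<ominus>\<^bsub>M\<^esub> signed M e x" if "x \<in> carrier M" for e x
    using that by (cases e) (simp_all add: signed_def)
  have Zlow: "Z r (Suc i) = \<ominus>\<^bsub>M\<^esub> W i r" if "r \<le> i" "i < m" for r i
    using that sgn[of "Y i r" "of_nat r + of_nat i"] Y[of i r]
    by (simp add: Z_def W_def low add.assoc add.commute[of 1])
  have Zhigh: "Z (Suc r) i = \<ominus>\<^bsub>M\<^esub> W i r" if "i < r" "r \<le> m" for r i
  proof -
    have "of_nat (Suc r) + of_nat i = of_nat r + of_nat i + (1 :: bit)"
      by (simp only: of_nat_Suc ac_simps)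
    then show ?thesis
      using that sgn[of "Y i r" "of_nat r + of_nat i"] Y[of i r]
      by (simp only: Z_def W_def high)
  qed
  have Zdiag: "Z (Suc r) (Suc r) \<oplus>\<^bsub>M\<^esub> Z (Suc r) r = \<zero>\<^bsub>M\<^esub>" if "r < m" for r
    using that X[of "Suc r" r] sgn[of "X (Suc r) r" "of_nat r + of_nat r"]
    by (simp add: Z_def diag signed_def M.r_neg)
  (* In row r of Z the entries with i > r are the negatives of the W i r with i \<ge> r, which sum to
     a r; the entries with i < r - 1 are the negatives of the W i (r - 1), which sum to b (r - 1);
     the entries at r - 1 and r cancel. What remains is a corner z r in the first and the last row.
     The shift b' of b has the value 0 in row 0, where there is no previous row. *)
  define a where "a r = (\<Oplus>\<^bsub>M\<^esub>i\<in>{r..<m}. W i r)" for r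
  define b where "b r = (\<Oplus>\<^bsub>M\<^esub>i\<in>{..<r}. W i r)" for r
  define b' where "b' r = (case r of 0 \<Rightarrow> \<zero>\<^bsub>M\<^esub> | Suc r \<Rightarrow> b r)" for r
  define z where "z r = (if r = 0 then Z 0 0 else if r = Suc m then Z (Suc m) m else \<zero>\<^bsub>M\<^esub>)" for r
  have ac: "a r \<in> carrier M" if "r \<le> Suc m" for r
    unfolding a_def using that Wc by (intro M.finsum_closed) auto
  have bc: "b r \<in> carrier M" if "r \<le> m" for r
    unfolding b_def using that Wc by (intro M.finsum_closed) auto
  have b'c: "b' r \<in> carrier M" if "r \<le> Suc m" for r
    using that bc by (auto simp: b'_def split: nat.split)
  have zc: "z r \<in> carrier M" for r
    by (auto simp: z_def Zc)
  have upper: "(\<Oplus>\<^bsub>M\<^esub>i\<in>{r<..m}. Z r i) = \<ominus>\<^bsub>M\<^esub> a r" if "r \<le> m" for r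
  proof -
    have "{r<..m} = Suc ` {r..<m}" by (auto simp: image_iff Suc_le_eq elim: lessE)
    then have "(\<Oplus>\<^bsub>M\<^esub>i\<in>{r<..m}. Z r i) = (\<Oplus>\<^bsub>M\<^esub>i\<in>{r..<m}. Z r (Suc i))"
      using that Zc by (simp only:) (rule M.finsum_reindex, auto)
    also have "\<dots> = (\<Oplus>\<^bsub>M\<^esub>i\<in>{r..<m}. \<ominus>\<^bsub>M\<^esub> W i r)"
      using that Wc Zlow by (intro M.finsum_cong') auto
    also have "\<dots> = \<ominus>\<^bsub>M\<^esub> a r"
      unfolding a_def using that Wc by (intro finsum_neg[OF M]) auto
    finally show ?thesis .
  qed
  have lower: "(\<Oplus>\<^bsub>M\<^esub>i\<in>{..<r}. Z (Suc r) i) = \<ominus>\<^bsub>M\<^esub> b r" if "r \<le> m" for r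
  proof -
    have "(\<Oplus>\<^bsub>M\<^esub>i\<in>{..<r}. Z (Suc r) i) = (\<Oplus>\<^bsub>M\<^esub>i\<in>{..<r}. \<ominus>\<^bsub>M\<^esub> W i r)"
      using that Wc Zhigh by (intro M.finsum_cong') auto
    also have "\<dots> = \<ominus>\<^bsub>M\<^esub> b r"
      unfolding b_def using that Wc by (intro finsum_neg[OF M]) auto
    finally show ?thesis .
  qed
  have neg_zero: "\<ominus>\<^bsub>M\<^esub> \<zero>\<^bsub>M\<^esub> = \<zero>\<^bsub>M\<^esub>" by (rule M.minus_equality) simp_all
  have row: "(\<Oplus>\<^bsub>M\<^esub>i\<in>{..m}. Z r i) = z r \<oplus>\<^bsub>M\<^esub> (\<ominus>\<^bsub>M\<^esub> b' r \<oplus>\<^bsub>M\<^esub> \<ominus>\<^bsub>M\<^esub> a r)" if r: "r \<le> Suc m" for r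
  proof -
    consider "r = 0" | r' where "r = Suc r'" "r' < m" | "r = Suc m"
      using r by (cases r) (auto simp: le_less)
    then show ?thesis
    proof cases
      case 1
      have "(\<Oplus>\<^bsub>M\<^esub>i\<in>insert 0 {0<..m}. Z 0 i) = Z 0 0 \<oplus>\<^bsub>M\<^esub> (\<Oplus>\<^bsub>M\<^esub>i\<in>{0<..m}. Z 0 i)"
        using Zc by (intro M.finsum_insert) auto
      moreover have "insert 0 {0<..m} = {..m}" by auto
      moreover have "\<ominus>\<^bsub>M\<^esub> b' 0 = \<zero>\<^bsub>M\<^esub>" by (simp only: b'_def nat.case neg_zero)
      ultimately show ?thesis
        using 1 upper[of 0] ac[of 0] by (simp add: z_def)
    next
      case 2
      let ?r = "Suc r'"
      have "{..m} = {..<r'} \<union> (insert ?r (insert r' {?r<..m}))" using 2 by auto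
      then have "(\<Oplus>\<^bsub>M\<^esub>i\<in>{..m}. Z ?r i) =
          (\<Oplus>\<^bsub>M\<^esub>i\<in>{..<r'}. Z ?r i) \<oplus>\<^bsub>M\<^esub> (\<Oplus>\<^bsub>M\<^esub>i\<in>insert ?r (insert r' {?r<..m}). Z ?r i)"
        using 2 Zc by (simp only:) (rule M.finsum_Un_disjoint, auto)
      also have "(\<Oplus>\<^bsub>M\<^esub>i\<in>insert ?r (insert r' {?r<..m}). Z ?r i) =
          Z ?r ?r \<oplus>\<^bsub>M\<^esub> (Z ?r r' \<oplus>\<^bsub>M\<^esub> (\<Oplus>\<^bsub>M\<^esub>i\<in>{?r<..m}. Z ?r i))"
        using 2 Zc by (subst M.finsum_insert; auto)+
      also have "\<dots> = \<ominus>\<^bsub>M\<^esub> a ?r"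
        using 2 Zc Zdiag ac by (simp add: upper M.a_assoc[symmetric])
      finally show ?thesis
        using 2 ac[of ?r] bc[of r'] by (simp add: lower z_def b'_def)
    next
      case 3
      have "(\<Oplus>\<^bsub>M\<^esub>i\<in>insert m {..<m}. Z (Suc m) i) = Z (Suc m) m \<oplus>\<^bsub>M\<^esub> (\<Oplus>\<^bsub>M\<^esub>i\<in>{..<m}. Z (Suc m) i)"
        using Zc by (intro M.finsum_insert) auto
      moreover have "insert m {..<m} = {..m}" by auto
      moreover have "\<ominus>\<^bsub>M\<^esub> a (Suc m) = \<zero>\<^bsub>M\<^esub>" by (simp add: a_def neg_zero)
      ultimately show ?thesis
        using 3 bc[of m] by (simp add: lower z_def b'_def)
    qed
  qed
  have col: "(\<Oplus>\<^bsub>M\<^esub>i\<in>{..<m}. W i r) = b r \<oplus>\<^bsub>M\<^esub> a r" if "r \<le> m" for r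
  proof -
    have "{..<m} = {..<r} \<union> {r..<m}" using that by auto
    then show ?thesis
      unfolding a_def b_def using that Wc by (simp only:) (rule M.finsum_Un_disjoint, auto)
  qed
  have zsum: "(\<Oplus>\<^bsub>M\<^esub>r\<in>{..Suc m}. z r) = Z 0 0 \<oplus>\<^bsub>M\<^esub> Z (Suc m) m"
  proof -
    have "(\<Oplus>\<^bsub>M\<^esub>r\<in>{..Suc m}. z r) = (\<Oplus>\<^bsub>M\<^esub>r\<in>{0, Suc m}. z r)"
      using zc by (intro M.add.finprod_mono_neutral_cong_right) (auto simp: z_def)
    also have "\<dots> = z 0 \<oplus>\<^bsub>M\<^esub> z (Suc m)" using zc by (simp add: M.finsum_insert)
    finally show ?thesis by (simp add: z_def)
  qed
  have b'sum: "(\<Oplus>\<^bsub>M\<^esub>r\<in>{..Suc m}. b' r) = (\<Oplus>\<^bsub>M\<^esub>r\<in>{..m}. b r)"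
  proof -
    have "(\<Oplus>\<^bsub>M\<^esub>r\<in>{..Suc m}. b' r) = (\<Oplus>\<^bsub>M\<^esub>r\<in>{..m}. b' (Suc r)) \<oplus>\<^bsub>M\<^esub> b' 0"
      using b'c by (intro M.finsum_Suc2) auto
    moreover have "(\<Oplus>\<^bsub>M\<^esub>r\<in>{..m}. b r) \<in> carrier M" using bc by (intro M.finsum_closed) auto
    ultimately show ?thesis by (simp add: b'_def)
  qed
  have asum: "(\<Oplus>\<^bsub>M\<^esub>r\<in>{..Suc m}. a r) = (\<Oplus>\<^bsub>M\<^esub>r\<in>{..m}. a r)"
  proof -
    have "(\<Oplus>\<^bsub>M\<^esub>r\<in>{..Suc m}. a r) = a (Suc m) \<oplus>\<^bsub>M\<^esub> (\<Oplus>\<^bsub>M\<^esub>r\<in>{..m}. a r)"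
      using ac by (intro M.finsum_Suc) auto
    moreover have "(\<Oplus>\<^bsub>M\<^esub>r\<in>{..m}. a r) \<in> carrier M" using ac by (intro M.finsum_closed) auto
    moreover have "a (Suc m) = \<zero>\<^bsub>M\<^esub>" by (simp add: a_def)
    ultimately show ?thesis by simp
  qed
  let ?a = "\<Oplus>\<^bsub>M\<^esub>r\<in>{..m}. a r" and ?b = "\<Oplus>\<^bsub>M\<^esub>r\<in>{..m}. b r"
  have abc: "?a \<in> carrier M" "?b \<in> carrier M" using ac bc by (auto intro!: M.finsum_closed)
  have "(\<Oplus>\<^bsub>M\<^esub>r\<in>{..Suc m}. \<Oplus>\<^bsub>M\<^esub>i\<in>{..m}. Z r i) =
      (\<Oplus>\<^bsub>M\<^esub>r\<in>{..Suc m}. z r \<oplus>\<^bsub>M\<^esub> (\<ominus>\<^bsub>M\<^esub> b' r \<oplus>\<^bsub>M\<^esub> \<ominus>\<^bsub>M\<^esub> a r))"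
    using row zc b'c ac by (intro M.finsum_cong') auto
  also have "\<dots> = (\<Oplus>\<^bsub>M\<^esub>r\<in>{..Suc m}. z r) \<oplus>\<^bsub>M\<^esub>
      ((\<Oplus>\<^bsub>M\<^esub>r\<in>{..Suc m}. \<ominus>\<^bsub>M\<^esub> b' r) \<oplus>\<^bsub>M\<^esub> (\<Oplus>\<^bsub>M\<^esub>r\<in>{..Suc m}. \<ominus>\<^bsub>M\<^esub> a r))"
    using zc b'c ac by (subst M.finsum_addf, auto)+
  also have "\<dots> = (Z 0 0 \<oplus>\<^bsub>M\<^esub> Z (Suc m) m) \<oplus>\<^bsub>M\<^esub> (\<ominus>\<^bsub>M\<^esub> ?b \<oplus>\<^bsub>M\<^esub> \<ominus>\<^bsub>M\<^esub> ?a)"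
    using finsum_neg[OF M, of "{..Suc m}" b'] finsum_neg[OF M, of "{..Suc m}" a] b'c ac
    by (simp only: atMost_iff zsum b'sum asum)
  finally have ZZ: "(\<Oplus>\<^bsub>M\<^esub>r\<in>{..Suc m}. \<Oplus>\<^bsub>M\<^esub>i\<in>{..m}. Z r i) =
      (Z 0 0 \<oplus>\<^bsub>M\<^esub> Z (Suc m) m) \<oplus>\<^bsub>M\<^esub> (\<ominus>\<^bsub>M\<^esub> ?b \<oplus>\<^bsub>M\<^esub> \<ominus>\<^bsub>M\<^esub> ?a)" .
  have "(\<Oplus>\<^bsub>M\<^esub>r\<in>{..m}. \<Oplus>\<^bsub>M\<^esub>i\<in>{..<m}. W i r) = (\<Oplus>\<^bsub>M\<^esub>r\<in>{..m}. b r \<oplus>\<^bsub>M\<^esub> a r)"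
    using col ac bc by (intro M.finsum_cong') auto
  also have "\<dots> = ?b \<oplus>\<^bsub>M\<^esub> ?a"
    using ac bc by (intro M.finsum_addf) auto
  finally have WW: "(\<Oplus>\<^bsub>M\<^esub>r\<in>{..m}. \<Oplus>\<^bsub>M\<^esub>i\<in>{..<m}. W i r) = ?b \<oplus>\<^bsub>M\<^esub> ?a" .
  have ZW: "(Z 0 0 \<oplus>\<^bsub>M\<^esub> Z (Suc m) m) \<oplus>\<^bsub>M\<^esub> (\<ominus>\<^bsub>M\<^esub> ?b \<oplus>\<^bsub>M\<^esub> \<ominus>\<^bsub>M\<^esub> ?a) \<oplus>\<^bsub>M\<^esub> (?b \<oplus>\<^bsub>M\<^esub> ?a) =
      Z 0 0 \<oplus>\<^bsub>M\<^esub> Z (Suc m) m"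
  proof -
    have "(\<ominus>\<^bsub>M\<^esub> ?b \<oplus>\<^bsub>M\<^esub> \<ominus>\<^bsub>M\<^esub> ?a) \<oplus>\<^bsub>M\<^esub> (?b \<oplus>\<^bsub>M\<^esub> ?a) = \<zero>\<^bsub>M\<^esub>"
      using abc by (simp add: M.minus_add[symmetric] M.l_neg)
    then show ?thesis using abc Zc[of 0 0] Zc[of "Suc m" m] by (simp add: M.a_assoc)
  qed
  have corner: "Z 0 0 = X 0 0" "Z (Suc m) m = \<ominus>\<^bsub>M\<^esub> X (Suc m) m"
    by (simp_all add: Z_def signed_def)
  show ?thesis
    unfolding Z_def[symmetric] W_def[symmetric] ZZ WW using ZW unfolding corner
    by (simp only: a_minus_def)
qed


section \<open>The homotopy on elementary tensors\<close>

text \<open>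
  A tensor product of elementary matrices is described by its rows \<open>u\<close>, its columns \<open>v\<close> and its
  entries \<open>a\<close>, as functions of the position. The following operations give the effect of \<open>h\<^sub>i\<close> and
  of an interior face on these data. Merging positions \<open>r\<close> and \<open>r + 1\<close> keeps the row of the first
  and the column of the second. The operation on entries is generic because it also tracks their
  parities, with addition in place of multiplication.
\<close>

definition insert_row :: "nat \<Rightarrow> (nat \<Rightarrow> nat) \<Rightarrow> nat \<Rightarrow> nat" where
  "insert_row i u s = (if s = 0 then u 0 else if s \<le> Suc i then 0 else u (s - 1))"

definition insert_col :: "nat \<Rightarrow> (nat \<Rightarrow> nat) \<Rightarrow> nat \<Rightarrow> nat" where
  "insert_col i v s = (if s \<le> i then 0 else v (s - 1))"

definition insert_slot :: "nat \<Rightarrow> 'b \<Rightarrow> (nat \<Rightarrow> 'b) \<Rightarrow> nat \<Rightarrow> 'b" where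
  "insert_slot i b a s = (if s \<le> i then a s else if s = Suc i then b else a (s - 1))"

definition merge_row :: "nat \<Rightarrow> (nat \<Rightarrow> nat) \<Rightarrow> nat \<Rightarrow> nat" where
  "merge_row r u s = (if s \<le> r then u s else u (Suc s))"

definition merge_col :: "nat \<Rightarrow> (nat \<Rightarrow> nat) \<Rightarrow> nat \<Rightarrow> nat" where
  "merge_col r v s = (if s < r then v s else v (Suc s))"

definition merge_slot :: "('b \<Rightarrow> 'b \<Rightarrow> 'b) \<Rightarrow> nat \<Rightarrow> (nat \<Rightarrow> 'b) \<Rightarrow> nat \<Rightarrow> 'b" where
  "merge_slot f r a s = (if s < r then a s else if s = r then f (a r) (a (Suc r)) else a (Suc s))"

text \<open>The condition without which \<open>h\<^sub>i\<close> annihilates an elementary tensor.\<close>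

definition matched :: "nat \<Rightarrow> (nat \<Rightarrow> nat) \<Rightarrow> (nat \<Rightarrow> nat) \<Rightarrow> bool" where
  "matched i u v \<longleftrightarrow> (\<forall>s<i. v s = u (Suc s))"

lemmas slot_defs = insert_row_def insert_col_def insert_slot_def merge_row_def merge_col_def merge_slot_def

text \<open>The corner index 0 is even, so that the inserted factor \<open>E 0 k 1\<close> has the parity of \<open>k\<close>; the sign in
  the supertrace comes from it.\<close>

locale supermatrices_pos = supermatrices K R p q
  for K :: "'k ring" and R :: "('k, 'a) superalgebra" and p q :: nat +
  assumes p_pos: "1 \<le> p"
begin

definition elementary_tensor :: "nat \<Rightarrow> (nat \<Rightarrow> nat) \<Rightarrow> (nat \<Rightarrow> nat) \<Rightarrow> (nat \<Rightarrow> 'a) \<Rightarrow> ('a mat list \<Rightarrow> 'k) set" where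
  "elementary_tensor m u v a = pure (Suc m) (\<lambda>s. E (u s) (v s) (a s))"

text \<open>The parities \<open>e\<close> belong to the entries; the factors, as matrices, have the parities
  \<open>slot_parity u v e\<close>.\<close>

definition elem_data :: "nat \<Rightarrow> (nat \<Rightarrow> nat) \<Rightarrow> (nat \<Rightarrow> nat) \<Rightarrow> (nat \<Rightarrow> 'a) \<Rightarrow> (nat \<Rightarrow> bit) \<Rightarrow> bool" where
  "elem_data m u v a e \<longleftrightarrow> (\<forall>s\<le>m. u s < n \<and> v s < n \<and> a s \<in> homog R (e s))"

definition slot_parity :: "(nat \<Rightarrow> nat) \<Rightarrow> (nat \<Rightarrow> nat) \<Rightarrow> (nat \<Rightarrow> bit) \<Rightarrow> nat \<Rightarrow> bit" where
  "slot_parity u v e s = e s + index_parity (u s) + index_parity (v s)"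

lemma elem_dataD:
  assumes "elem_data m u v a e" "s \<le> m"
  shows "u s < n" "v s < n" "a s \<in> homog R (e s)" "a s \<in> carrier R"
    "E (u s) (v s) (a s) \<in> homog S (slot_parity u v e s)" "E (u s) (v s) (a s) \<in> carrier S"
proof -
  show *: "u s < n" "v s < n" "a s \<in> homog R (e s)"
    using assms by (auto simp: elem_data_def)
  show "a s \<in> carrier R" using * RG.homog_carrier by blast
  then show "E (u s) (v s) (a s) \<in> carrier S" by (rule E_closed)
  show "E (u s) (v s) (a s) \<in> homog S (slot_parity u v e s)"
    using *(3) by (rule E_homog) (simp add: slot_parity_def)
qed

lemma elem_cong:
  "(\<And>s. s \<le> m \<Longrightarrow> u s = u' s \<and> v s = v' s \<and> a s = a' s) \<Longrightarrow> elementary_tensor m u v a = elementary_tensor m u' v' a'"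
  unfolding elementary_tensor_def by (rule pure_cong) simp

lemma elem_closed: "elem_data m u v a e \<Longrightarrow> elementary_tensor m u v a \<in> carrier (hochschild K S m)"
  unfolding elementary_tensor_def by (rule pure_closed) (rule elem_dataD)

lemma elem_data_insert:
  assumes "elem_data m u v a e" "i \<le> m"
  shows "elem_data (Suc m) (insert_row i u) (insert_col i v) (insert_slot i \<one>\<^bsub>R\<^esub> a) (insert_slot i 0 e)"
  using assms p_pos R.one_homog unfolding elem_data_def slot_defs
  by (auto split: if_splits)

lemma elem_data_merge:
  assumes "elem_data (Suc m) u v a e" "r \<le> m"
  shows "elem_data m (merge_row r u) (merge_col r v) (merge_slot (\<otimes>\<^bsub>R\<^esub>) r a) (merge_slot (+) r e)"
  using assms R.mult_homog unfolding elem_data_def slot_defs by auto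

lemma elem_data_rotate:
  assumes "elem_data (Suc m) u v a e"
  shows "elem_data m (\<lambda>s. if s = 0 then u (Suc m) else u s) v
    (\<lambda>s. if s = 0 then a (Suc m) \<otimes>\<^bsub>R\<^esub> a 0 else a s) (\<lambda>s. if s = 0 then e (Suc m) + e 0 else e s)"
  using assms R.mult_homog unfolding elem_data_def by auto

lemma homotopy_elem:
  assumes d: "elem_data m u v a e" and i: "i \<le> m"
  shows "homotopy_component m i (elementary_tensor m u v a) =
    (if matched i u v
     then elementary_tensor (Suc m) (insert_row i u) (insert_col i v) (insert_slot i \<one>\<^bsub>R\<^esub> a)
     else \<zero>\<^bsub>hochschild K S (Suc m)\<^esub>)"
proof -
  have "pure (Suc (Suc m)) (\<lambda>s. if s \<le> i then E (if s = 0 then u 0 else 0) 0 (a s)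
       else if s = Suc i then E 0 (v i) \<one>\<^bsub>R\<^esub> else E (u (s - 1)) (v (s - 1)) (a (s - 1))) =
     elementary_tensor (Suc m) (insert_row i u) (insert_col i v) (insert_slot i \<one>\<^bsub>R\<^esub> a)"
    unfolding elementary_tensor_def by (rule pure_cong) (auto simp: slot_defs)
  then show ?thesis
    unfolding elementary_tensor_def[of m] matched_def
    by (subst homotopy_component_elementary[OF i]) (simp_all only: elem_dataD[OF d])
qed

lemma face_elem:
  assumes d: "elem_data (Suc m) u v a e" and r: "r \<le> m"
  shows "hochschild_face K S (Suc m) r (elementary_tensor (Suc m) u v a) =
    (if v r = u (Suc r)
     then elementary_tensor m (merge_row r u) (merge_col r v) (merge_slot (\<otimes>\<^bsub>R\<^esub>) r a)
     else \<zero>\<^bsub>hochschild K S m\<^esub>)"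
proof -
  let ?A = "\<lambda>s. E (u s) (v s) (a s)"
  let ?B = "\<lambda>s. if s < r then ?A s else if s = r then ?A r \<otimes>\<^bsub>S\<^esub> ?A (Suc r) else ?A (Suc s)"
  have "hochschild_face K S (Suc m) r (elementary_tensor (Suc m) u v a) = pure (Suc m) ?B"
    unfolding elementary_tensor_def using r by (intro hochschild_face_inner[where e = "slot_parity u v e"] elem_dataD[OF d]) auto
  moreover have mult: "?A r \<otimes>\<^bsub>S\<^esub> ?A (Suc r) =
      (if v r = u (Suc r) then E (u r) (v (Suc r)) (a r \<otimes>\<^bsub>R\<^esub> a (Suc r)) else \<zero>\<^bsub>S\<^esub>)"
    using r by (intro E_mult elem_dataD[OF d]) auto
  moreover have "pure (Suc m) ?B = elementary_tensor m (merge_row r u) (merge_col r v) (merge_slot (\<otimes>\<^bsub>R\<^esub>) r a)"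
    if "v r = u (Suc r)"
    unfolding elementary_tensor_def by (rule pure_cong) (use that mult in \<open>auto simp: slot_defs\<close>)
  moreover have "pure (Suc m) ?B = \<zero>\<^bsub>hochschild K S m\<^esub>" if "v r \<noteq> u (Suc r)"
  proof (rule pure_zero[where s = r])
    show "?B s \<in> carrier S" if "s \<le> m" for s
      using that r elem_dataD(6)[OF d] by (auto intro!: mult_matrix_closed)
    show "?B r = \<zero>\<^bsub>S\<^esub>" using that mult by simp
  qed (rule r)
  ultimately show ?thesis by simp
qed

lemma last_face_elem:
  assumes d: "elem_data (Suc m) u v a e"
  shows "hochschild_face K S (Suc m) (Suc m) (elementary_tensor (Suc m) u v a) =
    (if v (Suc m) = u 0
     then signed (hochschild K S m) (slot_parity u v e (Suc m) * (\<Sum>s\<le>m. slot_parity u v e s))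
       (elementary_tensor m (\<lambda>s. if s = 0 then u (Suc m) else u s) v
         (\<lambda>s. if s = 0 then a (Suc m) \<otimes>\<^bsub>R\<^esub> a 0 else a s))
     else \<zero>\<^bsub>hochschild K S m\<^esub>)"
proof -
  let ?A = "\<lambda>s. E (u s) (v s) (a s)"
  let ?B = "\<lambda>s. if s = 0 then ?A (Suc m) \<otimes>\<^bsub>S\<^esub> ?A 0 else ?A s"
  let ?sgn = "signed (hochschild K S m) (slot_parity u v e (Suc m) * (\<Sum>s\<le>m. slot_parity u v e s))"
  have "hochschild_face K S (Suc m) (Suc m) (elementary_tensor (Suc m) u v a) = ?sgn (pure (Suc m) ?B)"
    using hochschild_face_last[of "Suc m" ?A "slot_parity u v e"] elem_dataD(5)[OF d]
    by (simp add: elementary_tensor_def lessThan_Suc_atMost del: upt_Suc)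
  moreover have mult: "?A (Suc m) \<otimes>\<^bsub>S\<^esub> ?A 0 =
      (if v (Suc m) = u 0 then E (u (Suc m)) (v 0) (a (Suc m) \<otimes>\<^bsub>R\<^esub> a 0) else \<zero>\<^bsub>S\<^esub>)"
    by (intro E_mult elem_dataD[OF d]) auto
  moreover have "pure (Suc m) ?B = elementary_tensor m (\<lambda>s. if s = 0 then u (Suc m) else u s) v
         (\<lambda>s. if s = 0 then a (Suc m) \<otimes>\<^bsub>R\<^esub> a 0 else a s)"
    if "v (Suc m) = u 0"
    unfolding elementary_tensor_def by (rule pure_cong) (use that mult in auto)
  moreover have "pure (Suc m) ?B = \<zero>\<^bsub>hochschild K S m\<^esub>" if "v (Suc m) \<noteq> u 0"
  proof (rule pure_zero[where s = 0])
    show "?B s \<in> carrier S" if "s \<le> m" for s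
      using that elem_dataD(6)[OF d] by (auto intro!: mult_matrix_closed)
    show "?B 0 = \<zero>\<^bsub>S\<^esub>" using that mult by simp
  qed simp
  ultimately show ?thesis by (simp add: signed_zero[OF hochschild_module])
qed

lemma face_zero:
  assumes "r \<le> Suc m"
  shows "hochschild_face K S (Suc m) r \<zero>\<^bsub>hochschild K S (Suc m)\<^esub> = \<zero>\<^bsub>hochschild K S m\<^esub>"
  using linear_maps_zero[OF hochschild_module hochschild_module hochschild_face_linear[of "Suc m" r]]
    assms by simp

lemma homotopy_zero:
  assumes "i \<le> m"
  shows "homotopy_component m i \<zero>\<^bsub>hochschild K S m\<^esub> = \<zero>\<^bsub>hochschild K S (Suc m)\<^esub>"
  by (rule linear_maps_zero[OF hochschild_module hochschild_module homotopy_component_linear[OF assms]])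

text \<open>The factors 1 to \<open>Suc i\<close> sit in the corner after the homotopy, so merging at \<open>r \<le> i\<close> always
  matches on the left; on the right the match is one of the conditions that the homotopy imposes
  on the left.\<close>

lemma face_homotopy_low:
  assumes d: "elem_data (Suc m) u v a e" and r: "r \<le> i" "i \<le> m"
  shows "hochschild_face K S (Suc (Suc m)) r (homotopy_component (Suc m) (Suc i) (elementary_tensor (Suc m) u v a)) =
    homotopy_component m i (hochschild_face K S (Suc m) r (elementary_tensor (Suc m) u v a))"
proof -
  let ?u = "merge_row r u" and ?v = "merge_col r v" and ?a = "merge_slot (\<otimes>\<^bsub>R\<^esub>) r a"
  have chain: "matched (Suc i) u v \<longleftrightarrow> v r = u (Suc r) \<and> matched i ?u ?v"
    unfolding matched_def
  proof
    assume *: "v r = u (Suc r) \<and> (\<forall>s<i. ?v s = ?u (Suc s))"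
    show "\<forall>s<Suc i. v s = u (Suc s)"
    proof (intro allI impI)
      fix s assume s: "s < Suc i"
      consider "s < r" | "s = r" | s' where "s = Suc s'" "r \<le> s'" by (cases s) (auto simp: le_less, linarith)
      then show "v s = u (Suc s)"
      proof cases
        case 1
        then show ?thesis using * r by (auto simp: slot_defs dest!: spec[of _ s])
      next
        case 3
        then show ?thesis using * s by (auto simp: slot_defs dest!: spec[of _ s'])
      qed (use * in simp)
    qed
  qed (use r in \<open>auto simp: slot_defs\<close>)
  have "elementary_tensor (Suc m) (merge_row r (insert_row (Suc i) u)) (merge_col r (insert_col (Suc i) v))
      (merge_slot (\<otimes>\<^bsub>R\<^esub>) r (insert_slot (Suc i) \<one>\<^bsub>R\<^esub> a)) =
    elementary_tensor (Suc m) (insert_row i ?u) (insert_col i ?v) (insert_slot i \<one>\<^bsub>R\<^esub> ?a)"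
    using r by (intro elem_cong) (case_tac s; auto simp: slot_defs)
  moreover have "insert_col (Suc i) v r = insert_row (Suc i) u (Suc r)"
    using r by (simp add: slot_defs)
  ultimately show ?thesis
    using r chain homotopy_elem[OF d, of "Suc i"] homotopy_elem[OF elem_data_merge[OF d, of r], of i]
      face_elem[OF elem_data_insert[OF d, of "Suc i"], of r] face_elem[OF d, of r]
    by (simp add: face_zero homotopy_zero del: upt_Suc)
qed

text \<open>Both maps act on disjoint sets of positions.\<close>

lemma face_homotopy_high:
  assumes d: "elem_data (Suc m) u v a e" and r: "i < r" "r \<le> m"
  shows "hochschild_face K S (Suc (Suc m)) (Suc r) (homotopy_component (Suc m) i (elementary_tensor (Suc m) u v a)) =
    homotopy_component m i (hochschild_face K S (Suc m) r (elementary_tensor (Suc m) u v a))"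
proof -
  let ?u = "merge_row r u" and ?v = "merge_col r v" and ?a = "merge_slot (\<otimes>\<^bsub>R\<^esub>) r a"
  have chain: "matched i u v \<longleftrightarrow> matched i ?u ?v"
    using r by (auto simp: slot_defs matched_def)
  have "elementary_tensor (Suc m) (merge_row (Suc r) (insert_row i u)) (merge_col (Suc r) (insert_col i v))
      (merge_slot (\<otimes>\<^bsub>R\<^esub>) (Suc r) (insert_slot i \<one>\<^bsub>R\<^esub> a)) =
    elementary_tensor (Suc m) (insert_row i ?u) (insert_col i ?v) (insert_slot i \<one>\<^bsub>R\<^esub> ?a)"
    using r by (intro elem_cong) (case_tac s; auto simp: slot_defs)
  moreover have "insert_col i v (Suc r) = v r" "insert_row i u (Suc (Suc r)) = u (Suc r)"
    using r by (simp_all add: slot_defs)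
  ultimately show ?thesis
    using r chain homotopy_elem[OF d, of i] homotopy_elem[OF elem_data_merge[OF d, of r], of i]
      face_elem[OF elem_data_insert[OF d, of i], of "Suc r"] face_elem[OF d, of r]
    by (simp add: face_zero homotopy_zero del: upt_Suc)
qed

text \<open>Each row parity of \<open>u (Suc s)\<close> with \<open>s < i\<close> cancels the equal column parity of \<open>v s\<close>; that of
  \<open>u 0\<close> stays with the first factor, and that of \<open>v i\<close> moves to the inserted one.\<close>

lemma slot_parity_insert:
  assumes "matched i u v" "i \<le> m"
  shows "(\<Sum>s\<le>Suc m. slot_parity (insert_row i u) (insert_col i v) (insert_slot i 0 e) s) =
    (\<Sum>s\<le>m. slot_parity u v e s)"
proof -
  let ?f = "slot_parity u v e"
  let ?F = "slot_parity (insert_row i u) (insert_col i v) (insert_slot i 0 e)"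
  have zero: "index_parity 0 = 0" using p_pos by (simp add: index_parity_def)
  have F0: "?F 0 = e 0 + index_parity (u 0)"
    by (simp add: slot_parity_def slot_defs zero)
  have Fle: "?F s = e s" if "0 < s" "s \<le> i" for s
    using that by (simp add: slot_parity_def slot_defs zero)
  have Fi: "?F (Suc i) = index_parity (v i)"
    by (simp add: slot_parity_def slot_defs zero)
  have Fgt: "?F (Suc s) = ?f s" if "i < s" for s
    using that by (simp add: slot_parity_def slot_defs)
  have s0: "(\<Sum>s\<le>0. g s) = g 0" for g :: "nat \<Rightarrow> bit" by simp
  have start: "(\<Sum>s\<le>j. ?F s) + index_parity (v j) = (\<Sum>s\<le>j. ?f s)" if "j \<le> i" for j
    using that
  proof (induction j)
    case 0
    show ?case unfolding s0 F0 by (simp only: slot_parity_def)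
  next
    case (Suc j)
    have bits: "(A + y) + (x + y + z) = A + x + z" for A x y z :: bit
      by (cases A; cases x; cases y; cases z) simp_all
    have "?f (Suc j) = e (Suc j) + index_parity (v j) + index_parity (v (Suc j))"
      using Suc.prems assms(1) by (simp only: slot_parity_def matched_def Suc_le_eq)
    moreover have "(\<Sum>s\<le>j. ?f s) = (\<Sum>s\<le>j. ?F s) + index_parity (v j)"
      using Suc by simp
    moreover have "?F (Suc j) = e (Suc j)" using Fle Suc.prems by blast
    ultimately show ?case by (simp only: sum.atMost_Suc bits)
  qed
  show ?thesis
    using assms(2)
  proof (induction m rule: dec_induct)
    case base
    show ?case unfolding start[OF le_refl, symmetric] sum.atMost_Suc Fi by (rule refl)
  next
    case (step k)
    have "?F (Suc (Suc k)) = ?f (Suc k)" using step.hyps by (intro Fgt) simp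
    then show ?case using step.IH by (simp only: sum.atMost_Suc)
  qed
qed

text \<open>The cyclic product changes row and entry at position 0, neither of which the homotopy
  inspects for matching. The signs on the two sides agree because the homotopy preserves the total
  parity of the factors in front of the last one.\<close>

lemma face_homotopy_last:
  assumes d: "elem_data (Suc m) u v a e" and i: "i \<le> m"
  shows "hochschild_face K S (Suc (Suc m)) (Suc (Suc m))
      (homotopy_component (Suc m) i (elementary_tensor (Suc m) u v a)) =
    homotopy_component m i (hochschild_face K S (Suc m) (Suc m) (elementary_tensor (Suc m) u v a))"
proof -
  let ?u = "\<lambda>s. if s = 0 then u (Suc m) else u s"
  let ?a = "\<lambda>s. if s = 0 then a (Suc m) \<otimes>\<^bsub>R\<^esub> a 0 else a s"
  let ?e = "slot_parity u v e (Suc m) * (\<Sum>s\<le>m. slot_parity u v e s)"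
  note dr = elem_data_rotate[OF d]
  have chain: "matched i u v \<longleftrightarrow> matched i ?u v"
    by (auto simp: matched_def)
  have "elementary_tensor (Suc m)
      (\<lambda>s. if s = 0 then insert_row i u (Suc (Suc m)) else insert_row i u s) (insert_col i v)
      (\<lambda>s. if s = 0 then insert_slot i \<one>\<^bsub>R\<^esub> a (Suc (Suc m)) \<otimes>\<^bsub>R\<^esub> insert_slot i \<one>\<^bsub>R\<^esub> a 0
        else insert_slot i \<one>\<^bsub>R\<^esub> a s) =
    elementary_tensor (Suc m) (insert_row i ?u) (insert_col i v) (insert_slot i \<one>\<^bsub>R\<^esub> ?a)"
    using i by (intro elem_cong) (auto simp: slot_defs)
  moreover have "insert_col i v (Suc (Suc m)) = v (Suc m)" "insert_row i u 0 = u 0"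
    using i by (simp_all add: slot_defs)
  moreover have "slot_parity (insert_row i u) (insert_col i v) (insert_slot i 0 e) (Suc (Suc m)) =
      slot_parity u v e (Suc m)"
    using i by (simp add: slot_parity_def slot_defs)
  moreover have "homotopy_component m i (signed (hochschild K S m) ?e (elementary_tensor m ?u v ?a)) =
      signed (hochschild K S (Suc m)) ?e (homotopy_component m i (elementary_tensor m ?u v ?a))"
    by (rule linear_maps_signed[OF hochschild_module hochschild_module
          homotopy_component_linear[OF i] elem_closed[OF dr]])
  ultimately show ?thesis
    using i chain homotopy_elem[OF d, of i] homotopy_elem[OF dr i]
      last_face_elem[OF elem_data_insert[OF d, of i]] last_face_elem[OF d]
      slot_parity_insert[of i u v m e]
    by (simp add: face_zero homotopy_zero signed_zero[OF hochschild_module] del: sum.atMost_Suc)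
qed

text \<open>On the left the corner entry \<open>a (Suc r)\<close> is multiplied by the inserted unit behind it, on the
  right the unit inserted one step earlier is multiplied by the untouched factor. The matching that
  \<open>h\<^bsub>r+1\<^esub>\<close> demands in addition is the one needed for the product on the right.\<close>

lemma face_homotopy_diagonal:
  assumes d: "elem_data m u v a e" and r: "r < m"
  shows "hochschild_face K S (Suc m) (Suc r) (homotopy_component m (Suc r) (elementary_tensor m u v a)) =
    hochschild_face K S (Suc m) (Suc r) (homotopy_component m r (elementary_tensor m u v a))"
proof -
  have chain: "matched (Suc r) u v \<longleftrightarrow> matched r u v \<and> v r = u (Suc r)"
    by (auto simp: matched_def less_Suc_eq)
  have "elementary_tensor m (merge_row (Suc r) (insert_row (Suc r) u))
      (merge_col (Suc r) (insert_col (Suc r) v)) (merge_slot (\<otimes>\<^bsub>R\<^esub>) (Suc r) (insert_slot (Suc r) \<one>\<^bsub>R\<^esub> a)) =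
    elementary_tensor m (merge_row (Suc r) (insert_row r u))
      (merge_col (Suc r) (insert_col r v)) (merge_slot (\<otimes>\<^bsub>R\<^esub>) (Suc r) (insert_slot r \<one>\<^bsub>R\<^esub> a))"
    using r elem_dataD(4)[OF d] by (intro elem_cong) (auto simp: slot_defs)
  moreover have "insert_col (Suc r) v (Suc r) = insert_row (Suc r) u (Suc (Suc r))"
    "insert_col r v (Suc r) = v r" "insert_row r u (Suc (Suc r)) = u (Suc r)"
    by (simp_all add: slot_defs)
  ultimately show ?thesis
    using r chain homotopy_elem[OF d, of "Suc r"] homotopy_elem[OF d, of r]
      face_elem[OF elem_data_insert[OF d, of "Suc r"], of "Suc r"]
      face_elem[OF elem_data_insert[OF d, of r], of "Suc r"]
    by (simp add: face_zero)
qed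

text \<open>The inserted \<open>E 0 (v 0) 1\<close> undoes the move of the first factor to column 0.\<close>

lemma face_homotopy_first:
  assumes d: "elem_data m u v a e"
  shows "hochschild_face K S (Suc m) 0 (homotopy_component m 0 (elementary_tensor m u v a)) =
    elementary_tensor m u v a"
proof -
  have "elementary_tensor m (merge_row 0 (insert_row 0 u)) (merge_col 0 (insert_col 0 v))
      (merge_slot (\<otimes>\<^bsub>R\<^esub>) 0 (insert_slot 0 \<one>\<^bsub>R\<^esub> a)) = elementary_tensor m u v a"
    using elem_dataD(4)[OF d] by (intro elem_cong) (auto simp: slot_defs)
  moreover have "insert_col 0 v 0 = insert_row 0 u (Suc 0)" "matched 0 u v"
    by (simp_all add: slot_defs matched_def)
  ultimately show ?thesis
    using homotopy_elem[OF d, of 0] face_elem[OF elem_data_insert[OF d, of 0], of 0] by simp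
qed

text \<open>After \<open>h\<^sub>m\<close> the entries \<open>a s\<close> are in column 0, and all but \<open>a 0\<close> are in the corner. The cyclic
  product with \<open>E 0 (v m) 1\<close> moves \<open>a 0\<close> there if \<open>v m = u 0\<close>, at the cost of a sign when the index \<open>u 0\<close>
  is odd.\<close>

lemma face_homotopy_corner:
  assumes d: "elem_data m u v a e"
  shows "hochschild_face K S (Suc m) (Suc m) (homotopy_component m m (elementary_tensor m u v a)) =
    Inc K p q R m (Str K p q R m (elementary_tensor m u v a))"
proof -
  let ?F = "slot_parity (insert_row m u) (insert_col m v) (insert_slot m 0 e)"
  define t where "t = tensor K R (map a [0..<Suc m])"
  define c where "c = index_parity (u 0) * (1 + (\<Sum>s\<le>m. e s))"
  have zero: "index_parity 0 = 0" using p_pos by (simp add: index_parity_def)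
  have ac: "\<And>s. s \<le> m \<Longrightarrow> a s \<in> carrier R" using elem_dataD(4)[OF d] .
  have t: "t \<in> carrier (hochschild K R m)"
    unfolding hochschild_def t_def using ac by (intro tensor_closed[OF RG.module] map_tuples) simp
  have Str: "Str K p q R m (elementary_tensor m u v a) =
    (if matched m u v \<and> v m = u 0 then signed (hochschild K R m) c t else \<zero>\<^bsub>hochschild K R m\<^esub>)"
    unfolding elementary_tensor_def matched_def t_def c_def
    by (rule Str_elementary) (fact elem_dataD[OF d])+
  have Inc: "Inc K p q R m (signed (hochschild K R m) c t) =
      signed (hochschild K S m) c (elementary_tensor m (\<lambda>_. 0) (\<lambda>_. 0) a)"
    using linear_maps_signed[OF hochschild_R_module hochschild_module Inc_linear t, of c]
      Inc_tensor[of m a, OF ac]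
    by (simp add: elementary_tensor_def t_def del: upt_Suc)
  have Inc0: "Inc K p q R m \<zero>\<^bsub>hochschild K R m\<^esub> = \<zero>\<^bsub>hochschild K S m\<^esub>"
    by (rule linear_maps_zero[OF hochschild_R_module hochschild_module Inc_linear])
  have last: "insert_col m v (Suc m) = v m" "insert_row m u 0 = u 0"
    by (simp_all add: slot_defs)
  have eq: "elementary_tensor m
      (\<lambda>s. if s = 0 then insert_row m u (Suc m) else insert_row m u s) (insert_col m v)
      (\<lambda>s. if s = 0 then insert_slot m \<one>\<^bsub>R\<^esub> a (Suc m) \<otimes>\<^bsub>R\<^esub> insert_slot m \<one>\<^bsub>R\<^esub> a 0
        else insert_slot m \<one>\<^bsub>R\<^esub> a s) = elementary_tensor m (\<lambda>_. 0) (\<lambda>_. 0) a"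
    using ac by (intro elem_cong) (auto simp: slot_defs)
  have sgn: "?F (Suc m) * (\<Sum>s\<le>m. ?F s) = c" if "v m = u 0"
  proof -
    have s0: "(\<Sum>s\<le>0. g s) = g 0" for g :: "nat \<Rightarrow> bit" by simp
    have "(\<Sum>s\<le>j. ?F s) = (\<Sum>s\<le>j. e s) + index_parity (u 0)" if "j \<le> m" for j
      using that
    proof (induction j)
      case 0
      have "?F 0 = e 0 + index_parity (u 0)" by (simp add: slot_parity_def slot_defs zero)
      then show ?case unfolding s0 .
    next
      case (Suc j)
      have "?F (Suc j) = e (Suc j)" using Suc.prems by (simp add: slot_parity_def slot_defs zero)
      then show ?case using Suc by (simp only: sum.atMost_Suc ac_simps Suc_leD)
    qed
    moreover have "?F (Suc m) = index_parity (u 0)"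
      using that by (simp add: slot_parity_def slot_defs zero)
    moreover have "x * (y + x) = x * (1 + y)" for x y :: bit by (cases x; cases y) simp_all
    ultimately show ?thesis by (simp only: le_refl c_def)
  qed
  show ?thesis
    using homotopy_elem[OF d, of m] last_face_elem[OF elem_data_insert[OF d, of m]] sgn
    unfolding last eq
    by (simp add: Str Inc Inc0 face_zero)
qed


section \<open>The chain homotopy\<close>

definition homotopy :: "nat \<Rightarrow> ('a mat list \<Rightarrow> 'k) set \<Rightarrow> ('a mat list \<Rightarrow> 'k) set" where
  "homotopy m x =
    (\<Oplus>\<^bsub>hochschild K S (Suc m)\<^esub>i\<in>{..m}. signed (hochschild K S (Suc m)) (of_nat i) (homotopy_component m i x))"

lemma homotopy_linear: "homotopy m \<in> linear_maps K (hochschild K S m) (hochschild K S (Suc m))"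
  unfolding homotopy_def
  by (intro finsum_linear_maps hochschild_module
      linear_maps_compose[OF homotopy_component_linear signed_linear]) simp

lemma hochschild_diff_Suc:
  "hochschild_diff K S (Suc m) x =
    (\<Oplus>\<^bsub>hochschild K S m\<^esub>r\<in>{..Suc m}. signed (hochschild K S m) (of_nat r) (hochschild_face K S (Suc m) r x))"
  by (simp add: hochschild_diff_def)

lemma signed_face_linear:
  assumes "r \<le> Suc m"
  shows "(\<lambda>x. signed (hochschild K S m) e (hochschild_face K S (Suc m) r x))
    \<in> linear_maps K (hochschild K S (Suc m)) (hochschild K S m)"
  using hochschild_face_linear[of "Suc m" r] assms
  by (intro linear_maps_compose[OF _ signed_linear[OF hochschild_module]]) simp

lemma hochschild_diff_linear:
  "hochschild_diff K S (Suc m) \<in> linear_maps K (hochschild K S (Suc m)) (hochschild K S m)"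
  unfolding hochschild_diff_Suc
  by (intro finsum_linear_maps hochschild_module signed_face_linear) simp

lemma diff_homotopy_expand:
  assumes x: "x \<in> carrier (hochschild K S m)"
  shows "hochschild_diff K S (Suc m) (homotopy m x) =
    (\<Oplus>\<^bsub>hochschild K S m\<^esub>r\<in>{..Suc m}. \<Oplus>\<^bsub>hochschild K S m\<^esub>i\<in>{..m}.
      signed (hochschild K S m) (of_nat r + of_nat i)
        (hochschild_face K S (Suc m) r (homotopy_component m i x)))"
proof -
  let ?H = "hochschild K S m" and ?H' = "hochschild K S (Suc m)"
  interpret H: module K ?H by (rule hochschild_module)
  have hc: "homotopy_component m i x \<in> carrier ?H'" if "i \<le> m" for i
    by (rule linear_maps_closed[OF homotopy_component_linear[OF that] x])
  have fc: "hochschild_face K S (Suc m) r y \<in> carrier ?H" if "r \<le> Suc m" "y \<in> carrier ?H'" for r y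
    using linear_maps_closed[OF hochschild_face_linear[of "Suc m" r]] that by simp
  have face: "signed ?H (of_nat r) (hochschild_face K S (Suc m) r (homotopy m x)) =
      (\<Oplus>\<^bsub>?H\<^esub>i\<in>{..m}. signed ?H (of_nat r + of_nat i)
        (hochschild_face K S (Suc m) r (homotopy_component m i x)))" if r: "r \<le> Suc m" for r
  proof -
    have "signed ?H (of_nat r) (hochschild_face K S (Suc m) r (homotopy m x)) =
        (\<Oplus>\<^bsub>?H\<^esub>i\<in>{..m}. signed ?H (of_nat r)
          (hochschild_face K S (Suc m) r (signed ?H' (of_nat i) (homotopy_component m i x))))"
      unfolding homotopy_def
      by (intro linear_maps_finsum[OF hochschild_module hochschild_module signed_face_linear[OF r]]
          signed_closed[OF hochschild_module] hc) simp
    also have "\<dots> = (\<Oplus>\<^bsub>?H\<^esub>i\<in>{..m}. signed ?H (of_nat r + of_nat i)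
        (hochschild_face K S (Suc m) r (homotopy_component m i x)))"
    proof (intro H.finsum_cong' refl funcsetI)
      fix i assume "i \<in> {..m}"
      then have i: "i \<le> m" by simp
      show "signed ?H (of_nat r + of_nat i)
          (hochschild_face K S (Suc m) r (homotopy_component m i x)) \<in> carrier ?H"
        by (intro signed_closed[OF hochschild_module] fc r hc i)
      have "hochschild_face K S (Suc m) r (signed ?H' (of_nat i) (homotopy_component m i x)) =
          signed ?H (of_nat i) (hochschild_face K S (Suc m) r (homotopy_component m i x))"
        using hochschild_face_linear[of "Suc m" r] r
        by (intro linear_maps_signed[OF hochschild_module hochschild_module _ hc[OF i]]) simp
      then show "signed ?H (of_nat r)
          (hochschild_face K S (Suc m) r (signed ?H' (of_nat i) (homotopy_component m i x))) =
        signed ?H (of_nat r + of_nat i) (hochschild_face K S (Suc m) r (homotopy_component m i x))"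
        by (simp add: signed_signed[OF hochschild_module fc[OF r hc[OF i]]])
    qed
    finally show ?thesis .
  qed
  show ?thesis
    unfolding hochschild_diff_Suc
    using face fc hc by (intro H.finsum_cong' refl)
      (auto intro!: H.finsum_closed signed_closed[OF hochschild_module])
qed

lemma homotopy_diff_expand:
  assumes x: "x \<in> carrier (hochschild K S (Suc m))"
  shows "homotopy m (hochschild_diff K S (Suc m) x) =
    (\<Oplus>\<^bsub>hochschild K S (Suc m)\<^esub>r\<in>{..Suc m}. \<Oplus>\<^bsub>hochschild K S (Suc m)\<^esub>i\<in>{..m}.
      signed (hochschild K S (Suc m)) (of_nat r + of_nat i)
        (homotopy_component m i (hochschild_face K S (Suc m) r x)))"
proof -
  let ?H = "hochschild K S m" and ?H' = "hochschild K S (Suc m)"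
  interpret H': module K ?H' by (rule hochschild_module)
  have fc: "hochschild_face K S (Suc m) r x \<in> carrier ?H" if "r \<le> Suc m" for r
    using linear_maps_closed[OF hochschild_face_linear[of "Suc m" r]] that x by simp
  have hc: "homotopy_component m i y \<in> carrier ?H'" if "i \<le> m" "y \<in> carrier ?H" for i y
    by (rule linear_maps_closed[OF homotopy_component_linear[OF that(1)] that(2)])
  have summand: "homotopy m (signed ?H (of_nat r) (hochschild_face K S (Suc m) r x)) =
      (\<Oplus>\<^bsub>?H'\<^esub>i\<in>{..m}. signed ?H' (of_nat r + of_nat i)
        (homotopy_component m i (hochschild_face K S (Suc m) r x)))" if r: "r \<le> Suc m" for r
    unfolding homotopy_def
  proof (intro H'.finsum_cong' refl funcsetI)
    fix i assume "i \<in> {..m}"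
    then have i: "i \<le> m" by simp
    show "signed ?H' (of_nat r + of_nat i)
        (homotopy_component m i (hochschild_face K S (Suc m) r x)) \<in> carrier ?H'"
      by (intro signed_closed[OF hochschild_module] fc r hc i)
    have "homotopy_component m i (signed ?H (of_nat r) (hochschild_face K S (Suc m) r x)) =
        signed ?H' (of_nat r) (homotopy_component m i (hochschild_face K S (Suc m) r x))"
      by (rule linear_maps_signed[OF hochschild_module hochschild_module
            homotopy_component_linear[OF i] fc[OF r]])
    then show "signed ?H' (of_nat i)
        (homotopy_component m i (signed ?H (of_nat r) (hochschild_face K S (Suc m) r x))) =
      signed ?H' (of_nat r + of_nat i) (homotopy_component m i (hochschild_face K S (Suc m) r x))"
      by (simp only: signed_signed[OF hochschild_module hc[OF i fc[OF r]]]
          add.commute[of "of_nat i" "of_nat r"])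
  qed
  have "homotopy m (hochschild_diff K S (Suc m) x) =
      (\<Oplus>\<^bsub>?H'\<^esub>r\<in>{..Suc m}. homotopy m (signed ?H (of_nat r) (hochschild_face K S (Suc m) r x)))"
    unfolding hochschild_diff_Suc
    by (intro linear_maps_finsum[OF hochschild_module hochschild_module homotopy_linear]
        signed_closed[OF hochschild_module] fc) simp
  also have "\<dots> = (\<Oplus>\<^bsub>?H'\<^esub>r\<in>{..Suc m}. \<Oplus>\<^bsub>?H'\<^esub>i\<in>{..m}. signed ?H' (of_nat r + of_nat i)
        (homotopy_component m i (hochschild_face K S (Suc m) r x)))"
    using summand fc hc by (intro H'.finsum_cong' refl)
      (auto intro!: H'.finsum_closed signed_closed[OF hochschild_module])
  finally show ?thesis .
qed

lemma homotopy_identity_elementary: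
  assumes d: "elem_data m u v a e"
  shows "hochschild_diff K S (Suc m) (homotopy m (elementary_tensor m u v a)) \<oplus>\<^bsub>hochschild K S m\<^esub>
      (if m = 0 then \<zero>\<^bsub>hochschild K S m\<^esub>
       else homotopy (m - 1) (hochschild_diff K S m (elementary_tensor m u v a))) =
    elementary_tensor m u v a \<ominus>\<^bsub>hochschild K S m\<^esub>
      Inc K p q R m (Str K p q R m (elementary_tensor m u v a))"
proof -
  let ?H = "hochschild K S m"
  interpret H: module K ?H by (rule hochschild_module)
  let ?T = "elementary_tensor m u v a"
  have T: "?T \<in> carrier ?H" by (rule elem_closed[OF d])
  let ?X = "\<lambda>r i. hochschild_face K S (Suc m) r (homotopy_component m i ?T)"
  let ?Y = "\<lambda>i r. homotopy_component (m - 1) i (hochschild_face K S m r ?T)"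
  have X: "?X r i \<in> carrier ?H" if "r \<le> Suc m" "i \<le> m" for r i
    using that linear_maps_closed[OF hochschild_face_linear[of "Suc m" r]]
      linear_maps_closed[OF homotopy_component_linear T] by simp
  have Y: "?Y i r \<in> carrier ?H" if "i < m" "r \<le> m" for i r
    using that T linear_maps_closed[OF hochschild_face_linear[of m r]]
      linear_maps_closed[OF homotopy_component_linear[of i "m - 1"]] by simp
  have second: "(if m = 0 then \<zero>\<^bsub>?H\<^esub> else homotopy (m - 1) (hochschild_diff K S m ?T)) =
      (\<Oplus>\<^bsub>?H\<^esub>r\<in>{..m}. \<Oplus>\<^bsub>?H\<^esub>i\<in>{..<m}. signed ?H (of_nat r + of_nat i) (?Y i r))"
  proof (cases m)
    case (Suc m')
    then show ?thesis
      using homotopy_diff_expand[of ?T m'] T by (simp add: lessThan_Suc_atMost)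
  next
    case 0
    then have empty: "{..<m} = {}" by simp
    show ?thesis
      unfolding if_P[OF 0] empty H.finsum_empty H.finsum_zero by (rule refl)
  qed
  have low: "?X r (Suc i) = ?Y i r" if "r \<le> i" "i < m" for r i
    using that d face_homotopy_low[of "m - 1" u v a e r i] by (cases m) auto
  have high: "?X (Suc r) i = ?Y i r" if "i < r" "r \<le> m" for r i
  proof (cases m)
    case (Suc m')
    show ?thesis
    proof (cases "r = m")
      case True
      then show ?thesis using that Suc d face_homotopy_last[of m' u v a e i] by simp
    next
      case False
      then show ?thesis using that Suc d face_homotopy_high[of m' u v a e i r] by simp
    qed
  qed (use that in simp)
  have cancel: "(\<Oplus>\<^bsub>?H\<^esub>r\<in>{..Suc m}. \<Oplus>\<^bsub>?H\<^esub>i\<in>{..m}. signed ?H (of_nat r + of_nat i) (?X r i)) \<oplus>\<^bsub>?H\<^esub>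
      (\<Oplus>\<^bsub>?H\<^esub>r\<in>{..m}. \<Oplus>\<^bsub>?H\<^esub>i\<in>{..<m}. signed ?H (of_nat r + of_nat i) (?Y i r)) =
    ?X 0 0 \<ominus>\<^bsub>?H\<^esub> ?X (Suc m) m"
    using hochschild_module X Y low face_homotopy_diagonal[OF d] high
    by (rule presimplicial_homotopy_cancellation)
  show ?thesis
    unfolding second diff_homotopy_expand[OF T] cancel face_homotopy_first[OF d]
      face_homotopy_corner[OF d] by (rule refl)
qed

lemma elementary_lists:
  assumes "length As = Suc m"
    and "set As \<subseteq> {E i j a | i j a. i < n \<and> j < n \<and> (\<exists>e. a \<in> homog R e)}"
  obtains u v a e where "elem_data m u v a e" "tensor K S As = elementary_tensor m u v a"
proof -
  have "\<forall>s. \<exists>i j a e. s \<le> m \<longrightarrow> i < n \<and> j < n \<and> a \<in> homog R e \<and> As ! s = E i j a"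
  proof
    fix s
    have "As ! s \<in> set As" if "s \<le> m" using that assms(1) by simp
    then show "\<exists>i j a e. s \<le> m \<longrightarrow> i < n \<and> j < n \<and> a \<in> homog R e \<and> As ! s = E i j a"
      using assms(2) by blast
  qed
  then obtain u v a e where
    *: "\<forall>s. s \<le> m \<longrightarrow> u s < n \<and> v s < n \<and> a s \<in> homog R (e s) \<and> As ! s = E (u s) (v s) (a s)"
    unfolding choice_iff by blast
  have "As = map (\<lambda>s. E (u s) (v s) (a s)) [0..<Suc m]"
    using * assms(1) by (intro nth_equalityI) (simp_all add: less_Suc_eq_le del: upt_Suc)
  then show thesis
    using that[of u v a e] * by (simp add: elem_data_def elementary_tensor_def del: upt_Suc)
qed

text \<open>Both sides are linear in \<open>x\<close>, the difference being written as a signed sum, and agree on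
  elementary tensors.\<close>

lemma homotopy_identity:
  assumes x: "x \<in> carrier (hochschild K S m)"
  shows "hochschild_diff K S (Suc m) (homotopy m x) \<oplus>\<^bsub>hochschild K S m\<^esub>
      (if m = 0 then \<zero>\<^bsub>hochschild K S m\<^esub> else homotopy (m - 1) (hochschild_diff K S m x)) =
    x \<ominus>\<^bsub>hochschild K S m\<^esub> Inc K p q R m (Str K p q R m x)"
proof -
  let ?H = "hochschild K S m"
  let ?f = "\<lambda>x. hochschild_diff K S (Suc m) (homotopy m x) \<oplus>\<^bsub>?H\<^esub>
      (if m = 0 then \<zero>\<^bsub>?H\<^esub> else homotopy (m - 1) (hochschild_diff K S m x))"
  let ?g = "\<lambda>x. x \<oplus>\<^bsub>?H\<^esub> signed ?H 1 (Inc K p q R m (Str K p q R m x))"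
  have hd: "(\<lambda>x. if m = 0 then \<zero>\<^bsub>?H\<^esub> else homotopy (m - 1) (hochschild_diff K S m x))
      \<in> linear_maps K ?H ?H"
  proof (cases m)
    case 0
    then show ?thesis using zero_linear[OF hochschild_module] by simp
  next
    case (Suc m')
    then show ?thesis using linear_maps_compose[OF hochschild_diff_linear homotopy_linear] by simp
  qed
  have f: "?f \<in> linear_maps K ?H ?H"
    by (intro add_linear_maps hochschild_module hd
        linear_maps_compose[OF homotopy_linear hochschild_diff_linear])
  have g: "?g \<in> linear_maps K ?H ?H"
    by (intro add_linear_maps hochschild_module linear_maps_id
        linear_maps_compose[OF linear_maps_compose[OF Str_linear Inc_linear]
          signed_linear[OF hochschild_module]])
  have "?f x = ?g x"
  proof (rule linear_maps_eq_on_generators[where f = ?f and g = ?g and n = "Suc m",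
        OF matrix_module hochschild_module elementary_generates])
    show "?f \<in> linear_maps K (tensor_power K S (Suc m)) ?H" "?g \<in> linear_maps K (tensor_power K S (Suc m)) ?H"
      "x \<in> carrier (tensor_power K S (Suc m))"
      using f g x by (simp_all only: hochschild_def)
    fix As assume "length As = Suc m"
      "set As \<subseteq> {E i j a | i j a. i < n \<and> j < n \<and> (\<exists>e. a \<in> homog R e)}"
    then obtain u v a e where d: "elem_data m u v a e" and T: "tensor K S As = elementary_tensor m u v a"
      by (rule elementary_lists)
    show "?f (tensor K S As) = ?g (tensor K S As)"
      unfolding T using homotopy_identity_elementary[OF d] by (simp add: a_minus_def signed_def)
  qed
  then show ?thesis by (simp add: a_minus_def signed_def)
qed

end

theorem theorem2:
  fixes K :: "'k ring" and R :: "('k, 'a) superalgebra" and p q :: nat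
  assumes "superalgebra K R" and "p \<ge> 1"
  defines "S \<equiv> matrix_superalgebra p q R"
  shows "\<exists>h :: nat \<Rightarrow> ('a mat list \<Rightarrow> 'k) set \<Rightarrow> ('a mat list \<Rightarrow> 'k) set.
    (\<forall>m. h m \<in> linear_maps K (hochschild K S m) (hochschild K S (Suc m))) \<and>
    (\<forall>m. \<forall>x\<in>carrier (hochschild K S m).
       hochschild_diff K S (Suc m) (h m x) \<oplus>\<^bsub>hochschild K S m\<^esub>
         (if m = 0 then \<zero>\<^bsub>hochschild K S m\<^esub> else h (m - 1) (hochschild_diff K S m x))
       = x \<ominus>\<^bsub>hochschild K S m\<^esub> Inc K p q R m (Str K p q R m x))"
proof -
  interpret supermatrices_pos K R p q
    by (intro supermatrices_pos.intro supermatrices.intro supermatrices_pos_axioms.intro assms(1,2))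
  show ?thesis
    unfolding S_def using homotopy_linear homotopy_identity by blast
qed

end
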